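(* Let $\mathfrak g$ be simple of rank $r$ with highest root $\theta$ and Coxeter number $h$. Then $$\sum_{\mu}\mathfrak m_\theta^\mu(q)=\mathfrak m_\theta^0(q)\bigl(\mathfrak m_\theta^0(q)-r+1\bigr)+\frac{\mathfrak m_\theta^0(q)}{q}\cdot\frac{1-q^h}{1-q},$$ where the sum is over the distinct weights $\mu\in\Delta\cup\{0\}$ of $\mathfrak g=V_\theta$; equivalently, $$\sum_{\mu} m_\theta^\mu\,\mathfrak m_\theta^\mu(q)=\mathfrak m_\theta^0(q)^2+\frac{\mathfrak m_\theta^0(q)}{q}\cdot\frac{1-q^h}{1-q},$$ where $m_\theta^\mu=\dim\mathfrak g^\mu$ (so $m_\theta^\mu=1$ for $\mu\in\Delta$ and $m_\theta^0=r$).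
   Context: Let $\mathfrak g$ be a semisimple Lie algebra over an algebraically closed field of characteristic zero, with Cartan subalgebra $\mathfrak t$, root system $\Delta$, positive roots $\Delta^+$, simple roots $\Pi=\{\alpha_1,\dots,\alpha_r\}$, $\rho=\frac12\sum_{\gamma\in\Delta^+}\gamma$, integral weight lattice $\mathfrak X$, dominant weights $\mathfrak X_+$, root lattice $Q$, and $Q_+$ the monoid generated by $\Pi$. The Weyl group is $W$, with length function $\ell$ and sign $\varepsilon(w)=(-1)^{\ell(w)}$. Define polynomials $\mathcal P_q(\mu)\in\mathbb Z[q]$ by $\prod_{\alpha\in\Delta^+}(1-qe^{\alpha})^{-1}=\sum_{\mu\in Q_+}\mathcal P_q(\mu)e^\mu$, and $\mathcal P_q(\mu)=0$ for $\mu\notin Q_+$. For $\lambda\in\mathfrak X_+$ and any $\mu\in\mathfrak X$, Lusztig's $q$-analogue of weight multiplicity is $\mathfrak m_\lambda^\mu(q)=\sum_{w\in W}\varepsilon(w)\mathcal P_q(w(\lambda+\rho)-(\mu+\rho))$; $m_\lambda^\mu$ denotes the dimension of the $\mu$-weight space of the simple module $V_\lambda$. $h$ is the Coxeter number of $\mathfrak g$ ($h-1=\mathrm{ht}(\theta)$). *)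

theory Defs
  imports "HOL-Analysis.Analysis" "HOL-Computational_Algebra.Polynomial"
begin

definition refl :: "'a::euclidean_space \<Rightarrow> 'a \<Rightarrow> 'a" where
  "refl \<alpha> x = x - ((2 * (x \<bullet> \<alpha>)) / (\<alpha> \<bullet> \<alpha>)) *\<^sub>R \<alpha>"

definition root_system :: "'a::euclidean_space set \<Rightarrow> bool" where
  "root_system R \<longleftrightarrow> finite R \<and> 0 \<notin> R
     \<and> (\<forall>\<alpha>\<in>R. \<forall>\<beta>\<in>R. refl \<alpha> \<beta> \<in> R)
     \<and> (\<forall>\<alpha>\<in>R. \<forall>\<beta>\<in>R. (2 * (\<beta> \<bullet> \<alpha>)) / (\<alpha> \<bullet> \<alpha>) \<in> \<int>)
     \<and> (\<forall>\<alpha>\<in>R. \<forall>c::real. c *\<^sub>R \<alpha> \<in> R \<longrightarrow> c = 1 \<or> c = -1)"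

text \<open>Irreducible root system (= root system of a simple Lie algebra).\<close>
definition irreducible_rs :: "'a::euclidean_space set \<Rightarrow> bool" where
  "irreducible_rs R \<longleftrightarrow> R \<noteq> {} \<and>
     \<not> (\<exists>A B. A \<union> B = R \<and> A \<noteq> {} \<and> B \<noteq> {} \<and> (\<forall>a\<in>A. \<forall>b\<in>B. a \<bullet> b = 0))"

definition Qplus :: "'a::euclidean_space set \<Rightarrow> 'a set" where
  "Qplus S = {x. \<exists>c::'a \<Rightarrow> nat. x = (\<Sum>\<alpha>\<in>S. real (c \<alpha>) *\<^sub>R \<alpha>)}"

definition is_base :: "'a::euclidean_space set \<Rightarrow> 'a set \<Rightarrow> bool" where
  "is_base R S \<longleftrightarrow> S \<subseteq> R \<and> independent S \<and>
     (\<forall>\<beta>\<in>R. \<beta> \<in> Qplus S \<or> - \<beta> \<in> Qplus S)"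

definition pos_roots :: "'a::euclidean_space set \<Rightarrow> 'a set \<Rightarrow> 'a set" where
  "pos_roots R S = R \<inter> Qplus S"

definition rho :: "'a::euclidean_space set \<Rightarrow> 'a set \<Rightarrow> 'a" where
  "rho R S = (1/2) *\<^sub>R (\<Sum>\<gamma>\<in>pos_roots R S. \<gamma>)"

definition height :: "'a::euclidean_space set \<Rightarrow> 'a \<Rightarrow> nat" where
  "height S x = (THE n. \<exists>c::'a \<Rightarrow> nat. x = (\<Sum>\<alpha>\<in>S. real (c \<alpha>) *\<^sub>R \<alpha>) \<and> sum c S = n)"

definition highest_root :: "'a::euclidean_space set \<Rightarrow> 'a set \<Rightarrow> 'a \<Rightarrow> bool" where
  "highest_root R S \<theta> \<longleftrightarrow> \<theta> \<in> R \<and> (\<forall>\<beta>\<in>R. \<theta> - \<beta> \<in> Qplus S)"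

definition coxeter_number :: "'a::euclidean_space set \<Rightarrow> 'a \<Rightarrow> nat" where
  "coxeter_number S \<theta> = height S \<theta> + 1"

definition weyl_word :: "'a::euclidean_space list \<Rightarrow> 'a \<Rightarrow> 'a" where
  "weyl_word ws = foldr (\<lambda>\<alpha> f. refl \<alpha> \<circ> f) ws id"

definition weyl_group :: "'a::euclidean_space set \<Rightarrow> ('a \<Rightarrow> 'a) set" where
  "weyl_group S = {weyl_word ws | ws. set ws \<subseteq> S}"

definition weyl_length :: "'a::euclidean_space set \<Rightarrow> ('a \<Rightarrow> 'a) \<Rightarrow> nat" where
  "weyl_length S w = (LEAST n. \<exists>ws. set ws \<subseteq> S \<and> length ws = n \<and> w = weyl_word ws)"

definition weyl_sign :: "'a::euclidean_space set \<Rightarrow> ('a \<Rightarrow> 'a) \<Rightarrow> int" where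
  "weyl_sign S w = (-1) ^ weyl_length S w"

text \<open>\<open>\<P>_q(\<mu>)\<close>: coefficient of \<open>e^\<mu>\<close> in \<open>\<Prod>_{\<alpha>>0} (1 - q e^\<alpha>)^{-1}\<close>,
  i.e. the sum of \<open>q^{\<Sum> k_\<alpha>}\<close> over all \<open>k : \<Delta>^+ \<rightarrow> \<nat>\<close> with \<open>\<Sum> k_\<alpha> \<alpha> = \<mu>\<close>
  (this set is finite; it is empty, giving 0, when \<open>\<mu> \<notin> Q_+\<close>).\<close>
definition kostant_q :: "'a::euclidean_space set \<Rightarrow> 'a set \<Rightarrow> 'a \<Rightarrow> int poly" where
  "kostant_q R S \<mu> =
     (\<Sum>k\<in>{k::'a \<Rightarrow> nat. (\<forall>x. x \<notin> pos_roots R S \<longrightarrow> k x = 0) \<and>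
                 (\<Sum>\<alpha>\<in>pos_roots R S. real (k \<alpha>) *\<^sub>R \<alpha>) = \<mu>}.
        monom 1 (\<Sum>\<alpha>\<in>pos_roots R S. k \<alpha>))"

definition lusztig_q :: "'a::euclidean_space set \<Rightarrow> 'a set \<Rightarrow> 'a \<Rightarrow> 'a \<Rightarrow> int poly" where
  "lusztig_q R S lam \<mu> =
     (\<Sum>w\<in>weyl_group S. smult (weyl_sign S w)
        (kostant_q R S (w (lam + rho R S) - (\<mu> + rho R S))))"

end

theory Submission
  imports Defs
begin

text \<open>
  Write \<open>L \<lambda> \<mu>\<close> for Lusztig's polynomial. Splitting off a simple root from the partition function
  gives Demazure-Lusztig relations between the values of \<open>L \<lambda>\<close> along root strings. They show
  \<open>L 0 (- \<gamma>) = q\<^bsup>ht \<gamma> - 1\<^esup> (q - 1)\<close> and \<open>L \<theta> \<gamma> = q\<^bsup>ht \<theta> - ht \<gamma>\<^esup>\<close> for positive roots \<open>\<gamma>\<close>, and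
  express \<open>L \<theta> (- \<gamma>)\<close> through \<open>A = L \<theta> 0\<close>. Expanding the character of the adjoint module into weights
  yields \<open>A = r - (1 - q) H\<close> with \<open>H = \<Sum>\<gamma>>0. q\<^bsup>ht \<gamma> - 1\<^esup>\<close>.

  The identity then reduces to the duality \<open>N\<^bsub>j+1\<^esub> + N\<^bsub>h-j\<^esub> = r\<close> for the numbers \<open>N\<^sub>j\<close> of roots of height \<open>j\<close>.
  As there are \<open>r h\<close> roots, an inequality suffices. It follows from Kostant's cyclic element: a weighted
  sum of raising operators for the affine simple roots commutes with its adjoint, so its rank is the same
  in every degree modulo \<open>h\<close> and at most \<open>r\<close>, while its part from the simple roots is surjective in
  positive and injective in negative degrees. Only the coefficients of these operators on root vectors are
  needed: up to signs they are square roots of string lengths, and the signs come from a two-colouring of the affine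
  diagram or, for simply laced systems, from a bilinear cocycle.
\<close>

section \<open>Root systems with a base\<close>

text \<open>Let H and K be the sums of q^(ht - 1) and q^(N - ht) over the positive roots, N = ht
  \<theta>. The values at the roots add up to K + q^N H + H (q - 1) A. As (q - 1) H = A - r, the
  last term is A (A - r); the rest must be (A / q)(1 - q^h)/(1 - q), which follows from H + q K = r
  (1 + q + ... + q^N), the duality in generating form. No Lie algebra is built. The cyclic operator
  acts on functions on \<open>R\<close>, so paths through the zero weight space are missing and
  commutation with the adjoint fails at heights congruent to 1 or -1 modulo h. Elsewhere commutation
  gives an operator and its square the same kernel; hence lowering step by step to height 1 modulo h
  loses nothing after the first step. There an explicit formula replaces the missing path by a map
  into the span of \<open>S\<close>, whence the bound r. The blocks from height j to j + 1 and from
  j - h to j + 1 - h contribute N_{j+1} and N_{h-j} to the rank.\<close>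

definition cint :: "'a::euclidean_space \<Rightarrow> 'a \<Rightarrow> real" where
  "cint x a = 2 * (x \<bullet> a) / (a \<bullet> a)"

lemma refl_cint: "refl a x = x - cint x a *\<^sub>R a"
  by (simp add: refl_def cint_def)

lemma linear_refl: "linear (refl a)"
  by (rule linearI) (simp_all add: refl_def algebra_simps add_divide_distrib)

lemma refl_0 [simp]: "refl a 0 = 0"
  and refl_add: "refl a (x + y) = refl a x + refl a y"
  and refl_diff: "refl a (x - y) = refl a x - refl a y"
  and refl_minus: "refl a (- x) = - refl a x"
  and refl_scaleR: "refl a (c *\<^sub>R x) = c *\<^sub>R refl a x"
  and refl_sum: "refl a (sum f A) = (\<Sum>i\<in>A. refl a (f i))"
  using linear_refl[of a]
  by (simp_all add: linear_0 linear_add linear_diff linear_neg linear_scale linear_sum)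

lemma refl_self [simp]: "refl a a = - a"
  by (cases "a = 0") (simp_all add: refl_def scaleR_2)

lemma refl_refl [simp]: "refl a (refl a x) = x"
  by (cases "a = 0") (simp_all add: refl_def algebra_simps inner_diff_left)

lemma refl_inner: "refl a x \<bullet> refl a y = x \<bullet> y"
  by (cases "a = 0")
    (simp_all add: refl_def inner_diff_left inner_diff_right inner_commute field_simps power2_eq_square)

lemma refl_comp_refl [simp]: "refl a \<circ> refl a = id"
  by (rule ext) simp

lemma refl_conj:
  assumes "linear w" "\<And>x y. w x \<bullet> w y = x \<bullet> y"
  shows "refl (w a) (w x) = w (refl a x)"
  using assms by (simp add: refl_def linear_diff linear_scale)

lemma independent_functional:
  fixes S :: "'a::euclidean_space set"
  assumes "independent S"
  shows "\<exists>v. \<forall>a\<in>S. a \<bullet> v = g a"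
proof -
  obtain f where f: "linear f" "\<forall>x\<in>S. f x = g x"
    using linear_independent_extend[OF assms, of g] by blast
  define v where "v = (\<Sum>b\<in>Basis. f b *\<^sub>R b)"
  have "f x = x \<bullet> v" for x
  proof -
    have "f x = f (\<Sum>b\<in>Basis. (x \<bullet> b) *\<^sub>R b)" by (simp add: euclidean_representation)
    also have "\<dots> = (\<Sum>b\<in>Basis. (x \<bullet> b) * f b)"
      using f(1) by (simp add: linear_sum linear_scale)
    also have "\<dots> = x \<bullet> v" by (simp add: v_def inner_sum_right mult.commute)
    finally show ?thesis .
  qed
  then show ?thesis using f(2) by metis
qed

locale based_roots =
  fixes R S :: "'a::euclidean_space set"
  assumes rs: "root_system R" and base: "is_base R S"
begin

lemma finite_R: "finite R" and root_nonzero: "a \<in> R \<Longrightarrow> a \<noteq> 0"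
  using rs by (auto simp: root_system_def)

lemma refl_root: "a \<in> R \<Longrightarrow> b \<in> R \<Longrightarrow> refl a b \<in> R"
  using rs by (auto simp: root_system_def)

lemma cint_Ints: "a \<in> R \<Longrightarrow> b \<in> R \<Longrightarrow> cint a b \<in> \<int>"
  using rs by (auto simp: root_system_def cint_def)

lemma root_multiple: "a \<in> R \<Longrightarrow> c *\<^sub>R a \<in> R \<Longrightarrow> c = 1 \<or> c = -1"
  using rs by (auto simp: root_system_def)

lemma root_inner_pos: "a \<in> R \<Longrightarrow> a \<bullet> a > 0"
  using root_nonzero by simp

lemma uminus_root [intro]: "a \<in> R \<Longrightarrow> - a \<in> R"
  using refl_root[of a a] by simp

lemma uminus_root_iff [simp]: "- a \<in> R \<longleftrightarrow> a \<in> R"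
  using uminus_root[of a] uminus_root[of "- a"] by auto

lemma refl_root_iff: "a \<in> R \<Longrightarrow> refl a b \<in> R \<longleftrightarrow> b \<in> R"
  by (metis refl_refl refl_root)

lemma cint_self [simp]: "a \<in> R \<Longrightarrow> cint a a = 2"
  using root_inner_pos[of a] by (simp add: cint_def)

lemma root_diff_commute: "a - b \<in> R \<longleftrightarrow> b - a \<in> R"
  using uminus_root_iff[of "a - b"] by simp

lemma strict_Cauchy_roots:
  assumes "a \<in> R" "b \<in> R" "a \<noteq> b" "a \<noteq> - b"
  shows "(a \<bullet> b)\<^sup>2 < (a \<bullet> a) * (b \<bullet> b)"
proof -
  define c where "c = (a \<bullet> b) / (b \<bullet> b)"
  have b: "b \<bullet> b > 0" using root_inner_pos assms by blast
  have "a - c *\<^sub>R b \<noteq> 0"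
  proof
    assume "a - c *\<^sub>R b = 0"
    then have ac: "a = c *\<^sub>R b" by simp
    then have "c = 1 \<or> c = -1" using root_multiple assms by auto
    then show False using ac assms by auto
  qed
  then have "(a - c *\<^sub>R b) \<bullet> (a - c *\<^sub>R b) > 0" by simp
  also have "(a - c *\<^sub>R b) \<bullet> (a - c *\<^sub>R b) = a \<bullet> a - (a \<bullet> b)\<^sup>2 / (b \<bullet> b)"
    using b by (simp add: c_def inner_diff_left inner_diff_right inner_commute power2_eq_square field_simps)
  finally show ?thesis using b by (simp add: field_simps)
qed

lemma cint_product_less:
  assumes "a \<in> R" "b \<in> R" "a \<noteq> b" "a \<noteq> - b"
  shows "cint a b * cint b a < 4"
proof -
  have "cint a b * cint b a = 4 * ((a \<bullet> b)\<^sup>2 / ((a \<bullet> a) * (b \<bullet> b)))"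
    by (simp add: cint_def inner_commute power2_eq_square)
  also have "(a \<bullet> b)\<^sup>2 / ((a \<bullet> a) * (b \<bullet> b)) < 1"
    using strict_Cauchy_roots[OF assms] root_inner_pos assms by (simp add: divide_less_eq)
  finally show ?thesis by simp
qed

lemma cint_obtain:
  assumes "a \<in> R" "b \<in> R"
  obtains m :: int where "cint a b = of_int m"
  using cint_Ints[OF assms] by (auto elim: Ints_cases)

lemma root_diff_ne: assumes "a \<in> R" "g \<in> R" shows "g - a \<noteq> a"
proof
  assume "g - a = a"
  then have "g = 2 *\<^sub>R a" by (simp add: scaleR_2 diff_eq_eq)
  then show False using root_multiple[OF assms(1), of 2] assms(2) by simp
qed

text \<open>Both Cartan integers are \<open>2 * (a \<bullet> b)\<close> measured in different
  positive units, so they agree in sign; strict Cauchy-Schwarz keeps their product below 4.\<close>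

lemma cint_pair:
  assumes ab: "a \<in> R" "b \<in> R" "a \<noteq> b" "a \<noteq> - b" "a \<bullet> b \<noteq> 0"
  obtains m n :: int where "cint a b = of_int m" "cint b a = of_int n"
    "of_int m * (b \<bullet> b) = 2 * (a \<bullet> b)" "of_int n * (a \<bullet> a) = 2 * (a \<bullet> b)" "1 \<le> m * n" "m * n \<le> 3"
proof -
  obtain m where m: "cint a b = of_int m" using cint_obtain ab by blast
  obtain n where n: "cint b a = of_int n" using cint_obtain ab by blast
  have p: "a \<bullet> a > 0" "b \<bullet> b > 0" using root_inner_pos ab by auto
  have e: "of_int m * (b \<bullet> b) = 2 * (a \<bullet> b)" "of_int n * (a \<bullet> a) = 2 * (a \<bullet> b)"
    using m n p by (simp_all add: cint_def inner_commute field_simps)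
  have "of_int (m * n) * ((a \<bullet> a) * (b \<bullet> b)) = (2 * (a \<bullet> b)) * (2 * (a \<bullet> b))"
    using e by (metis mult.assoc mult.commute of_int_mult)
  also have "\<dots> > 0" using ab(5) by (auto simp: zero_less_mult_iff)
  finally have "real_of_int (m * n) > 0" using p by (metis mult_pos_pos zero_less_mult_pos2)
  then have "1 \<le> m * n" by linarith
  moreover have "real_of_int (m * n) < 4" using cint_product_less[OF ab(1-4)] m n by simp
  then have "m * n \<le> 3" by linarith
  ultimately show ?thesis using that m n e by blast
qed

text \<open>Two positive integers with product at most 3 include a 1, and the corresponding
  reflection is then the subtraction.\<close>

lemma diff_root:
  assumes ab: "a \<in> R" "b \<in> R" and pos: "a \<bullet> b > 0" and ne: "a \<noteq> b"
  shows "a - b \<in> R"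
proof -
  have ne': "a \<noteq> - b" using pos root_inner_pos[OF ab(2)] by (metis inner_minus_left neg_0_less_iff_less less_asym)
  obtain m n :: int where mn: "cint a b = of_int m" "cint b a = of_int n" "m * n \<le> 3"
    using cint_pair[OF ab ne ne'] pos by (metis less_irrefl)
  have "cint a b > 0" "cint b a > 0"
    using pos ab root_inner_pos by (simp_all add: cint_def inner_commute)
  then have pos': "m > 0" "n > 0" using mn by simp_all
  have "m = 1 \<or> n = 1"
  proof (rule ccontr)
    assume "\<not> ?thesis"
    then have "m \<ge> 2" "n \<ge> 2" using pos' by auto
    then have "2 * 2 \<le> m * n" by (intro mult_mono) auto
    then show False using mn by simp
  qed
  then show ?thesis
  proof
    assume "m = 1"
    then show ?thesis using refl_root[OF ab(2,1)] mn by (simp add: refl_cint)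
  next
    assume "n = 1"
    then have "b - a \<in> R" using refl_root[OF ab] mn by (simp add: refl_cint)
    then show ?thesis by (simp add: root_diff_commute)
  qed
qed

lemma add_root:
  assumes "a \<in> R" "b \<in> R" "a \<bullet> b < 0" "a \<noteq> - b"
  shows "a + b \<in> R"
  using diff_root[of a "- b"] assms by auto

section \<open>Coordinates with respect to the base\<close>

lemma S_subset: "S \<subseteq> R" and S_indep: "independent S"
  using base by (auto simp: is_base_def)

lemma S_root: "a \<in> S \<Longrightarrow> a \<in> R"
  using S_subset by blast

lemma finite_S: "finite S"
  using S_subset finite_R finite_subset by blast

text \<open>A dual basis of \<open>S\<close>, determined only up to vectors orthogonal to
  \<open>S\<close>; it reads off coordinates on the span.\<close>

definition dualv :: "'a \<Rightarrow> 'a" where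
  "dualv a = (SOME v. \<forall>b\<in>S. b \<bullet> v = (if b = a then 1 else 0))"

lemma inner_dualv: "b \<in> S \<Longrightarrow> b \<bullet> dualv a = (if b = a then 1 else 0)"
  unfolding dualv_def
  using someI_ex[OF independent_functional[OF S_indep, of "\<lambda>b. if b = a then 1 else 0"]] by auto

lemma sum_inner_dualv:
  "a \<in> S \<Longrightarrow> (\<Sum>b\<in>S. c b *\<^sub>R b) \<bullet> dualv a = c a"
  using finite_S by (simp add: inner_sum_left inner_dualv if_distrib cong: if_cong)

lemma Qplus_0: "0 \<in> Qplus S"
  unfolding Qplus_def by (auto intro: exI[of _ "\<lambda>_. 0"])

lemma Qplus_add: "x \<in> Qplus S \<Longrightarrow> y \<in> Qplus S \<Longrightarrow> x + y \<in> Qplus S"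
  unfolding Qplus_def
proof clarsimp
  fix c d :: "'a \<Rightarrow> nat"
  show "\<exists>e. (\<Sum>\<alpha>\<in>S. real (c \<alpha>) *\<^sub>R \<alpha>) + (\<Sum>\<alpha>\<in>S. real (d \<alpha>) *\<^sub>R \<alpha>) = (\<Sum>\<alpha>\<in>S. real (e \<alpha> ) *\<^sub>R \<alpha>)"
    by (rule exI[of _ "\<lambda>a. c a + d a"]) (simp add: sum.distrib scaleR_add_left)
qed

lemma Qplus_simple: "a \<in> S \<Longrightarrow> a \<in> Qplus S"
  unfolding Qplus_def using finite_S
  by (auto intro!: exI[of _ "\<lambda>b. if b = a then 1 else 0"] simp: if_distrib[of real] if_distrib[of "\<lambda>c. c *\<^sub>R _"] cong: if_cong)

lemma Qplus_sum: "(\<And>i. i \<in> A \<Longrightarrow> f i \<in> Qplus S) \<Longrightarrow> sum f A \<in> Qplus S"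
  by (induction A rule: infinite_finite_induct) (auto simp: Qplus_0 Qplus_add)

lemma Qplus_scale: "x \<in> Qplus S \<Longrightarrow> real n *\<^sub>R x \<in> Qplus S"
  by (induction n) (auto simp: Qplus_0 Qplus_add scaleR_add_left)

lemma Qplus_expand: "x \<in> Qplus S \<Longrightarrow> x = (\<Sum>a\<in>S. (x \<bullet> dualv a) *\<^sub>R a)"
  unfolding Qplus_def by (auto simp: sum_inner_dualv intro!: sum.cong)

lemma Qplus_coord: "x \<in> Qplus S \<Longrightarrow> a \<in> S \<Longrightarrow> x \<bullet> dualv a \<in> \<nat>"
  unfolding Qplus_def by (auto simp: sum_inner_dualv)

lemma Qplus_coord_nonneg: "x \<in> Qplus S \<Longrightarrow> a \<in> S \<Longrightarrow> x \<bullet> dualv a \<ge> 0"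
  using Qplus_coord[of x a] by (auto simp: Nats_def)

lemma Qplus_antisym:
  assumes "x \<in> Qplus S" "- x \<in> Qplus S" shows "x = 0"
proof -
  have "x \<bullet> dualv a = 0" if "a \<in> S" for a
    using Qplus_coord_nonneg[OF assms(1) that] Qplus_coord_nonneg[OF assms(2) that] by simp
  then show ?thesis by (subst Qplus_expand[OF assms(1)]) simp
qed

abbreviation P where "P \<equiv> pos_roots R S"

lemma pos_root: "g \<in> P \<Longrightarrow> g \<in> R" and pos_Qplus: "g \<in> P \<Longrightarrow> g \<in> Qplus S"
  by (auto simp: pos_roots_def)

lemma finite_P: "finite P"
  using finite_R by (auto simp: pos_roots_def)

lemma simple_pos: "a \<in> S \<Longrightarrow> a \<in> P"
  using Qplus_simple S_root by (auto simp: pos_roots_def)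

lemma root_cases: "g \<in> R \<Longrightarrow> g \<in> P \<or> - g \<in> P"
  using base by (auto simp: pos_roots_def is_base_def)

lemma pos_not_neg: "g \<in> P \<Longrightarrow> - g \<notin> P"
  using Qplus_antisym root_nonzero by (auto simp: pos_roots_def)

lemma R_split: "R = P \<union> uminus ` P" "P \<inter> uminus ` P = {}"
proof -
  show "R = P \<union> uminus ` P"
  proof
    show "R \<subseteq> P \<union> uminus ` P"
    proof
      fix g assume "g \<in> R"
      then consider "g \<in> P" | "- g \<in> P" using root_cases by blast
      then show "g \<in> P \<union> uminus ` P"
        by cases (simp, metis UnI2 image_eqI minus_minus)
    qed
    show "P \<union> uminus ` P \<subseteq> R" using pos_root by auto
  qed
  show "P \<inter> uminus ` P = {}" using pos_not_neg by fastforce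
qed

lemma sum_R_split: "sum f R = sum f P + (\<Sum>g\<in>P. f (- g))" for f :: "'a \<Rightarrow> 'b::comm_monoid_add"
proof -
  have "sum f R = sum f P + sum f (uminus ` P)"
    using R_split finite_P by (metis finite_imageI sum.union_disjoint)
  also have "sum f (uminus ` P) = (\<Sum>g\<in>P. f (- g))"
    by (subst sum.reindex) (auto simp: inj_on_def)
  finally show ?thesis .
qed

text \<open>Only the \<open>a\<close>-coordinate changes. Were the new root negative, the other
  coordinates of \<open>g\<close> would vanish, making \<open>g\<close> a multiple of
  \<open>a\<close>.\<close>

lemma pos_minus_simple:
  assumes g: "g \<in> P" and a: "a \<in> S" and ga: "g - c *\<^sub>R a \<in> R" and ne: "g \<noteq> a"
  shows "g - c *\<^sub>R a \<in> P"
proof (rule ccontr)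
  assume "g - c *\<^sub>R a \<notin> P"
  then have n: "- (g - c *\<^sub>R a) \<in> Qplus S" using root_cases[OF ga] pos_Qplus by blast
  have "g \<bullet> dualv b = 0" if "b \<in> S" "b \<noteq> a" for b
    using Qplus_coord_nonneg[OF n that(1)] Qplus_coord_nonneg[OF pos_Qplus[OF g] that(1)] that a
    by (simp add: inner_diff_left inner_minus_left inner_dualv)
  then have "(\<Sum>b\<in>S. (g \<bullet> dualv b) *\<^sub>R b) = (\<Sum>b\<in>S. if b = a then (g \<bullet> dualv a) *\<^sub>R a else 0)"
    by (intro sum.cong) auto
  then have ga': "g = (g \<bullet> dualv a) *\<^sub>R a"
    using Qplus_expand[OF pos_Qplus[OF g]] finite_S a by simp
  then have "g \<bullet> dualv a = 1 \<or> g \<bullet> dualv a = -1"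
    using root_multiple[OF S_root[OF a], of "g \<bullet> dualv a"] pos_root[OF g] by simp
  then show False
    using ga' ne Qplus_coord_nonneg[OF pos_Qplus[OF g] a] by auto
qed

lemma refl_pos:
  assumes "g \<in> P" "a \<in> S" "g \<noteq> a" shows "refl a g \<in> P"
  using pos_minus_simple[OF assms(1,2) _ assms(3), of "cint g a"] refl_root[OF S_root pos_root, of a g] assms
  by (simp add: refl_cint)

lemma refl_permutes_pos:
  assumes "a \<in> S" shows "bij_betw (refl a) (P - {a}) (P - {a})"
proof -
  have "refl a ` (P - {a}) \<subseteq> P - {a}"
  proof (rule image_subsetI)
    fix g assume "g \<in> P - {a}"
    then have g: "g \<in> P" "g \<noteq> a" by auto
    have "refl a g \<noteq> a"
    proof
      assume "refl a g = a"
      then have "g = - a" using refl_refl[of a g] by simp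
      then show False using g pos_not_neg simple_pos[OF assms] by auto
    qed
    then show "refl a g \<in> P - {a}" using refl_pos assms g by auto
  qed
  then show ?thesis by (intro bij_betw_byWitness[where f' = "refl a"]) auto
qed

lemma simple_diff_not_root:
  assumes "a \<in> S" "b \<in> S" shows "a - b \<notin> R"
proof
  assume r: "a - b \<in> R"
  then have "a \<noteq> b" using root_nonzero[of 0] by auto
  have "a - 1 *\<^sub>R b \<in> P"
    using pos_minus_simple[OF simple_pos[OF assms(1)] assms(2), of 1] r \<open>a \<noteq> b\<close> by simp
  then have "(a - b) \<bullet> dualv b \<ge> 0" using Qplus_coord_nonneg pos_Qplus assms by auto
  then show False using assms \<open>a \<noteq> b\<close> by (simp add: inner_diff_left inner_dualv)
qed

text \<open>Expanding \<open>g \<bullet> g > 0\<close> in the base yields a simple root with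
  positive inner product. This drives the inductions on height.\<close>

lemma simple_descent:
  assumes g: "g \<in> P" and ns: "g \<notin> S"
  shows "\<exists>a\<in>S. g \<bullet> a > 0 \<and> g - a \<in> P"
proof -
  have "0 < g \<bullet> g" using g pos_root root_inner_pos by blast
  also have "g \<bullet> g = g \<bullet> (\<Sum>a\<in>S. (g \<bullet> dualv a) *\<^sub>R a)"
    using Qplus_expand[OF pos_Qplus[OF g]] by simp
  also have "\<dots> = (\<Sum>a\<in>S. (g \<bullet> dualv a) * (g \<bullet> a))" by (simp add: inner_sum_right)
  finally obtain a where a: "a \<in> S" "(g \<bullet> dualv a) * (g \<bullet> a) > 0"
    by (meson not_less sum_nonpos)
  then have ga: "g \<bullet> a > 0"
    using Qplus_coord_nonneg[OF pos_Qplus[OF g] a(1)] by (simp add: zero_less_mult_iff)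
  have "g \<noteq> a" using a ns by auto
  then have "g - a \<in> R" using diff_root ga g pos_root S_root a by blast
  then show ?thesis using pos_minus_simple[OF g a(1), of 1] \<open>g \<noteq> a\<close> a ga by auto
qed

section \<open>Half-sums of positive roots and coroots\<close>

abbreviation rhow where "rhow \<equiv> rho R S"

text \<open>Half the sum of the positive coroots 2 g / (g . g). It pairs to 1 with each simple root,
  so \<open>x \<bullet> rhoc\<close> is the height as a linear functional, also for negative
  roots.\<close>

definition rhoc :: 'a where "rhoc = (\<Sum>g\<in>P. (1 / (g \<bullet> g)) *\<^sub>R g)"

lemma refl_rho: assumes a: "a \<in> S" shows "refl a rhow = rhow - a"
proof -
  have "refl a (\<Sum>P) = refl a a + (\<Sum>g\<in>P - {a}. refl a g)"
    by (simp only: refl_sum refl_add sum.remove[OF finite_P simple_pos[OF a]])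
  also have "(\<Sum>g\<in>P - {a}. refl a g) = \<Sum>(P - {a})"
    using sum.reindex_bij_betw[OF refl_permutes_pos[OF a], of "\<lambda>x. x"] by simp
  also have "refl a a + \<Sum>(P - {a}) = \<Sum>P - 2 *\<^sub>R a"
    by (simp add: sum.remove[OF finite_P simple_pos[OF a]] scaleR_2)
  finally show ?thesis by (simp add: rho_def refl_scaleR scaleR_diff_right)
qed

lemma cint_rho: assumes a: "a \<in> S" shows "cint rhow a = 1"
proof -
  have "cint rhow a *\<^sub>R a = 1 *\<^sub>R a" using refl_rho[OF a] by (simp add: refl_cint)
  then show ?thesis using root_nonzero[OF S_root[OF a]] by (simp only: scaleR_right_imp_eq)
qed

lemma refl_rhoc: assumes a: "a \<in> S" shows "refl a rhoc = rhoc - (2 / (a \<bullet> a)) *\<^sub>R a"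
proof -
  let ?f = "\<lambda>g::'a. (1 / (g \<bullet> g)) *\<^sub>R g"
  have "refl a (sum ?f P) = refl a (?f a) + (\<Sum>g\<in>P - {a}. ?f (refl a g))"
    by (simp only: refl_sum refl_add refl_scaleR refl_inner sum.remove[OF finite_P simple_pos[OF a]])
  also have "(\<Sum>g\<in>P - {a}. ?f (refl a g)) = sum ?f (P - {a})"
    using sum.reindex_bij_betw[OF refl_permutes_pos[OF a], of ?f] by simp
  also have "refl a (?f a) + sum ?f (P - {a}) = sum ?f P - (2 / (a \<bullet> a)) *\<^sub>R a"
    unfolding sum.remove[OF finite_P simple_pos[OF a]]
    using scaleR_2[of "(1 / (a \<bullet> a)) *\<^sub>R a"] by (simp add: refl_scaleR)
  finally show ?thesis by (simp add: rhoc_def)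
qed

lemma inner_rhoc_simple: assumes a: "a \<in> S" shows "a \<bullet> rhoc = 1"
proof -
  have "cint rhoc a *\<^sub>R a = (2 / (a \<bullet> a)) *\<^sub>R a" using refl_rhoc[OF a] by (simp add: refl_cint)
  then have "cint rhoc a = 2 / (a \<bullet> a)" using root_nonzero[OF S_root[OF a]] by simp
  then show ?thesis using root_inner_pos[OF S_root[OF a]] by (simp add: cint_def inner_commute)
qed

lemma height_Qplus:
  assumes "x \<in> Qplus S" shows "real (height S x) = x \<bullet> rhoc"
proof -
  obtain c :: "'a \<Rightarrow> nat" where c: "x = (\<Sum>a\<in>S. real (c a) *\<^sub>R a)"
    using assms by (auto simp: Qplus_def)
  have u: "real (sum d S) = x \<bullet> rhoc" if "x = (\<Sum>a\<in>S. real (d a) *\<^sub>R a)" for d :: "'a \<Rightarrow> nat"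
    by (simp add: that inner_sum_left inner_rhoc_simple)
  have "height S x = sum c S"
    unfolding height_def
  proof (rule the_equality)
    show "\<exists>c'. x = (\<Sum>\<alpha>\<in>S. real (c' \<alpha>) *\<^sub>R \<alpha>) \<and> sum c' S = sum c S" using c by blast
  next
    fix n assume "\<exists>c. x = (\<Sum>\<alpha>\<in>S. real (c \<alpha>) *\<^sub>R \<alpha>) \<and> sum c S = n"
    then show "n = sum c S" using u c by (metis of_nat_eq_iff)
  qed
  then show ?thesis using u[OF c] by simp
qed

lemma height_add: "x \<in> Qplus S \<Longrightarrow> y \<in> Qplus S \<Longrightarrow> height S (x + y) = height S x + height S y"
  using height_Qplus[of x] height_Qplus[of y] height_Qplus[of "x + y"] Qplus_add[of x y]
  by (simp add: inner_add_left)

lemma height_simple: "a \<in> S \<Longrightarrow> height S a = 1"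
  using height_Qplus[OF Qplus_simple, of a] inner_rhoc_simple[of a] by simp

lemma Qplus_rhoc_nonneg: "x \<in> Qplus S \<Longrightarrow> x \<bullet> rhoc \<ge> 0"
  by (metis height_Qplus of_nat_0_le_iff)

lemma Qplus_rhoc_0: assumes "x \<in> Qplus S" "x \<bullet> rhoc \<le> 0" shows "x = 0"
proof -
  have "x \<bullet> rhoc = (\<Sum>a\<in>S. x \<bullet> dualv a)"
    by (subst Qplus_expand[OF assms(1)]) (simp add: inner_sum_left inner_rhoc_simple)
  then have "(\<Sum>a\<in>S. x \<bullet> dualv a) = 0"
    using Qplus_coord_nonneg[OF assms(1)] assms(2) by (metis antisym sum_nonneg)
  then have "x \<bullet> dualv a = 0" if "a \<in> S" for a
    using sum_nonneg_eq_0_iff[OF finite_S, of "\<lambda>a. x \<bullet> dualv a"] Qplus_coord_nonneg[OF assms(1)] that by auto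
  then show ?thesis by (subst Qplus_expand[OF assms(1)]) simp
qed

lemma pos_height_ge1: assumes "g \<in> P" shows "height S g \<ge> 1"
proof (rule ccontr)
  assume "\<not> ?thesis"
  then have "g \<bullet> rhoc = 0" using height_Qplus[OF pos_Qplus[OF assms]] by simp
  then have "g = 0" using Qplus_rhoc_0 pos_Qplus[OF assms] by simp
  then show False using root_nonzero[OF pos_root[OF assms]] by simp
qed

lemma height_one_simple: assumes "g \<in> P" "height S g = 1" shows "g \<in> S"
proof (rule ccontr)
  assume "g \<notin> S"
  then obtain a where a: "a \<in> S" "g - a \<in> P" using simple_descent assms(1) by blast
  have "height S g = height S (g - a) + height S a"
    using height_add[of "g - a" a] a pos_Qplus Qplus_simple by simp
  then show False using assms(2) height_simple[OF a(1)] pos_height_ge1[OF a(2)] by simp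
qed

lemma pos_iff_rhoc: assumes "g \<in> R" shows "g \<in> P \<longleftrightarrow> g \<bullet> rhoc > 0"
proof -
  have *: "x \<bullet> rhoc > 0" if "x \<in> P" for x
    using pos_height_ge1[OF that] height_Qplus[OF pos_Qplus[OF that]] by linarith
  show ?thesis using *[of g] *[of "- g"] root_cases[OF assms] pos_not_neg[of g] by auto
qed

end

section \<open>Partition functions and the Weyl group\<close>

definition qq :: "int poly" where "qq = [:0, 1:]"

lemma monom_1_qq: "monom 1 n = qq ^ n"
  by (simp add: monom_altdef qq_def)

text \<open>The set \<open>A\<close> is a parameter so that one simple root can be removed from the
  positive roots.\<close>

definition kpart :: "'a::euclidean_space set \<Rightarrow> 'a \<Rightarrow> ('a \<Rightarrow> nat) set" where
  "kpart A \<mu> = {k. (\<forall>x. x \<notin> A \<longrightarrow> k x = 0) \<and> (\<Sum>\<alpha>\<in>A. real (k \<alpha>) *\<^sub>R \<alpha>) = \<mu>}"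

definition kq :: "'a::euclidean_space set \<Rightarrow> 'a \<Rightarrow> int poly" where
  "kq A \<mu> = (\<Sum>k\<in>kpart A \<mu>. qq ^ (\<Sum>\<alpha>\<in>A. k \<alpha>))"

lemma kostant_q_eq_kq: "kostant_q R S = kq (pos_roots R S)"
  by (rule ext) (simp add: kostant_q_def kq_def kpart_def monom_1_qq)

lemma kq_linear_permute:
  assumes s: "linear s" and bij: "bij_betw s A A" and inv: "\<And>x. s (s x) = x"
  shows "kq A (s \<mu>) = kq A \<mu>"
proof -
  have mem: "s x \<in> A \<longleftrightarrow> x \<in> A" for x
    using bij inv by (metis bij_betw_apply)
  have sub: "k \<circ> s \<in> kpart A (s \<nu>)" if "k \<in> kpart A \<nu>" for k \<nu>
  proof -
    have "(\<Sum>\<alpha>\<in>A. real (k (s \<alpha>)) *\<^sub>R \<alpha>) = (\<Sum>\<alpha>\<in>A. real (k (s (s \<alpha>))) *\<^sub>R s \<alpha>)"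
      using sum.reindex_bij_betw[OF bij, of "\<lambda>\<alpha>. real (k (s \<alpha>)) *\<^sub>R \<alpha>"] by simp
    also have "\<dots> = s (\<Sum>\<alpha>\<in>A. real (k \<alpha>) *\<^sub>R \<alpha>)"
      using s by (simp add: inv linear_sum linear_scale)
    finally show ?thesis using that mem by (auto simp: kpart_def)
  qed
  have invo: "(k \<circ> s) \<circ> s = k" for k :: "'a \<Rightarrow> nat" by (rule ext) (simp add: inv)
  have "bij_betw (\<lambda>k. k \<circ> s) (kpart A \<mu>) (kpart A (s \<mu>))"
    using sub[of _ \<mu>] sub[of _ "s \<mu>"] invo
    by (intro bij_betw_byWitness[where f' = "\<lambda>k. k \<circ> s"]) (auto simp: inv)
  then have "kq A (s \<mu>) = (\<Sum>k\<in>kpart A \<mu>. qq ^ (\<Sum>\<alpha>\<in>A. (k \<circ> s) \<alpha>))"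
    unfolding kq_def by (rule sum.reindex_bij_betw[symmetric])
  also have "\<dots> = kq A \<mu>"
    unfolding kq_def by (simp add: sum.reindex_bij_betw[OF bij])
  finally show ?thesis .
qed

context based_roots begin

text \<open>Every part has height at least 1, so no multiplicity exceeds the height of
  \<open>\<mu>\<close>.\<close>

lemma finite_kpart:
  assumes A: "A \<subseteq> P" shows "finite (kpart A \<mu>)"
proof -
  define B where "B = nat \<lfloor>\<mu> \<bullet> rhoc\<rfloor>"
  have fA: "finite A" using A finite_P finite_subset by blast
  have le: "k x \<le> B" if k: "k \<in> kpart A \<mu>" and x: "x \<in> A" for k x
  proof -
    have ge1: "a \<bullet> rhoc \<ge> 1" if "a \<in> A" for a
      using pos_height_ge1[of a] height_Qplus[OF pos_Qplus, of a] that A by auto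
    have "real (k x) \<le> real (k x) * (x \<bullet> rhoc)"
      using ge1[OF x] by (simp add: mult_le_cancel_left1)
    also have "\<dots> \<le> (\<Sum>a\<in>A. real (k a) * (a \<bullet> rhoc))"
      using fA x ge1 by (intro member_le_sum[of x A "\<lambda>a. real (k a) * (a \<bullet> rhoc)"]) (auto intro!: mult_nonneg_nonneg order_trans[OF zero_le_one ge1])
    also have "\<dots> = \<mu> \<bullet> rhoc" using k by (auto simp: kpart_def inner_sum_left)
    finally show ?thesis by (simp add: B_def le_nat_floor)
  qed
  have "kpart A \<mu> \<subseteq> {f. \<forall>x. (x \<in> A \<longrightarrow> f x \<in> {..B}) \<and> (x \<notin> A \<longrightarrow> f x = 0)}"
    using le by (auto simp: kpart_def)
  then show ?thesis
    using finite_set_of_finite_funs[OF fA, of "{..B}" 0] finite_subset by blast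
qed

text \<open>Partitions avoiding \<open>a\<close>, and those from which one copy of \<open>a\<close>
  can be removed; on generating functions this is multiplication by 1 - q e^a.\<close>

lemma kq_split:
  assumes A: "A \<subseteq> P" and a: "a \<in> A"
  shows "kq A \<mu> = kq (A - {a}) \<mu> + qq * kq A (\<mu> - a)"
proof -
  have fA: "finite A" using A finite_P finite_subset by blast
  let ?Z = "{k \<in> kpart A \<mu>. k a = 0}" and ?N = "{k \<in> kpart A \<mu>. k a \<noteq> 0}"
  let ?f = "\<lambda>k. qq ^ sum k A"
  have sp: "(\<Sum>\<alpha>\<in>A. real (k \<alpha>) *\<^sub>R \<alpha>) = real (k a) *\<^sub>R a + (\<Sum>\<alpha>\<in>A - {a}. real (k \<alpha>) *\<^sub>R \<alpha>)"
    and spn: "sum k A = k a + sum k (A - {a})" for k :: "'a \<Rightarrow> nat"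
    using fA a by (simp_all add: sum.remove)
  have "kq A \<mu> = sum ?f ?Z + sum ?f ?N"
    unfolding kq_def using finite_kpart[OF A, of \<mu>]
    by (subst sum.union_disjoint[symmetric]) (auto intro!: sum.cong)
  also have "sum ?f ?Z = kq (A - {a}) \<mu>"
    unfolding kq_def using a
    by (intro sum.cong) (auto simp: kpart_def sp spn)
  also have "sum ?f ?N = qq * kq A (\<mu> - a)"
  proof -
    have e: "(\<Sum>\<alpha>\<in>A - {a}. real ((k(a := n)) \<alpha>) *\<^sub>R \<alpha>) = (\<Sum>\<alpha>\<in>A - {a}. real (k \<alpha>) *\<^sub>R \<alpha>)"
      "sum (k(a := n)) (A - {a}) = sum k (A - {a})" for k :: "'a \<Rightarrow> nat" and n
      by (auto intro!: sum.cong)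
    have "bij_betw (\<lambda>k. k(a := Suc (k a))) (kpart A (\<mu> - a)) ?N"
    proof (rule bij_betw_byWitness[where f' = "\<lambda>k. k(a := k a - 1)"])
      show "(\<lambda>k. k(a := Suc (k a))) ` kpart A (\<mu> - a) \<subseteq> ?N"
        using a by (auto simp: kpart_def sp e scaleR_add_left algebra_simps)
      show "(\<lambda>k. k(a := k a - 1)) ` ?N \<subseteq> kpart A (\<mu> - a)"
        using a by (auto simp: kpart_def sp e of_nat_diff scaleR_diff_left algebra_simps)
    qed auto
    then have "sum ?f ?N = (\<Sum>k\<in>kpart A (\<mu> - a). ?f (k(a := Suc (k a))))"
      by (rule sum.reindex_bij_betw[symmetric])
    also have "\<dots> = (\<Sum>k\<in>kpart A (\<mu> - a). qq * ?f k)"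
      by (intro sum.cong refl) (simp add: spn e)
    finally show ?thesis by (simp add: kq_def sum_distrib_left)
  qed
  finally show ?thesis .
qed

lemma kpart_0: "kpart P 0 = {\<lambda>_. 0}"
proof -
  have "k x = 0" if k: "k \<in> kpart P 0" for k x
  proof (cases "x \<in> P")
    case True
    have s: "(\<Sum>a\<in>P. real (k a) * (a \<bullet> rhoc)) = 0"
      using k by (auto simp: kpart_def simp flip: inner_scaleR_left inner_sum_left)
    have pos: "a \<bullet> rhoc > 0" if "a \<in> P" for a using that pos_iff_rhoc pos_root by blast
    have "\<forall>a\<in>P. real (k a) * (a \<bullet> rhoc) = 0"
      using s pos by (subst (asm) sum_nonneg_eq_0_iff[OF finite_P]) (simp_all add: less_imp_le)
    then have "real (k x) * (x \<bullet> rhoc) = 0" using True by blast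
    then show ?thesis using pos[OF True] by simp
  qed (use k in \<open>auto simp: kpart_def\<close>)
  then show ?thesis by (auto simp: kpart_def)
qed

lemma kq_0: "kq P 0 = 1"
  by (simp add: kq_def kpart_0)

lemma kq_not_Qplus: assumes "\<mu> \<notin> Qplus S" shows "kq P \<mu> = 0"
proof -
  have "kpart P \<mu> = {}"
    using assms Qplus_sum[of P "\<lambda>\<alpha>. real (_ \<alpha>) *\<^sub>R \<alpha>"] Qplus_scale pos_Qplus by (auto simp: kpart_def)
  then show ?thesis by (simp add: kq_def)
qed

lemma coeff_kq_0: "coeff (kq P \<mu>) 0 = (if \<mu> = 0 then 1 else 0)"
proof (cases "\<mu> = 0")
  case False
  have "coeff (qq ^ sum k P) 0 = 0" if "k \<in> kpart P \<mu>" for k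
  proof -
    have "sum k P \<noteq> 0"
    proof
      assume "sum k P = 0"
      then have "\<forall>x\<in>P. k x = 0" using finite_P by simp
      then show False using that False by (auto simp: kpart_def)
    qed
    then show ?thesis by (simp add: coeff_0_power qq_def)
  qed
  then show ?thesis using False by (simp add: kq_def coeff_sum)
qed (simp add: kq_0)

end

section \<open>The Weyl group, its sign and the exchange condition\<close>

lemma weyl_word_Nil [simp]: "weyl_word [] = id"
  and weyl_word_Cons [simp]: "weyl_word (a # ws) = refl a \<circ> weyl_word ws"
  by (simp_all add: weyl_word_def)

lemma weyl_word_append: "weyl_word (us @ vs) = weyl_word us \<circ> weyl_word vs"
  by (induction us) (auto simp: o_assoc)

lemma linear_weyl_word: "linear (weyl_word ws)"
proof (induction ws)
  case (Cons a ws)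
  then show ?case unfolding weyl_word_Cons by (intro linear_compose linear_refl)
qed (simp only: weyl_word_Nil linear_id)

lemma weyl_word_inner: "weyl_word ws x \<bullet> weyl_word ws y = x \<bullet> y"
  by (induction ws) (simp_all add: refl_inner)

lemma weyl_word_fixes: "(\<And>a. a \<in> set ws \<Longrightarrow> z \<bullet> a = 0) \<Longrightarrow> weyl_word ws z = z"
  by (induction ws) (simp_all add: refl_def)

context based_roots begin

abbreviation W where "W \<equiv> weyl_group S"

lemma W_id: "id \<in> W"
  unfolding weyl_group_def by (auto intro!: exI[of _ "[]"])

lemma W_left: assumes "a \<in> S" "w \<in> W" shows "refl a \<circ> w \<in> W"
proof -
  obtain ws where "w = weyl_word ws" "set ws \<subseteq> S" using assms by (auto simp: weyl_group_def)
  then show ?thesis using assms unfolding weyl_group_def by (auto intro!: exI[of _ "a # ws"])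
qed

lemma W_right: assumes "a \<in> S" "w \<in> W" shows "w \<circ> refl a \<in> W"
proof -
  obtain ws where "w = weyl_word ws" "set ws \<subseteq> S" using assms by (auto simp: weyl_group_def)
  then show ?thesis using assms unfolding weyl_group_def
    by (auto intro!: exI[of _ "ws @ [a]"] simp: weyl_word_append)
qed

lemma W_linear: "w \<in> W \<Longrightarrow> linear w"
  by (auto simp: weyl_group_def linear_weyl_word)

lemma W_inner: "w \<in> W \<Longrightarrow> w x \<bullet> w y = x \<bullet> y"
  by (auto simp: weyl_group_def weyl_word_inner)

lemma W_inj: assumes "w \<in> W" shows "inj w"
proof (rule injI)
  fix x y assume "w x = w y"
  then have "w (x - y) = 0" using W_linear[OF assms] by (simp add: linear_diff)
  then have "(x - y) \<bullet> (x - y) = 0" using W_inner[OF assms, of "x - y" "x - y"] by simp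
  then show "x = y" by simp
qed

lemma weyl_word_root: "set ws \<subseteq> S \<Longrightarrow> g \<in> R \<Longrightarrow> weyl_word ws g \<in> R"
  by (induction ws) (auto simp: refl_root S_root)

lemma W_root: "w \<in> W \<Longrightarrow> g \<in> R \<Longrightarrow> w g \<in> R"
  by (auto simp: weyl_group_def weyl_word_root)

lemma W_bij_R: assumes "w \<in> W" shows "bij_betw w R R"
proof -
  have "w ` R = R"
    using endo_inj_surj[OF finite_R, of w] W_root[OF assms] W_inj[OF assms]
    by (auto simp: inj_on_def)
  then show ?thesis using W_inj[OF assms] by (auto simp: bij_betw_def inj_on_def)
qed

lemma W_fixes: "w \<in> W \<Longrightarrow> (\<And>a. a \<in> S \<Longrightarrow> z \<bullet> a = 0) \<Longrightarrow> w z = z"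
  unfolding weyl_group_def by (auto intro!: weyl_word_fixes)

text \<open>\<open>R\<close> may fail to span the space, but every element of \<open>W\<close> fixes
  the orthogonal complement of \<open>S\<close>.\<close>

lemma W_eqI:
  assumes w: "w \<in> W" "w' \<in> W" and eq: "\<And>a. a \<in> S \<Longrightarrow> w a = w' a" shows "w = w'"
proof
  fix x
  obtain y z where yz: "y \<in> span S" "\<And>u. u \<in> span S \<Longrightarrow> orthogonal z u" "x = y + z"
    using orthogonal_subspace_decomp_exists[of S x] by metis
  have "w z = z" "w' z = z"
    using yz(2) w by (auto intro!: W_fixes simp: span_base orthogonal_def)
  moreover have "w y = w' y"
    using linear_eq_on[of w w' y S] W_linear w eq yz(1) by blast
  ultimately show "w x = w' x"
    using linear_add[OF W_linear[OF w(1)], of y z] linear_add[OF W_linear[OF w(2)], of y z] yz(3) by simp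
qed

lemma finite_W: "finite W"
proof -
  have inj: "inj_on (\<lambda>w. restrict w S) W"
  proof (rule inj_onI)
    fix w w' assume w: "w \<in> W" "w' \<in> W" and eq: "restrict w S = restrict w' S"
    have "w a = w' a" if "a \<in> S" for a using fun_cong[OF eq, of a] that by simp
    then show "w = w'" using W_eqI[OF w] by blast
  qed
  have "(\<lambda>w. restrict w S) ` W \<subseteq> S \<rightarrow>\<^sub>E R"
    using W_root S_root by (auto simp: PiE_def extensional_def)
  moreover have "finite (S \<rightarrow>\<^sub>E R)" by (intro finite_PiE finite_S finite_R)
  ultimately have "finite ((\<lambda>w. restrict w S) ` W)" by (rule finite_subset)
  then show ?thesis using inj by (rule finite_imageD)
qed

lemma bij_W_left: "a \<in> S \<Longrightarrow> bij_betw (\<lambda>w. refl a \<circ> w) W W"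
  using W_left by (intro bij_betw_byWitness[where f' = "\<lambda>w. refl a \<circ> w"]) (auto simp: o_assoc)

lemma bij_W_right: "a \<in> S \<Longrightarrow> bij_betw (\<lambda>w. w \<circ> refl a) W W"
  using W_right by (intro bij_betw_byWitness[where f' = "\<lambda>w. w \<circ> refl a"]) (auto simp: comp_assoc)

text \<open>The inversion set. The parity of its size depends on \<open>w\<close> alone, yet equals
  that of the length of any word for \<open>w\<close>; this makes the sign computable from
  words.\<close>

definition invs :: "('a \<Rightarrow> 'a) \<Rightarrow> 'a set" where "invs w = {g \<in> P. - w g \<in> P}"

text \<open>\<open>refl a\<close> matches the inversions other than \<open>a\<close>, and
  \<open>a\<close> is an inversion of exactly one of the two elements.\<close>

lemma invs_comp_refl:
  assumes w: "w \<in> W" and a: "a \<in> S"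
  shows "(-1::int) ^ card (invs (w \<circ> refl a)) = - ((-1) ^ card (invs w))"
proof -
  have fin: "finite (invs v)" for v using finite_P by (auto simp: invs_def)
  have bij: "bij_betw (refl a) (invs (w \<circ> refl a) - {a}) (invs w - {a})"
  proof (rule bij_betw_byWitness[where f' = "refl a"])
    have b: "refl a g \<in> P - {a}" if "g \<in> P - {a}" for g
      using refl_permutes_pos[OF a] that by (rule bij_betw_apply)
    show "refl a ` (invs (w \<circ> refl a) - {a}) \<subseteq> invs w - {a}"
      using b by (auto simp: invs_def)
    show "refl a ` (invs w - {a}) \<subseteq> invs (w \<circ> refl a) - {a}"
    proof (rule image_subsetI)
      fix g assume g: "g \<in> invs w - {a}"
      then have "refl a g \<in> P - {a}" by (intro b) (simp add: invs_def)
      then show "refl a g \<in> invs (w \<circ> refl a) - {a}" using g by (simp add: invs_def)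
    qed
  qed auto
  have c: "card (invs (w \<circ> refl a) - {a}) = card (invs w - {a})" using bij_betw_same_card[OF bij] .
  have "w a \<in> P \<longleftrightarrow> - w a \<notin> P"
    using root_cases[OF W_root[OF w S_root[OF a]]] pos_not_neg by blast
  moreover have "w (- a) = - w a" using W_linear[OF w] by (simp add: linear_neg)
  ultimately have ai: "a \<in> invs (w \<circ> refl a) \<longleftrightarrow> a \<notin> invs w"
    using simple_pos[OF a] by (auto simp: invs_def)
  have cr: "card (invs v) = (if a \<in> invs v then Suc (card (invs v - {a})) else card (invs v - {a}))" for v
    using card.remove[OF fin, of a v] by simp
  define n where "n = card (invs w - {a})"
  have "card (invs w) = (if a \<in> invs w then Suc n else n)"
    "card (invs (w \<circ> refl a)) = (if a \<in> invs w then n else Suc n)"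
    using cr[of w] cr[of "w \<circ> refl a"] ai c unfolding n_def by presburger+
  then show ?thesis by (simp only:) (simp split: if_splits)
qed

lemma invs_word:
  "set ws \<subseteq> S \<Longrightarrow> (-1::int) ^ card (invs (weyl_word ws)) = (-1) ^ length ws"
proof (induction ws rule: rev_induct)
  case Nil
  have "invs id = {}" using pos_not_neg by (auto simp: invs_def)
  then show ?case by (simp only: weyl_word_Nil card.empty list.size)
next
  case (snoc a ws)
  then have "weyl_word ws \<in> W" by (auto simp: weyl_group_def)
  then have "(-1::int) ^ card (invs (weyl_word ws \<circ> refl a)) = - ((-1) ^ card (invs (weyl_word ws)))"
    using snoc.prems by (intro invs_comp_refl) auto
  moreover have "weyl_word (ws @ [a]) = weyl_word ws \<circ> refl a"
    by (rule ext) (simp add: weyl_word_append)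
  ultimately have "(-1::int) ^ card (invs (weyl_word (ws @ [a]))) = - ((-1) ^ card (invs (weyl_word ws)))"
    by (simp only:)
  then show ?case using snoc by (simp only:) simp
qed

lemma weyl_sign_word:
  assumes "set ws \<subseteq> S" shows "weyl_sign S (weyl_word ws) = (-1) ^ length ws"
proof -
  have "\<exists>us. set us \<subseteq> S \<and> length us = weyl_length S (weyl_word ws) \<and> weyl_word ws = weyl_word us"
    unfolding weyl_length_def by (rule LeastI[of _ "length ws"]) (use assms in blast)
  then obtain us where us: "set us \<subseteq> S" "length us = weyl_length S (weyl_word ws)" "weyl_word ws = weyl_word us"
    by blast
  have "weyl_sign S (weyl_word ws) = (-1) ^ length us" using us by (simp add: weyl_sign_def)
  then show ?thesis using invs_word[OF us(1)] invs_word[OF assms] us(3) by simp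
qed

lemma weyl_sign_left: assumes "a \<in> S" "w \<in> W" shows "weyl_sign S (refl a \<circ> w) = - weyl_sign S w"
proof -
  obtain ws where ws: "w = weyl_word ws" "set ws \<subseteq> S" using assms by (auto simp: weyl_group_def)
  show ?thesis using weyl_sign_word[of "a # ws"] weyl_sign_word[of ws] ws assms by simp
qed

lemma weyl_sign_right: assumes "a \<in> S" "w \<in> W" shows "weyl_sign S (w \<circ> refl a) = - weyl_sign S w"
proof -
  obtain ws where ws: "w = weyl_word ws" "set ws \<subseteq> S" using assms by (auto simp: weyl_group_def)
  have "weyl_word (ws @ [a]) = w \<circ> refl a"
    by (rule ext) (simp add: weyl_word_append ws)
  then show ?thesis using weyl_sign_word[of "ws @ [a]"] weyl_sign_word[of ws] ws assms by simp
qed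

lemma weyl_sign_id: "weyl_sign S id = 1"
  using weyl_sign_word[of "[]"] by simp

text \<open>As the letters act one after another, the root changes sign at some letter; a simple
  reflection makes only its own root negative, so the root is then that letter.\<close>

lemma word_sign_change:
  assumes "set vs \<subseteq> S" "g \<in> P" "- weyl_word vs g \<in> P"
  shows "\<exists>xs b ys. vs = xs @ b # ys \<and> weyl_word ys g = b"
  using assms(1,3)
proof (induction vs)
  case Nil
  then show ?case using assms(2) pos_not_neg by auto
next
  case (Cons b vs)
  let ?y = "weyl_word vs g"
  have "?y \<in> R" using weyl_word_root[of vs g] Cons.prems(1) pos_root[OF assms(2)] by simp
  then consider "?y \<in> P" | "- ?y \<in> P" using root_cases by blast
  then show ?case
  proof cases
    case 1
    then have "?y = b" using refl_pos[of ?y b] Cons.prems pos_not_neg by auto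
    then show ?thesis by (intro exI[of _ "[]"]) auto
  next
    case 2
    then obtain xs c ys where "vs = xs @ c # ys" "weyl_word ys g = c" using Cons by auto
    then show ?thesis by (intro exI[of _ "b # xs"]) auto
  qed
qed

text \<open>Since the last letter \<open>a\<close> is no inversion of the whole word, the remaining
  letters send it to a negative root. By \<open>word_sign_change\<close> some earlier letter
  \<open>b\<close> is conjugate to \<open>a\<close> through the letters between them; the two cancel
  and the word shortens.\<close>

lemma word_no_invs:
  "set ws \<subseteq> S \<Longrightarrow> invs (weyl_word ws) = {} \<Longrightarrow> weyl_word ws = id"
proof (induction "length ws" arbitrary: ws rule: less_induct)
  case less
  show ?case
  proof (cases ws rule: rev_cases)
    case (snoc vs a)
    have a: "a \<in> S" and vs: "set vs \<subseteq> S" using less.prems snoc by auto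
    have "weyl_word ws a \<in> R" using weyl_word_root less.prems S_root[OF a] by blast
    then have "weyl_word ws a \<in> P"
      using root_cases less.prems(2) simple_pos[OF a] by (auto simp: invs_def)
    moreover have "weyl_word ws a = - weyl_word vs a"
      using linear_weyl_word[of vs] by (simp add: snoc weyl_word_append linear_neg)
    ultimately have "- weyl_word vs a \<in> P" by simp
    then obtain xs b ys where xs: "vs = xs @ b # ys" "weyl_word ys a = b"
      using word_sign_change[OF vs simple_pos[OF a]] by blast
    have "refl b \<circ> weyl_word ys = weyl_word ys \<circ> refl a"
      using refl_conj[OF linear_weyl_word weyl_word_inner, of ys a] xs(2) by (auto simp: fun_eq_iff)
    then have "weyl_word ws x = weyl_word (xs @ ys) x" for x
      by (simp add: snoc xs(1) weyl_word_append fun_eq_iff)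
    then have eq: "weyl_word ws = weyl_word (xs @ ys)" by blast
    then show ?thesis
      using less.hyps[of "xs @ ys"] less.prems vs by (auto simp: snoc xs(1))
  qed simp
qed

lemma W_invs: assumes "w \<in> W" "w \<noteq> id" obtains g where "g \<in> P" "- w g \<in> P"
proof -
  obtain ws where ws: "w = weyl_word ws" "set ws \<subseteq> S" using assms by (auto simp: weyl_group_def)
  then have "invs w \<noteq> {}" using word_no_invs assms(2) by blast
  then show ?thesis using that by (auto simp: invs_def)
qed

text \<open>Up to signs \<open>w\<close> permutes \<open>P\<close>; passing from \<open>w g\<close>
  to its positive version \<open>?p g\<close> changes the sum exactly at the inversions.\<close>

lemma rho_minus_W:
  assumes w: "w \<in> W" shows "rhow - w rhow = (\<Sum>g\<in>invs w. - w g)"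
proof -
  have lin: "linear w" using W_linear[OF w] .
  have sub: "invs w \<subseteq> P" by (auto simp: invs_def)
  let ?p = "\<lambda>g. if w g \<in> P then w g else - w g"
  have cases: "w g \<in> P \<longleftrightarrow> - w g \<notin> P" if "g \<in> P" for g
    using root_cases[OF W_root[OF w pos_root[OF that]]] pos_not_neg by blast
  have inj: "inj_on ?p P"
  proof (rule inj_onI)
    fix g g' assume g: "g \<in> P" "g' \<in> P" "?p g = ?p g'"
    then have "w g = w g' \<or> w g = - w g'" by (simp split: if_splits) (metis minus_minus)+
    then have "w g = w g' \<or> w g = w (- g')" using lin by (simp add: linear_neg)
    then have "g = g' \<or> g = - g'" using W_inj[OF w] by (auto dest: injD)
    then show "g = g'" using g pos_not_neg by auto
  qed
  have "?p ` P \<subseteq> P" using cases by auto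
  then have "bij_betw ?p P P" using endo_inj_surj[OF finite_P _ inj] inj by (auto simp: bij_betw_def)
  then have "\<Sum>P = sum ?p P" using sum.reindex_bij_betw[of ?p P P "\<lambda>x. x"] by simp
  also have "\<dots> = (\<Sum>g\<in>P. w g + (if g \<in> invs w then - 2 *\<^sub>R w g else 0))"
    using cases by (intro sum.cong) (auto simp: invs_def scaleR_2)
  also have "\<dots> = w (\<Sum>P) + (\<Sum>g\<in>invs w. - 2 *\<^sub>R w g)"
    using lin sub finite_P
    by (simp add: sum.distrib linear_sum sum.If_cases Int_absorb1 flip: sum.inter_restrict)
  finally have "\<Sum>P - w (\<Sum>P) = (\<Sum>g\<in>invs w. - 2 *\<^sub>R w g)" by (metis add_diff_cancel_left')
  then have "(1/2) *\<^sub>R (\<Sum>P - w (\<Sum>P)) = (1/2) *\<^sub>R (\<Sum>g\<in>invs w. - 2 *\<^sub>R w g)" by (rule arg_cong)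
  moreover have "rhow - w rhow = (1/2) *\<^sub>R (\<Sum>P - w (\<Sum>P))"
    by (simp only: rho_def linear_scale[OF lin] scaleR_diff_right)
  ultimately show ?thesis by (simp add: scaleR_sum_right)
qed

lemma rho_minus_W_Qplus: "w \<in> W \<Longrightarrow> rhow - w rhow \<in> Qplus S"
  unfolding rho_minus_W by (intro Qplus_sum) (auto simp: invs_def pos_Qplus)

lemma rho_minus_W_0:
  assumes "w \<in> W" "rhow = w rhow" shows "w = id"
proof (rule ccontr)
  assume "w \<noteq> id"
  then obtain g where g: "g \<in> P" "- w g \<in> P" using W_invs assms by blast
  have "0 = (\<Sum>g\<in>invs w. (- w g) \<bullet> rhoc)"
    using rho_minus_W[OF assms(1)] assms(2) inner_sum_left[of "\<lambda>g. - w g" "invs w" rhoc] by simp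
  moreover have "(\<Sum>g\<in>invs w. (- w g) \<bullet> rhoc) > 0"
    using g pos_iff_rhoc[OF pos_root] finite_P
    by (intro sum_pos) (auto simp: invs_def simp del: inner_minus_left)
  ultimately show False by simp
qed

end

section \<open>Lusztig's polynomials\<close>

lemma cint_minus: "cint (- x) a = - cint x a"
  by (simp add: cint_def)

context based_roots begin

abbreviation L where "L \<equiv> lusztig_q R S"

lemma L_eq: "L \<kappa> \<mu> = (\<Sum>w\<in>W. smult (weyl_sign S w) (kq P (w (\<kappa> + rhow) - (\<mu> + rhow))))"
  by (simp add: lusztig_q_def kostant_q_eq_kq)

text \<open>Antisymmetry under the dot action, by substituting \<open>w \<circ> refl a\<close> for
  \<open>w\<close>.\<close>

lemma L_dot:
  assumes a: "a \<in> S" shows "L (refl a \<nu> - a) \<mu> = - L \<nu> \<mu>"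
proof -
  have e: "refl a \<nu> - a + rhow = refl a (\<nu> + rhow)" by (simp add: refl_add refl_rho[OF a])
  have "L (refl a \<nu> - a) \<mu> = (\<Sum>w\<in>W. smult (weyl_sign S w) (kq P (w (refl a (\<nu> + rhow)) - (\<mu> + rhow))))"
    by (simp add: L_eq e)
  also have "\<dots> = (\<Sum>w\<in>W. smult (weyl_sign S (w \<circ> refl a)) (kq P ((w \<circ> refl a) (refl a (\<nu> + rhow)) - (\<mu> + rhow))))"
    by (rule sum.reindex_bij_betw[OF bij_W_right[OF a], symmetric])
  also have "\<dots> = (\<Sum>w\<in>W. - smult (weyl_sign S w) (kq P (w (\<nu> + rhow) - (\<mu> + rhow))))"
    by (intro sum.cong refl) (simp add: weyl_sign_right[OF a])
  finally show ?thesis by (simp add: L_eq sum_negf)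
qed

text \<open>The simple reflection permutes the positive roots other than \<open>a\<close>, so the partition function
  without \<open>a\<close>, which is \<open>kq P x - q kq P (x - a)\<close>, is invariant under it.\<close>

lemma L_hecke:
  assumes a: "a \<in> S"
  shows "L \<kappa> \<mu> + L \<kappa> (refl a \<mu> - a) = qq * (L \<kappa> (\<mu> + a) + L \<kappa> (refl a \<mu>))"
proof -
  define M where "M \<mu> = (\<Sum>w\<in>W. smult (weyl_sign S w) (kq (P - {a}) (w (\<kappa> + rhow) - (\<mu> + rhow))))" for \<mu>
  have split: "L \<kappa> \<nu> = M \<nu> + qq * L \<kappa> (\<nu> + a)" for \<nu>
  proof -
    have "kq P (x - (\<nu> + rhow)) = kq (P - {a}) (x - (\<nu> + rhow)) + qq * kq P (x - (\<nu> + a + rhow))" for x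
      using kq_split[OF order_refl simple_pos[OF a], of "x - (\<nu> + rhow)"] by (simp add: algebra_simps)
    then show ?thesis
      by (simp only: L_eq M_def smult_add_right sum.distrib mult_smult_right sum_distrib_left)
  qed
  have anti: "M (refl a \<mu> - a) = - M \<mu>"
  proof -
    have inv: "kq (P - {a}) x = kq (P - {a}) (refl a x)" for x
      by (rule kq_linear_permute[symmetric]) (simp_all add: linear_refl refl_permutes_pos[OF a])
    have e: "refl a (x - (refl a \<mu> - a + rhow)) = refl a x - (\<mu> + rhow)" for x
      by (simp add: refl_add refl_diff refl_rho[OF a])
    have "M (refl a \<mu> - a) = (\<Sum>w\<in>W. smult (weyl_sign S w) (kq (P - {a}) ((refl a \<circ> w) (\<kappa> + rhow) - (\<mu> + rhow))))"
      unfolding M_def by (subst inv) (simp add: e)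
    also have "\<dots> = (\<Sum>w\<in>W. - smult (weyl_sign S (refl a \<circ> w)) (kq (P - {a}) ((refl a \<circ> w) (\<kappa> + rhow) - (\<mu> + rhow))))"
      by (intro sum.cong refl) (simp add: weyl_sign_left[OF a])
    also have "\<dots> = (\<Sum>w\<in>W. - smult (weyl_sign S w) (kq (P - {a}) (w (\<kappa> + rhow) - (\<mu> + rhow))))"
      by (rule sum.reindex_bij_betw[OF bij_W_left[OF a]])
    finally show ?thesis by (simp add: M_def sum_negf)
  qed
  show ?thesis
    using split[of \<mu>] split[of "refl a \<mu> - a"] anti by (simp add: algebra_simps)
qed

text \<open>\<open>R\<close> is stable under \<open>w\<close>, so inside the alternating sum
  \<open>w \<nu>\<close> can be renamed to a root \<open>g\<close>, which then shifts the second
  argument.\<close>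

lemma sum_L_roots: "(\<Sum>\<nu>\<in>R. L \<nu> \<mu>) = (\<Sum>g\<in>R. L 0 (\<mu> - g))"
proof -
  have "(\<Sum>\<nu>\<in>R. L \<nu> \<mu>) = (\<Sum>w\<in>W. \<Sum>\<nu>\<in>R. smult (weyl_sign S w) (kq P (w \<nu> + w rhow - (\<mu> + rhow))))"
    unfolding L_eq using W_linear by (subst sum.swap) (auto intro!: sum.cong simp: linear_add)
  also have "\<dots> = (\<Sum>w\<in>W. \<Sum>g\<in>R. smult (weyl_sign S w) (kq P (g + w rhow - (\<mu> + rhow))))"
    by (intro sum.cong refl sum.reindex_bij_betw[OF W_bij_R])
  also have "\<dots> = (\<Sum>g\<in>R. L 0 (\<mu> - g))"
    unfolding L_eq by (subst sum.swap) (auto intro!: sum.cong simp: algebra_simps)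
  finally show ?thesis .
qed

lemma L0_vanish: assumes "- \<mu> \<notin> Qplus S" shows "L 0 \<mu> = 0"
proof -
  have "kq P (w rhow - (\<mu> + rhow)) = 0" if "w \<in> W" for w
  proof (rule kq_not_Qplus, rule notI)
    assume "w rhow - (\<mu> + rhow) \<in> Qplus S"
    then have "(w rhow - (\<mu> + rhow)) + (rhow - w rhow) \<in> Qplus S"
      using rho_minus_W_Qplus[OF that] Qplus_add by blast
    then show False using assms by simp
  qed
  then show ?thesis by (simp add: L_eq)
qed

lemma L0_0: "L 0 0 = 1"
proof -
  have "kq P (w rhow - rhow) = 0" if "w \<in> W" "w \<noteq> id" for w
  proof (rule kq_not_Qplus, rule notI)
    assume "w rhow - rhow \<in> Qplus S"
    then have "rhow - w rhow = 0"
      using rho_minus_W_Qplus[OF that(1)] Qplus_antisym[of "rhow - w rhow"] by simp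
    then show False using rho_minus_W_0[OF that(1)] that(2) by simp
  qed
  then have "L 0 0 = smult (weyl_sign S id) (kq P (id rhow - rhow))"
    unfolding L_eq by (subst sum.remove[OF finite_W W_id]) (auto intro!: sum.neutral)
  then show ?thesis by (simp add: weyl_sign_id kq_0)
qed

lemma cint_pos_int:
  assumes "x \<in> R" "a \<in> R" "x \<bullet> a > 0" obtains k :: nat where "k \<ge> 1" "cint x a = real k"
proof -
  obtain m where m: "cint x a = of_int m" using cint_obtain assms by blast
  have "cint x a > 0" using assms root_inner_pos by (simp add: cint_def)
  then have "m > 0" using m by simp
  then show ?thesis using that[of "nat m"] m by simp
qed

lemma height_diff_simple:
  assumes "d \<in> P" "a \<in> S" "d - real j *\<^sub>R a \<in> P"
  shows "height S d = height S (d - real j *\<^sub>R a) + j"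
proof -
  have "real (height S d) = real (height S (d - real j *\<^sub>R a)) + real j"
    using height_Qplus[OF pos_Qplus[OF assms(1)]] height_Qplus[OF pos_Qplus[OF assms(3)]]
      inner_rhoc_simple[OF assms(2)] by (simp add: inner_diff_left)
  then show ?thesis by linarith
qed

lemma poly_two_cancel: "x + x = y + y \<Longrightarrow> x = y" for x y :: "int poly"
  by (metis mult_2 mult_cancel_left numeral_neq_zero)

text \<open>With \<open>cint d a = k\<close> the Hecke relation at \<open>- d\<close> involves
  \<open>d\<close>, \<open>d - a\<close> and their reflections \<open>d - k a\<close>,
  \<open>d - (k - 1) a\<close>. All are positive roots, and those other than \<open>d\<close> are
  lower. For \<open>k = 1\<close> the last one is \<open>d\<close> again, hence the doubled
  equation.\<close>

lemma L_neg:
  assumes c: "\<And>a. a \<in> S \<Longrightarrow> L \<kappa> (- a) = c" and d: "d \<in> P"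
  shows "L \<kappa> (- d) = qq ^ (height S d - 1) * c"
  using d
proof (induction "height S d" arbitrary: d rule: less_induct)
  case less
  show ?case
  proof (cases "d \<in> S")
    case True
    then show ?thesis by (simp add: c height_simple)
  next
    case False
    then obtain a where a: "a \<in> S" "d \<bullet> a > 0" "d - a \<in> P" using simple_descent less.prems by blast
    obtain k :: nat where k: "k \<ge> 1" "cint d a = real k"
      using cint_pos_int[OF pos_root[OF less.prems] S_root[OF a(1)] a(2)] by blast
    have ne: "d \<noteq> a" using a False by auto
    have da: "d - a \<noteq> a" by (rule root_diff_ne[OF S_root[OF a(1)] pos_root[OF less.prems]])
    have ra: "refl a d = d - real k *\<^sub>R a" using k by (simp add: refl_cint)
    have p1: "d - real k *\<^sub>R a \<in> P" using refl_pos[OF less.prems a(1) ne] ra by simp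
    have "refl a (d - a) = d - real (k - 1) *\<^sub>R a"
      using k(1) by (simp add: refl_diff ra of_nat_diff algebra_simps)
    then have p2: "d - real (k - 1) *\<^sub>R a \<in> P" using refl_pos[OF a(3,1) da] by simp
    have h0: "height S d = height S (d - a) + 1" using height_diff_simple[OF less.prems a(1), of 1] a by simp
    have h1: "height S d = height S (d - real k *\<^sub>R a) + k" by (rule height_diff_simple[OF less.prems a(1) p1])
    have h2: "height S d = height S (d - real (k - 1) *\<^sub>R a) + (k - 1)"
      by (rule height_diff_simple[OF less.prems a(1) p2])
    have ge: "height S (d - a) \<ge> 1" "height S (d - real k *\<^sub>R a) \<ge> 1" "height S (d - real (k - 1) *\<^sub>R a) \<ge> 1"
      using pos_height_ge1 a(3) p1 p2 by auto
    have ih0: "L \<kappa> (- (d - a)) = qq ^ (height S (d - a) - 1) * c"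
      using less.hyps[OF _ a(3)] h0 by simp
    have ih1: "L \<kappa> (- (d - real k *\<^sub>R a)) = qq ^ (height S (d - real k *\<^sub>R a) - 1) * c"
      using less.hyps[OF _ p1] h1 k by simp
    have hecke: "L \<kappa> (- d) + L \<kappa> (- (d - real (k - 1) *\<^sub>R a))
       = qq * (L \<kappa> (- (d - a)) + L \<kappa> (- (d - real k *\<^sub>R a)))"
    proof -
      have e1: "refl a (- d) = - (d - real k *\<^sub>R a)" by (simp add: refl_minus ra)
      have e2: "refl a (- d) - a = - (d - real (k - 1) *\<^sub>R a)"
        using k(1) by (simp add: refl_minus ra of_nat_diff algebra_simps)
      have e3: "- d + a = - (d - a)" by simp
      show ?thesis using L_hecke[OF a(1), of \<kappa> "- d"] unfolding e2 unfolding e1 e3 .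
    qed
    have r0: "qq * (qq ^ (height S (d - a) - 1) * c) = qq ^ (height S d - 1) * c"
      using h0 ge(1) by (metis add_diff_cancel_right' le_add_diff_inverse2 mult.assoc power_Suc Suc_eq_plus1)
    show ?thesis
    proof (cases "k = 1")
      case True
      then have "L \<kappa> (- d) + L \<kappa> (- d) = qq ^ (height S d - 1) * c + qq ^ (height S d - 1) * c"
        using hecke ih0 r0 by (simp add: distrib_left)
      then show ?thesis by (rule poly_two_cancel)
    next
      case False
      then have ih2: "L \<kappa> (- (d - real (k - 1) *\<^sub>R a)) = qq ^ (height S (d - real (k - 1) *\<^sub>R a) - 1) * c"
        using less.hyps[OF _ p2] h2 k by simp
      \<comment> \<open>These two heights differ by one, so their terms cancel and only
        \<open>d\<close> and \<open>d - a\<close> remain.\<close>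
      have "height S (d - real (k - 1) *\<^sub>R a) - 1 = Suc (height S (d - real k *\<^sub>R a) - 1)"
        using h1 h2 ge k by linarith
      then have "qq * (qq ^ (height S (d - real k *\<^sub>R a) - 1) * c) = qq ^ (height S (d - real (k - 1) *\<^sub>R a) - 1) * c"
        by (simp only: power_Suc mult.assoc)
      then show ?thesis using hecke r0 unfolding ih0 ih1 ih2 distrib_left by (metis add_right_cancel)
    qed
  qed
qed

text \<open>At \<mu> = 0 the Hecke relation reads 1 + L 0 (- a) = q (L 0 a + 1), and
  \<open>L 0 a\<close> vanishes.\<close>

lemma L0_neg: "d \<in> P \<Longrightarrow> L 0 (- d) = qq ^ (height S d - 1) * (qq - 1)"
proof (rule L_neg)
  fix a assume a: "a \<in> S"
  have "- a \<notin> Qplus S" using Qplus_antisym Qplus_simple[OF a] root_nonzero[OF S_root[OF a]] by blast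
  then have "L 0 a = 0" by (rule L0_vanish)
  then show "L 0 (- a) = qq - 1"
    using L_hecke[OF a, of 0 0] L0_0 by (simp add: algebra_simps)
qed

definition dom :: "'a \<Rightarrow> bool" where "dom x \<longleftrightarrow> (\<forall>a\<in>S. x \<bullet> a \<ge> 0)"

lemma dom_Qplus: assumes "dom x" "y \<in> Qplus S" shows "x \<bullet> y \<ge> 0"
proof -
  have "x \<bullet> y = (\<Sum>a\<in>S. (y \<bullet> dualv a) * (x \<bullet> a))"
    by (subst Qplus_expand[OF assms(2)]) (simp add: inner_sum_right)
  then show ?thesis
    using assms Qplus_coord_nonneg[OF assms(2)] by (auto simp: dom_def intro!: sum_nonneg)
qed

text \<open>The mirror image of \<open>L_neg\<close>: where \<open>\<mu>\<close> pairs negatively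
  with \<open>a\<close>, the Hecke relation leads to higher roots of the \<open>a\<close>-string, so
  the induction ends at dominant roots.\<close>

lemma L_pos:
  assumes dom: "\<And>\<mu>. \<mu> \<in> P \<Longrightarrow> dom \<mu> \<Longrightarrow> L \<kappa> \<mu> = qq ^ (N - height S \<mu>)"
    and N: "\<And>\<mu>. \<mu> \<in> P \<Longrightarrow> height S \<mu> \<le> N"
    and \<mu>: "\<mu> \<in> P"
  shows "L \<kappa> \<mu> = qq ^ (N - height S \<mu>)"
  using \<mu>
proof (induction "N - height S \<mu>" arbitrary: \<mu> rule: less_induct)
  case less
  show ?case
  proof (cases "dom \<mu>")
    case False
    then obtain a where a: "a \<in> S" "\<mu> \<bullet> a < 0" by (auto simp: dom_def)
    obtain k :: nat where k: "k \<ge> 1" "cint (- \<mu>) a = real k"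
      using cint_pos_int[of "- \<mu>" a] pos_root[OF less.prems] S_root[OF a(1)] a(2) by auto
    have "cint \<mu> a = - real k" using k(2) by (simp add: cint_minus)
    then have ra: "refl a \<mu> = \<mu> + real k *\<^sub>R a" by (simp add: refl_cint)
    have ne: "\<mu> \<noteq> a" using a(2) root_inner_pos[OF S_root[OF a(1)]] by (metis less_asym)
    have ne': "\<mu> \<noteq> - a" using less.prems pos_not_neg[OF simple_pos[OF a(1)]] by auto
    have "\<mu> + a \<in> R" using add_root[OF pos_root[OF less.prems] S_root[OF a(1)] a(2) ne'] .
    then have p0: "\<mu> + a \<in> P" using less.prems simple_pos[OF a(1)] pos_Qplus Qplus_add by (auto simp: pos_roots_def)
    have p1: "\<mu> + real k *\<^sub>R a \<in> P" using refl_pos[OF less.prems a(1) ne] ra by simp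
    have "\<mu> + a \<noteq> a" using root_nonzero[OF pos_root[OF less.prems]] by simp
    moreover have "refl a (\<mu> + a) = \<mu> + real (k - 1) *\<^sub>R a"
      using k(1) by (simp add: refl_add ra of_nat_diff algebra_simps)
    ultimately have p2: "\<mu> + real (k - 1) *\<^sub>R a \<in> P" using refl_pos[OF p0 a(1)] by simp
    have h: "height S (\<mu> + real j *\<^sub>R a) = height S \<mu> + j" if "\<mu> + real j *\<^sub>R a \<in> P" for j
      using height_diff_simple[OF that a(1), of j] less.prems by simp
    note h0 = h[of 1, simplified, OF p0] and h1 = h[OF p1] and h2 = h[OF p2]
    have le: "height S \<mu> + k \<le> N" using N[OF p1] h1 by simp
    have ih0: "L \<kappa> (\<mu> + a) = qq ^ (N - height S (\<mu> + a))"
      using less.hyps[OF _ p0] h0 le k(1) by simp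
    have ih1: "L \<kappa> (\<mu> + real k *\<^sub>R a) = qq ^ (N - height S (\<mu> + real k *\<^sub>R a))"
      using less.hyps[OF _ p1] h1 le k(1) by simp
    have r0: "qq * qq ^ (N - height S (\<mu> + a)) = qq ^ (N - height S \<mu>)"
    proof -
      have "N - height S \<mu> = Suc (N - height S (\<mu> + a))" using h0 le k(1) by simp
      then show ?thesis by simp
    qed
    have hecke: "L \<kappa> \<mu> + L \<kappa> (\<mu> + real (k - 1) *\<^sub>R a) = qq * (L \<kappa> (\<mu> + a) + L \<kappa> (\<mu> + real k *\<^sub>R a))"
    proof -
      have "refl a \<mu> - a = \<mu> + real (k - 1) *\<^sub>R a" using k(1) by (simp add: ra of_nat_diff algebra_simps)
      then show ?thesis using L_hecke[OF a(1), of \<kappa> \<mu>] by (simp only: ra)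
    qed
    show ?thesis
    proof (cases "k = 1")
      case True
      then have "L \<kappa> \<mu> + L \<kappa> \<mu> = qq ^ (N - height S \<mu>) + qq ^ (N - height S \<mu>)"
        using hecke ih0 r0 by (simp add: distrib_left)
      then show ?thesis by (rule poly_two_cancel)
    next
      case False
      then have ih2: "L \<kappa> (\<mu> + real (k - 1) *\<^sub>R a) = qq ^ (N - height S (\<mu> + real (k - 1) *\<^sub>R a))"
        using less.hyps[OF _ p2] h2 le k by simp
      have "N - height S (\<mu> + real (k - 1) *\<^sub>R a) = Suc (N - height S (\<mu> + real k *\<^sub>R a))"
        using h1 h2 le k by linarith
      then have "qq * qq ^ (N - height S (\<mu> + real k *\<^sub>R a)) = qq ^ (N - height S (\<mu> + real (k - 1) *\<^sub>R a))"
        by simp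
      then show ?thesis using hecke r0 unfolding ih0 ih1 ih2 distrib_left by (metis add_right_cancel)
    qed
  qed (use dom less.prems in auto)
qed

lemma strictly_dominant_pos:
  assumes x: "\<And>a. a \<in> S \<Longrightarrow> x \<bullet> a > 0" and g: "g \<in> P" shows "x \<bullet> g > 0"
proof -
  have nn: "\<And>a. a \<in> S \<Longrightarrow> (g \<bullet> dualv a) * (x \<bullet> a) \<ge> 0"
    using Qplus_coord_nonneg[OF pos_Qplus[OF g]] x by (simp add: less_imp_le)
  have e: "x \<bullet> g = (\<Sum>a\<in>S. (g \<bullet> dualv a) * (x \<bullet> a))"
    by (subst Qplus_expand[OF pos_Qplus[OF g]]) (simp add: inner_sum_right)
  have "x \<bullet> g \<noteq> 0"
  proof
    assume "x \<bullet> g = 0"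
    then have "\<forall>a\<in>S. (g \<bullet> dualv a) * (x \<bullet> a) = 0"
      using sum_nonneg_eq_0_iff[OF finite_S, of "\<lambda>a. (g \<bullet> dualv a) * (x \<bullet> a)"] nn e by simp
    then have "\<forall>a\<in>S. g \<bullet> dualv a = 0" using x by (metis less_irrefl mult_eq_0_iff)
    then have "g = 0" by (subst Qplus_expand[OF pos_Qplus[OF g]]) simp
    then show False using root_nonzero pos_root[OF g] by blast
  qed
  moreover have "x \<bullet> g \<ge> 0" unfolding e by (rule sum_nonneg) (rule nn)
  ultimately show ?thesis by simp
qed

text \<open>At q = 0 the partition function is the delta function at 0. A strictly dominant vector
  is moved to a strictly dominant one by the identity only.\<close>

lemma coeff_L_0:
  assumes "dom \<kappa>" "dom \<mu>" shows "coeff (L \<kappa> \<mu>) 0 = (if \<kappa> = \<mu> then 1 else 0)"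
proof -
  have rp: "rhow \<bullet> a > 0" if "a \<in> S" for a
  proof -
    have "2 * (rhow \<bullet> a) = a \<bullet> a"
      using cint_rho[OF that] root_inner_pos[OF S_root[OF that]] by (simp add: cint_def field_simps)
    then show ?thesis using root_inner_pos[OF S_root[OF that]] by linarith
  qed
  have sd: "(x + rhow) \<bullet> a > 0" if "dom x" "a \<in> S" for x a
    using that rp by (auto simp: dom_def inner_add_left intro: add_nonneg_pos)
  have "w (\<kappa> + rhow) - (\<mu> + rhow) \<noteq> 0" if w: "w \<in> W" "w \<noteq> id" for w
  proof
    assume eq: "w (\<kappa> + rhow) - (\<mu> + rhow) = 0"
    obtain g where g: "g \<in> P" "- w g \<in> P" using W_invs w by blast
    have "(\<kappa> + rhow) \<bullet> g > 0" "(\<mu> + rhow) \<bullet> (- w g) > 0"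
      using strictly_dominant_pos sd assms g by blast+
    moreover have "(\<mu> + rhow) \<bullet> w g = (\<kappa> + rhow) \<bullet> g" using eq W_inner[OF w(1)] by (metis right_minus_eq)
    ultimately show False by simp
  qed
  then have "coeff (L \<kappa> \<mu>) 0 = (\<Sum>w\<in>W. if w = id then (if \<kappa> = \<mu> then 1 else 0) else 0)"
    unfolding L_eq coeff_sum by (intro sum.cong refl) (auto simp: coeff_kq_0 weyl_sign_id)
  then show ?thesis using finite_W W_id by simp
qed

end

section \<open>The highest root\<close>

locale irr_roots = based_roots +
  fixes \<theta> :: 'a
  assumes irr: "irreducible_rs R" and highest: "highest_root R S \<theta>"
begin

lemma theta_root: "\<theta> \<in> R" and theta_above: "g \<in> R \<Longrightarrow> \<theta> - g \<in> Qplus S"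
  using highest by (auto simp: highest_root_def)

lemma theta_pos: "\<theta> \<in> P"
proof (rule ccontr)
  assume "\<theta> \<notin> P"
  then have n: "- \<theta> \<in> Qplus S" using root_cases[OF theta_root] pos_Qplus by blast
  have "\<theta> - (- \<theta>) \<in> Qplus S" using theta_above theta_root by blast
  then have "(\<theta> - (- \<theta>)) + (- \<theta>) \<in> Qplus S" using n Qplus_add by blast
  then have "\<theta> = 0" using Qplus_antisym[of \<theta>] n by simp
  then show False using root_nonzero[OF theta_root] by simp
qed

abbreviation N where "N \<equiv> height S \<theta>"

lemma height_le_N: "g \<in> P \<Longrightarrow> height S g \<le> N"
  using height_add[OF pos_Qplus theta_above[OF pos_root], of g g] by simp

lemma N_ge1: "N \<ge> 1"
  using pos_height_ge1 theta_pos by blast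

lemma theta_dom: "dom \<theta>"
  unfolding dom_def
proof (rule ballI, rule ccontr)
  fix a assume a: "a \<in> S" and "\<not> 0 \<le> \<theta> \<bullet> a"
  moreover have "\<theta> \<noteq> - a" using theta_pos pos_not_neg[OF simple_pos[OF a]] by auto
  ultimately have "\<theta> + a \<in> R" using add_root[OF theta_root S_root[OF a]] by simp
  then have "\<theta> - (\<theta> + a) \<in> Qplus S" by (rule theta_above)
  then have "- a \<in> Qplus S" by simp
  then show False using Qplus_antisym[OF Qplus_simple[OF a]] root_nonzero[OF S_root[OF a]] by simp
qed

text \<open>This is what \<open>L \<theta> \<mu>\<close> becomes when the Weyl character of highest weight \<open>\<theta>\<close> is replaced by
  \<open>r + \<Sum>\<gamma>\<in>R. e\<^bsup>\<gamma>\<^esup>\<close>; that the two agree is \<open>L_theta\<close> below.\<close>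

definition X :: "'a \<Rightarrow> int poly" where
  "X \<mu> = of_nat (card S) * L 0 \<mu> + (\<Sum>g\<in>R. L 0 (\<mu> - g))"

lemma L0_not_neg: "\<mu> \<in> Qplus S \<Longrightarrow> \<mu> \<noteq> 0 \<Longrightarrow> L 0 \<mu> = 0"
  using L0_vanish Qplus_antisym by blast

lemma X_0: "X 0 = of_nat (card S) + (qq - 1) * (\<Sum>g\<in>P. qq ^ (height S g - 1))"
proof -
  have "(\<Sum>g\<in>R. L 0 (0 - g)) = (\<Sum>g\<in>P. L 0 (- g)) + (\<Sum>g\<in>P. L 0 g)"
    by (subst sum_R_split) simp
  also have "(\<Sum>g\<in>P. L 0 g) = 0"
    using L0_not_neg pos_Qplus root_nonzero[OF pos_root] by (intro sum.neutral) blast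
  also have "(\<Sum>g\<in>P. L 0 (- g)) = (qq - 1) * (\<Sum>g\<in>P. qq ^ (height S g - 1))"
    by (simp add: L0_neg sum_distrib_left mult.commute)
  finally show ?thesis by (simp add: X_def L0_0)
qed

text \<open>Dominance gives \<open>cint g \<mu> \<ge> 2\<close>; the two Cartan integers have
  product below 4, so the other one is 1, which is the last claim.\<close>

lemma above_dominant:
  assumes \<mu>: "\<mu> \<in> P" "dom \<mu>" and g: "g \<in> R" "g \<noteq> \<mu>" "g - \<mu> \<in> Qplus S"
  shows "g - \<mu> \<in> P" "\<mu> \<bullet> \<mu> \<le> g \<bullet> \<mu>" "2 * (g \<bullet> \<mu>) = g \<bullet> g"
proof -
  have "\<mu> \<bullet> (g - \<mu>) \<ge> 0" using dom_Qplus \<mu>(2) g(3) by blast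
  then show le: "\<mu> \<bullet> \<mu> \<le> g \<bullet> \<mu>" by (simp add: inner_diff_right inner_commute)
  have mu: "\<mu> \<in> R" "\<mu> \<bullet> \<mu> > 0" using pos_root[OF \<mu>(1)] root_inner_pos by auto
  then have gm: "g \<bullet> \<mu> > 0" using le by (simp only: less_le_trans)
  then show "g - \<mu> \<in> P" using diff_root[OF g(1) mu(1)] g(2,3) by (simp add: pos_roots_def)
  have ne: "g \<noteq> - \<mu>" using gm by (metis inner_ge_zero inner_minus_left neg_0_less_iff_less not_le)
  obtain k where k: "cint \<mu> g = of_int k" using cint_obtain mu(1) g(1) by blast
  have k0: "cint \<mu> g > 0" using gm root_inner_pos[OF g(1)] by (simp add: cint_def inner_commute)
  have c2: "cint g \<mu> \<ge> 2" using le mu(2) by (simp add: cint_def field_simps)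
  have "k = 1"
  proof (rule ccontr)
    assume "k \<noteq> 1"
    then have "cint \<mu> g \<ge> 2" using k k0 by simp
    then have "2 * 2 \<le> cint g \<mu> * cint \<mu> g" using c2 by (intro mult_mono) auto
    then show False using cint_product_less[OF g(1) mu(1) g(2) ne] by simp
  qed
  then show "2 * (g \<bullet> \<mu>) = g \<bullet> g" using k root_inner_pos[OF g(1)] by (simp add: cint_def inner_commute)
qed

text \<open>This makes the sum in \<open>X\<close> geometric. For injectivity, note that the
  difference of two roots of equal height is never a root.\<close>

lemma heights_above_dominant:
  assumes \<mu>: "\<mu> \<in> P" "dom \<mu>"
  defines "G \<equiv> {g \<in> R. g \<noteq> \<mu> \<and> g - \<mu> \<in> Qplus S}"
  shows "bij_betw (\<lambda>g. height S (g - \<mu>)) G {1..N - height S \<mu>}"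
proof -
  have dP: "g - \<mu> \<in> P" if "g \<in> G" for g using that above_dominant(1)[OF \<mu>, of g] by (simp add: G_def)
  have inj: "inj_on (\<lambda>g. height S (g - \<mu>)) G"
  proof (rule inj_onI, rule ccontr)
    fix g g' assume gg: "g \<in> G" "g' \<in> G" "height S (g - \<mu>) = height S (g' - \<mu>)" "g \<noteq> g'"
    have R: "g \<in> R" "g' \<in> R" using gg by (auto simp: G_def)
    have h: "(g - \<mu>) \<bullet> rhoc = (g' - \<mu>) \<bullet> rhoc"
      using height_Qplus[OF pos_Qplus[OF dP]] gg by metis
    show False
    proof (cases "g \<bullet> g' > 0")
      case True
      then have "g - g' \<in> R" using diff_root[OF R _ gg(4)] by blast
      moreover have "(g - g') \<bullet> rhoc = 0" using h by (simp add: inner_diff_left)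
      ultimately show False
        using root_cases[of "g - g'"] pos_iff_rhoc[of "g - g'"] pos_iff_rhoc[of "- (g - g')"] pos_root
        by (simp del: minus_diff_eq)
    next
      case False
      have a: "\<mu> \<bullet> \<mu> \<le> g \<bullet> \<mu>" "2 * (g \<bullet> \<mu>) = g \<bullet> g" "\<mu> \<bullet> \<mu> \<le> g' \<bullet> \<mu>" "2 * (g' \<bullet> \<mu>) = g' \<bullet> g'"
        using above_dominant(2,3)[OF \<mu>, of g] above_dominant(2,3)[OF \<mu>, of g'] gg(1,2)
        unfolding G_def by blast+
      \<comment> \<open>two incomparable roots above \<open>\<mu>\<close> would be symmetric about \<open>\<mu>\<close>\<close>
      let ?d = "(g - \<mu>) + (g' - \<mu>)"
      have "?d \<bullet> ?d = g \<bullet> g + g' \<bullet> g' + 2 * (g \<bullet> g') - 4 * (g \<bullet> \<mu>) - 4 * (g' \<bullet> \<mu>) + 4 * (\<mu> \<bullet> \<mu>)"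
        by (simp add: inner_add_left inner_add_right inner_diff_left inner_diff_right inner_commute)
      also have "\<dots> \<le> 0" using a False by linarith
      finally have "?d = 0" by (metis inner_eq_zero_iff inner_ge_zero order_antisym)
      then have "g' - \<mu> = - (g - \<mu>)" by (metis add.commute eq_neg_iff_add_eq_0)
      then show False using dP[OF gg(1)] dP[OF gg(2)] pos_not_neg by metis
    qed
  qed
  have ht: "height S g = height S \<mu> + height S (g - \<mu>)" if "g \<in> G" for g
    using height_add[OF pos_Qplus[OF \<mu>(1)] pos_Qplus[OF dP[OF that]]] by simp
  have GP: "g \<in> P" if "g \<in> G" for g
    using Qplus_add[OF pos_Qplus[OF \<mu>(1)] pos_Qplus[OF dP[OF that]]] that by (simp add: pos_roots_def G_def)
  have sub: "(\<lambda>g. height S (g - \<mu>)) ` G \<subseteq> {1..N - height S \<mu>}"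
  proof (rule image_subsetI)
    fix g assume g: "g \<in> G"
    show "height S (g - \<mu>) \<in> {1..N - height S \<mu>}"
      using pos_height_ge1[OF dP[OF g]] height_le_N[OF GP[OF g]] ht[OF g] by simp
  qed
  \<comment> \<open>Descent from \<open>\<theta>\<close>, with \<open>i\<close> counting the steps.
    Dominance of \<open>\<mu>\<close> carries the positive product with \<open>a\<close> over from
    \<open>g - \<mu>\<close> to \<open>g\<close>.\<close>
  have "\<exists>g\<in>G. height S (g - \<mu>) = N - height S \<mu> - i" if "i < N - height S \<mu>" for i
    using that
  proof (induction i)
    case 0
    then have "\<theta> \<noteq> \<mu>" by auto
    then have "\<theta> \<in> G" using theta_root theta_above[OF pos_root[OF \<mu>(1)]] by (simp add: G_def)
    then show ?case using ht[of \<theta>] by (intro bexI[of _ \<theta>]) auto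
  next
    case (Suc i)
    then obtain g where g: "g \<in> G" "height S (g - \<mu>) = N - height S \<mu> - i" by auto
    have h2: "height S (g - \<mu>) \<ge> 2" using g Suc.prems by simp
    then have "g - \<mu> \<notin> S" using height_simple by force
    then obtain a where a: "a \<in> S" "(g - \<mu>) \<bullet> a > 0" "g - \<mu> - a \<in> P"
      using simple_descent[OF dP[OF g(1)]] by blast
    have "\<mu> \<bullet> a \<ge> 0" using \<mu>(2) a(1) by (simp add: dom_def)
    then have "g \<bullet> a > 0" using a(2) by (simp add: inner_diff_left)
    moreover have "g \<noteq> a" using ht[OF g(1)] h2 height_simple[OF a(1)] by auto
    ultimately have "g - a \<in> R" using diff_root g(1) S_root[OF a(1)] by (simp add: G_def)
    moreover have e: "g - a - \<mu> = g - \<mu> - a" by simp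
    moreover have "g - a \<noteq> \<mu>" using root_nonzero[OF pos_root[OF a(3)]] by auto
    ultimately have "g - a \<in> G" using pos_Qplus[OF a(3)] unfolding G_def mem_Collect_eq e by blast
    moreover have "height S (g - \<mu>) = height S (g - \<mu> - a) + 1"
      using height_diff_simple[OF dP[OF g(1)] a(1), of 1] a(3) by simp
    ultimately have "height S (g - a - \<mu>) = N - height S \<mu> - Suc i"
      unfolding e using g(2) by simp
    then show ?case using \<open>g - a \<in> G\<close> by blast
  qed
  then have "j \<in> (\<lambda>g. height S (g - \<mu>)) ` G" if "j \<in> {1..N - height S \<mu>}" for j
    using that by (force dest: spec[of _ "N - height S \<mu> - j"])
  then show ?thesis using inj sub by (auto simp: bij_betw_def)
qed

lemma X_dominant:
  assumes \<mu>: "\<mu> \<in> P" "dom \<mu>" shows "X \<mu> = qq ^ (N - height S \<mu>)"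
proof -
  let ?G = "{g \<in> R. g \<noteq> \<mu> \<and> g - \<mu> \<in> Qplus S}"
  have "L 0 (\<mu> - g) = 0" if "g \<in> R - insert \<mu> ?G" for g
    using that by (intro L0_vanish) auto
  then have "(\<Sum>g\<in>R. L 0 (\<mu> - g)) = (\<Sum>g\<in>insert \<mu> ?G. L 0 (\<mu> - g))"
    using finite_R pos_root[OF \<mu>(1)] by (intro sum.mono_neutral_right) auto
  also have "\<dots> = 1 + (\<Sum>g\<in>?G. L 0 (- (g - \<mu>)))"
    using finite_R by (subst sum.insert) (auto simp: L0_0)
  also have "(\<Sum>g\<in>?G. L 0 (- (g - \<mu>))) = (\<Sum>g\<in>?G. qq ^ (height S (g - \<mu>) - 1) * (qq - 1))"
    using above_dominant(1)[OF \<mu>] by (intro sum.cong refl L0_neg) auto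
  also have "\<dots> = (\<Sum>j=1..N - height S \<mu>. qq ^ (j - 1) * (qq - 1))"
    by (rule sum.reindex_bij_betw[OF heights_above_dominant[OF \<mu>]])
  also have "\<dots> = (\<Sum>j<N - height S \<mu>. qq ^ j) * (qq - 1)"
    by (simp add: sum_distrib_right sum.atLeast1_atMost_eq)
  also have "1 + \<dots> = qq ^ (N - height S \<mu>)"
    using one_diff_power_eq[of qq "N - height S \<mu>"] by (simp add: algebra_simps)
  finally show ?thesis
    using L0_not_neg[OF pos_Qplus[OF \<mu>(1)]] root_nonzero[OF pos_root[OF \<mu>(1)]] by (simp add: X_def)
qed

text \<open>The dot reflection in \<open>a\<close> with \<open>cint \<nu> a = - k\<close> adds
  \<open>k - 1\<close> copies of \<open>a\<close> at the cost of a sign and stays in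
  \<open>insert 0 R\<close>. For \<open>k = 1\<close> it fixes \<open>\<nu>\<close>, so
  \<open>L \<nu>\<close> is its own negative and vanishes.\<close>

lemma straighten:
  "\<nu> \<in> insert 0 R \<Longrightarrow> \<exists>c l. l \<in> insert 0 R \<and> dom l \<and> (\<forall>\<mu>. L \<nu> \<mu> = smult c (L l \<mu>))"
proof (induction "height S (\<theta> - \<nu>)" arbitrary: \<nu> rule: less_induct)
  case less
  have Q: "\<theta> - x \<in> Qplus S" if "x \<in> insert 0 R" for x
    using that theta_above pos_Qplus[OF theta_pos] by auto
  show ?case
  proof (cases "dom \<nu>")
    case True
    then show ?thesis using less.prems by (intro exI[of _ 1] exI[of _ \<nu>]) simp
  next
    case False
    then obtain a where a: "a \<in> S" "\<nu> \<bullet> a < 0" by (auto simp: dom_def)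
    have nu: "\<nu> \<in> R" using less.prems a by auto
    obtain k :: nat where k: "k \<ge> 1" "cint (- \<nu>) a = real k"
      using cint_pos_int[of "- \<nu>" a] nu S_root[OF a(1)] a(2) by auto
    have "cint \<nu> a = - real k" using k(2) by (simp add: cint_minus)
    then have ra: "refl a \<nu> - a = \<nu> + real (k - 1) *\<^sub>R a"
      using k(1) by (simp add: refl_cint of_nat_diff algebra_simps)
    have anti: "L (\<nu> + real (k - 1) *\<^sub>R a) \<mu> = - L \<nu> \<mu>" for \<mu>
      using L_dot[OF a(1), of \<nu> \<mu>] ra by simp
    show ?thesis
    proof (cases "k = 1")
      case True
      then have "L \<nu> \<mu> = - L \<nu> \<mu>" for \<mu> using anti[of \<mu>] by simp
      then have "L \<nu> \<mu> + L \<nu> \<mu> = 0 + 0" for \<mu> by (metis add.right_inverse add_0)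
      then have "L \<nu> \<mu> = 0" for \<mu> using poly_two_cancel by blast
      then show ?thesis by (intro exI[of _ 0] exI[of _ 0]) (simp add: dom_def)
    next
      case False
      have "\<nu> + a \<in> insert 0 R"
        using add_root[OF nu S_root[OF a(1)] a(2)] by (cases "\<nu> = - a") auto
      then have "refl a (\<nu> + a) \<in> insert 0 R" using refl_root[OF S_root[OF a(1)]] by auto
      then have n': "\<nu> + real (k - 1) *\<^sub>R a \<in> insert 0 R" using ra by (simp add: refl_add)
      have "real (height S (\<theta> - \<nu>)) = real (height S (\<theta> - (\<nu> + real (k - 1) *\<^sub>R a))) + real (k - 1)"
        using height_Qplus[OF Q[OF less.prems]] height_Qplus[OF Q[OF n']] inner_rhoc_simple[OF a(1)]
        by (simp add: inner_diff_left inner_add_left)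
      then have "height S (\<theta> - (\<nu> + real (k - 1) *\<^sub>R a)) < height S (\<theta> - \<nu>)"
        using False k(1) by linarith
      then obtain c l where cl: "l \<in> insert 0 R" "dom l" "\<forall>\<mu>. L (\<nu> + real (k - 1) *\<^sub>R a) \<mu> = smult c (L l \<mu>)"
        using less.hyps n' by blast
      then have "L \<nu> \<mu> = smult (- c) (L l \<mu>)" for \<mu> using anti[of \<mu>] by simp
      then show ?thesis using cl by blast
    qed
  qed
qed

lemma dom_root_pos: assumes "g \<in> R" "dom g" shows "g \<in> P"
proof (rule ccontr)
  assume "g \<notin> P"
  then have "- g \<in> Qplus S" using root_cases[OF assms(1)] pos_Qplus by blast
  then have "g \<bullet> (- g) \<ge> 0" using dom_Qplus assms(2) by blast
  then show False using root_inner_pos[OF assms(1)] by simp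
qed

text \<open>Straightening writes \<open>X\<close> as a combination of the \<open>L l\<close> with \<open>l\<close> dominant; since \<open>L l \<mu>\<close> is
  \<open>\<delta>\<^sub>l\<^sub>\<mu>\<close> at \<open>q = 0\<close>, its coefficients are the constant terms of the values of \<open>X\<close> already computed.\<close>

lemma L_theta: "L \<theta> \<mu> = X \<mu>"
proof -
  define c l where "c \<nu> = fst (SOME p. snd p \<in> insert 0 R \<and> dom (snd p) \<and> (\<forall>\<mu>. L \<nu> \<mu> = smult (fst p) (L (snd p) \<mu>)))"
    and "l \<nu> = snd (SOME p. snd p \<in> insert 0 R \<and> dom (snd p) \<and> (\<forall>\<mu>. L \<nu> \<mu> = smult (fst p) (L (snd p) \<mu>)))" for \<nu>
  have cl: "l \<nu> \<in> insert 0 R \<and> dom (l \<nu>) \<and> (\<forall>\<mu>. L \<nu> \<mu> = smult (c \<nu>) (L (l \<nu>) \<mu>))" if "\<nu> \<in> insert 0 R" for \<nu>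
    unfolding c_def l_def by (rule someI_ex) (use straighten[OF that] in auto)
  define D where "D = {x \<in> insert 0 R. dom x}"
  have fin: "finite (insert 0 R)" "finite D" using finite_R by (auto simp: D_def)
  have R0: "0 \<notin> R" using root_nonzero[of 0] by auto
  define m where "m \<nu> = (if \<nu> = 0 then int (card S) else 1)" for \<nu> :: 'a
  define C where "C x = (\<Sum>\<nu>\<in>{\<nu> \<in> insert 0 R. l \<nu> = x}. m \<nu> * c \<nu>)" for x
  have X: "X \<mu> = (\<Sum>x\<in>D. smult (C x) (L x \<mu>))" for \<mu>
  proof -
    have "X \<mu> = of_nat (card S) * L 0 \<mu> + (\<Sum>\<nu>\<in>R. L \<nu> \<mu>)" by (simp add: X_def sum_L_roots)
    also have "\<dots> = smult (m 0) (L 0 \<mu>) + (\<Sum>\<nu>\<in>R. smult (m \<nu>) (L \<nu> \<mu>))"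
      using R0 by (auto simp: m_def of_nat_poly intro!: sum.cong)
    also have "\<dots> = (\<Sum>\<nu>\<in>insert 0 R. smult (m \<nu>) (L \<nu> \<mu>))"
      using R0 finite_R by simp
    also have "\<dots> = (\<Sum>\<nu>\<in>insert 0 R. smult (m \<nu> * c \<nu>) (L (l \<nu>) \<mu>))"
      using cl by (intro sum.cong refl) (metis smult_smult)
    also have "\<dots> = (\<Sum>x\<in>D. \<Sum>\<nu>\<in>{\<nu> \<in> insert 0 R. l \<nu> = x}. smult (m \<nu> * c \<nu>) (L (l \<nu>) \<mu>))"
      using cl fin by (intro sum.group[symmetric]) (auto simp: D_def)
    also have "\<dots> = (\<Sum>x\<in>D. smult (C x) (L x \<mu>))"
      unfolding C_def by (intro sum.cong refl) (simp add: smult_sum)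
    finally show ?thesis .
  qed
  have C: "C x = coeff (X x) 0" if "x \<in> D" for x
  proof -
    have "coeff (X x) 0 = (\<Sum>y\<in>D. if y = x then C y else 0)"
      unfolding X coeff_sum using that by (intro sum.cong refl) (simp add: coeff_L_0 D_def)
    then show ?thesis using that fin by simp
  qed
  \<comment> \<open>The trivial module does not occur: at q = 0 the multiplicity
    \<open>card S\<close> of the zero weight is cancelled by the simple roots, the only ones with
    exponent ht - 1 = 0.\<close>
  have C0: "C 0 = 0"
  proof -
    have z: "coeff (qq ^ n) 0 = (if n = 0 then 1 else 0)" for n by (simp add: coeff_0_power qq_def)
    have "coeff (\<Sum>g\<in>P. qq ^ (height S g - 1)) 0 = (\<Sum>g\<in>P. if g \<in> S then 1 else 0)"
      unfolding coeff_sum z using height_one_simple height_simple pos_height_ge1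
      by (intro sum.cong refl) (force simp: le_Suc_eq)
    also have "\<dots> = int (card S)"
      using finite_P simple_pos by (simp add: sum.If_cases Int_absorb1 subsetI)
    finally have "coeff (X 0) 0 = 0" by (simp add: X_0 coeff_mult_0 qq_def of_nat_poly)
    then show ?thesis using C[of 0] by (simp add: D_def dom_def)
  qed
  have "C x = (if x = \<theta> then 1 else 0)" if "x \<in> D" for x
  proof (cases "x = 0")
    case True
    then show ?thesis using C0 root_nonzero[OF theta_root] by simp
  next
    case False
    then have x: "x \<in> P" "dom x" using that dom_root_pos by (auto simp: D_def)
    have "coeff (X x) 0 = (if N - height S x = 0 then 1 else 0)"
      by (simp add: X_dominant[OF x] coeff_0_power qq_def)
    moreover have "N - height S x = 0 \<longleftrightarrow> x = \<theta>"
    proof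
      assume "N - height S x = 0"
      then have "height S (\<theta> - x) = 0"
        using height_add[OF pos_Qplus[OF x(1)] theta_above[OF pos_root[OF x(1)]]] by simp
      then have "\<theta> - x = 0"
        using height_Qplus[OF theta_above[OF pos_root[OF x(1)]]] Qplus_rhoc_0[OF theta_above[OF pos_root[OF x(1)]]] by simp
      then show "x = \<theta>" by simp
    qed simp
    ultimately show ?thesis using C[OF that] by simp
  qed
  then have "X \<mu> = (\<Sum>x\<in>D. if x = \<theta> then L \<theta> \<mu> else 0)"
    unfolding X by (intro sum.cong refl) auto
  moreover have "\<theta> \<in> D" using theta_root theta_dom by (simp add: D_def)
  ultimately show ?thesis using fin by simp
qed

lemma L_theta_0: "L \<theta> 0 = of_nat (card S) + (qq - 1) * (\<Sum>g\<in>P. qq ^ (height S g - 1))"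
  by (simp add: L_theta X_0)

lemma L_theta_pos: "\<mu> \<in> P \<Longrightarrow> L \<theta> \<mu> = qq ^ (N - height S \<mu>)"
  by (rule L_pos) (simp_all add: L_theta X_dominant height_le_N)

lemma L_theta_neg: "d \<in> P \<Longrightarrow> L \<theta> (- d) = qq ^ (height S d - 1) * (qq ^ N + (qq - 1) * L \<theta> 0)"
proof (rule L_neg)
  fix a assume a: "a \<in> S"
  have "qq * L \<theta> a = qq ^ N"
    using L_theta_pos[OF simple_pos[OF a]] height_simple[OF a] N_ge1
    by (simp flip: power_Suc)
  then show "L \<theta> (- a) = qq ^ N + (qq - 1) * L \<theta> 0"
    using L_hecke[OF a, of \<theta> 0] by (simp add: algebra_simps)
qed

lemma sum_L_theta_roots:
  "(\<Sum>\<mu>\<in>R. L \<theta> \<mu>) = (\<Sum>g\<in>P. qq ^ (N - height S g))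
     + (\<Sum>g\<in>P. qq ^ (height S g - 1)) * (qq ^ N + (qq - 1) * L \<theta> 0)"
  by (subst sum_R_split) (simp add: L_theta_pos L_theta_neg sum_distrib_right)

end

section \<open>The number of roots and their lengths\<close>

context irr_roots begin

lemma irreducible_const:
  assumes "\<And>a b. a \<in> R \<Longrightarrow> b \<in> R \<Longrightarrow> a \<bullet> b \<noteq> 0 \<Longrightarrow> f a = f b" and "a \<in> R" "b \<in> R"
  shows "f a = f b"
proof (rule ccontr)
  assume ne: "f a \<noteq> f b"
  let ?A = "{x \<in> R. f x = f a}" and ?B = "{x \<in> R. f x \<noteq> f a}"
  have "?A \<union> ?B = R" "?A \<noteq> {}" "?B \<noteq> {}" using assms(2,3) ne by auto
  moreover have "\<forall>x\<in>?A. \<forall>y\<in>?B. x \<bullet> y = 0" using assms(1) by (metis (mono_tags, lifting) mem_Collect_eq)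
  ultimately show False using irr unfolding irreducible_rs_def by blast
qed

lemma span_R_S: "span R = span S"
proof
  have "R \<subseteq> span S"
  proof
    fix g assume "g \<in> R"
    then have "g \<in> Qplus S \<or> - g \<in> Qplus S" using root_cases pos_Qplus by blast
    moreover have "Qplus S \<subseteq> span S"
      unfolding Qplus_def by clarify (intro span_sum span_scale span_base)
    ultimately show "g \<in> span S" using span_neg[of "- g" S] by auto
  qed
  then show "span R \<subseteq> span S" by (simp add: span_minimal)
  show "span S \<subseteq> span R" by (rule span_mono[OF S_subset])
qed

text \<open>An invariant form, hence a multiple of the inner product; its trace is \<open>2 |R|\<close>,
  and evaluating it at \<open>\<theta>\<close> gives the multiple \<open>2 h\<close>.\<close>

definition \<Psi> :: "'a \<Rightarrow> 'a \<Rightarrow> real" where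
  "\<Psi> x y = (\<Sum>g\<in>R. 2 * (x \<bullet> g) * (y \<bullet> g) / (g \<bullet> g))"

lemma Psi_refl: assumes "a \<in> R" shows "\<Psi> (refl a x) (refl a y) = \<Psi> x y"
proof -
  have bij: "bij_betw (refl a) R R"
    using refl_root[OF assms] by (intro bij_betw_byWitness[where f' = "refl a"]) auto
  have "\<Psi> (refl a x) (refl a y) = (\<Sum>g\<in>R. 2 * (refl a x \<bullet> refl a g) * (refl a y \<bullet> refl a g) / (refl a g \<bullet> refl a g))"
    unfolding \<Psi>_def by (rule sum.reindex_bij_betw[OF bij, symmetric])
  then show ?thesis by (simp add: refl_inner \<Psi>_def)
qed

lemma Psi_linear: "\<Psi> (x + x') y = \<Psi> x y + \<Psi> x' y" "\<Psi> (c *\<^sub>R x) y = c * \<Psi> x y"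
  "\<Psi> x (y + y') = \<Psi> x y + \<Psi> x y'" "\<Psi> x (c *\<^sub>R y) = c * \<Psi> x y" "\<Psi> x y = \<Psi> y x"
  "\<Psi> (- x) y = - \<Psi> x y"
  by (simp_all add: \<Psi>_def inner_add_left sum.distrib[symmetric] sum_distrib_left sum_negf[symmetric]
      algebra_simps add_divide_distrib)

text \<open>\<open>\<Psi>\<close> is invariant under \<open>refl a\<close>, which negates
  \<open>a\<close> and fixes its orthogonal complement; so that complement pairs to zero with
  \<open>a\<close>.\<close>

lemma Psi_root: assumes "a \<in> R" shows "\<Psi> a y = \<Psi> a a / (a \<bullet> a) * (a \<bullet> y)"
proof -
  define z where "z = y - ((y \<bullet> a) / (a \<bullet> a)) *\<^sub>R a"
  have aa: "a \<bullet> a > 0" using root_inner_pos assms by blast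
  have za: "z \<bullet> a = 0" using aa by (simp add: z_def inner_diff_left)
  then have "refl a z = z" by (simp add: refl_def)
  then have "\<Psi> a z = - \<Psi> a z" using Psi_refl[OF assms, of a z] by (simp add: Psi_linear(6))
  then have z0: "\<Psi> a z = 0" by simp
  have "y = z + ((y \<bullet> a) / (a \<bullet> a)) *\<^sub>R a" by (simp add: z_def)
  then have "\<Psi> a y = \<Psi> a z + (y \<bullet> a) / (a \<bullet> a) * \<Psi> a a" by (metis Psi_linear(3,4))
  then show ?thesis using z0 by (simp add: inner_commute)
qed

lemma Psi_scalar:
  assumes "x \<in> span R" shows "\<Psi> x y = \<Psi> \<theta> \<theta> / (\<theta> \<bullet> \<theta>) * (x \<bullet> y)"
proof -
  define f where "f a = \<Psi> a a / (a \<bullet> a)" for a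
  have "f a = f b" if "a \<in> R" "b \<in> R" "a \<bullet> b \<noteq> 0" for a b
  proof -
    have "f a * (a \<bullet> b) = f b * (a \<bullet> b)"
      using Psi_root[OF that(1), of b] Psi_root[OF that(2), of a] Psi_linear(5)[of a b]
      unfolding f_def by (simp only: inner_commute[of b a])
    then show ?thesis using that(3) by simp
  qed
  then have c: "f a = f \<theta>" if "a \<in> R" for a
    using irreducible_const[of f a \<theta>] that theta_root by blast
  show ?thesis using assms
  proof (induction rule: span_induct_alt)
    case base
    then show ?case by (simp add: \<Psi>_def)
  next
    case (step d a x)
    have "\<Psi> a y = \<Psi> \<theta> \<theta> / (\<theta> \<bullet> \<theta>) * (a \<bullet> y)" using Psi_root[OF step(1), of y] c[OF step(1)] by (simp only: f_def)
    then show ?case using step by (simp add: Psi_linear(1,2) inner_add_left algebra_simps)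
  qed
qed

text \<open>For \<open>k \<ge> 2\<close> the root \<open>k \<theta> - g\<close>, the negative of a
  reflection of \<open>g\<close>, is at most as high as \<open>\<theta>\<close>, which forces
  \<open>g\<close> to be at least as high as \<open>\<theta>\<close>.\<close>

lemma cint_theta:
  assumes g: "g \<in> P" "g \<noteq> \<theta>" shows "cint g \<theta> = 0 \<or> cint g \<theta> = 1"
proof -
  obtain k where k: "cint g \<theta> = of_int k" using cint_obtain pos_root[OF g(1)] theta_root by blast
  have tt: "\<theta> \<bullet> rhoc > 0" using pos_iff_rhoc theta_root theta_pos by blast
  have "g \<bullet> \<theta> \<ge> 0" using dom_Qplus[OF theta_dom pos_Qplus[OF g(1)]] by (simp add: inner_commute)
  then have "cint g \<theta> \<ge> 0" using root_inner_pos[OF theta_root] by (simp add: cint_def)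
  then have k0: "k \<ge> 0" using k by simp
  have "k < 2"
  proof (rule ccontr)
    assume "\<not> k < 2"
    then have k2: "k \<ge> 2" by simp
    have "refl \<theta> g \<in> R" using refl_root theta_root pos_root[OF g(1)] by blast
    then have "of_int k *\<^sub>R \<theta> - g \<in> R" using k uminus_root[of "refl \<theta> g"] by (simp add: refl_cint)
    then have "\<theta> - (of_int k *\<^sub>R \<theta> - g) \<in> Qplus S" by (rule theta_above)
    then have "(\<theta> - (of_int k *\<^sub>R \<theta> - g)) \<bullet> rhoc \<ge> 0" by (rule Qplus_rhoc_nonneg)
    then have 1: "g \<bullet> rhoc \<ge> (of_int k - 1) * (\<theta> \<bullet> rhoc)" by (simp add: inner_diff_left algebra_simps)
    have "(of_int k - 1) * (\<theta> \<bullet> rhoc) \<ge> 1 * (\<theta> \<bullet> rhoc)"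
      using k2 tt by (intro mult_right_mono) auto
    then have "(\<theta> - g) \<bullet> rhoc \<le> 0" using 1 by (simp add: inner_diff_left)
    then have "\<theta> - g = 0" using Qplus_rhoc_0[OF theta_above[OF pos_root[OF g(1)]]] by blast
    then show False using g(2) by simp
  qed
  then have "k = 0 \<or> k = 1" using k0 by auto
  then show ?thesis using k by auto
qed

text \<open>For \<open>g\<close> other than \<open>\<theta>\<close> the integer
  \<open>cint g \<theta>\<close> equals its square, so the quadratic sum becomes the linear sum for
  \<open>\<theta> \<bullet> rhoc = N\<close>. The term of \<open>\<theta>\<close> itself counts
  twice, whence \<open>N + 1\<close>.\<close>

lemma Psi_theta: "\<Psi> \<theta> \<theta> = 2 * real (N + 1) * (\<theta> \<bullet> \<theta>)"
proof -
  let ?f = "\<lambda>g. 2 * (\<theta> \<bullet> g) * (\<theta> \<bullet> g) / (g \<bullet> g)"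
  have tt: "\<theta> \<bullet> \<theta> > 0" using root_inner_pos theta_root by blast
  have "\<Psi> \<theta> \<theta> = 2 * sum ?f P"
    unfolding \<Psi>_def by (subst sum_R_split) (simp)
  also have "sum ?f P = ?f \<theta> + sum ?f (P - {\<theta>})"
    by (rule sum.remove[OF finite_P theta_pos])
  also have "sum ?f (P - {\<theta>}) = (\<Sum>g\<in>P - {\<theta>}. (\<theta> \<bullet> \<theta>) * ((\<theta> \<bullet> g) / (g \<bullet> g)))"
  proof (intro sum.cong refl)
    fix g assume "g \<in> P - {\<theta>}"
    then have "cint g \<theta> = 0 \<or> cint g \<theta> = 1" using cint_theta by blast
    then have "\<theta> \<bullet> g = 0 \<or> 2 * (\<theta> \<bullet> g) = \<theta> \<bullet> \<theta>"
      using tt by (auto simp: cint_def inner_commute field_simps)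
    then show "?f g = (\<theta> \<bullet> \<theta>) * ((\<theta> \<bullet> g) / (g \<bullet> g))" by auto
  qed
  also have "\<dots> = (\<theta> \<bullet> \<theta>) * (\<Sum>g\<in>P - {\<theta>}. (\<theta> \<bullet> g) / (g \<bullet> g))" by (simp add: sum_distrib_left)
  also have "(\<Sum>g\<in>P - {\<theta>}. (\<theta> \<bullet> g) / (g \<bullet> g)) = real N - 1"
  proof -
    have "real N = (\<Sum>g\<in>P. (\<theta> \<bullet> g) / (g \<bullet> g))"
      using height_Qplus[OF pos_Qplus[OF theta_pos]] by (simp add: rhoc_def inner_sum_right)
    also have "\<dots> = (\<theta> \<bullet> \<theta>) / (\<theta> \<bullet> \<theta>) + (\<Sum>g\<in>P - {\<theta>}. (\<theta> \<bullet> g) / (g \<bullet> g))"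
      by (rule sum.remove[OF finite_P theta_pos])
    finally show ?thesis using tt by simp
  qed
  finally show ?thesis using tt by (simp add: algebra_simps)
qed

lemma card_roots: "card R = card S * (N + 1)"
proof -
  obtain B where B: "B \<subseteq> span R" "pairwise orthogonal B" "\<And>x. x \<in> B \<Longrightarrow> norm x = 1"
     "independent B" "card B = dim (span R)" "span B = span R"
    using orthonormal_basis_subspace[OF subspace_span, of R] by metis
  have dimR: "dim (span R) = card S"
    using dim_eq_card_independent[OF S_indep] by (simp add: span_R_S)
  have fB: "finite B" using B(4) independent_imp_finite by blast
  have tt: "\<theta> \<bullet> \<theta> > 0" using root_inner_pos theta_root by blast
  have Parseval: "(\<Sum>b\<in>B. (b \<bullet> g) * (b \<bullet> g)) = g \<bullet> g" if "g \<in> span R" for g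
  proof -
    have "g \<in> span B" using that B(6) by simp
    then obtain u where u: "g = (\<Sum>b\<in>B. u b *\<^sub>R b)" using span_finite[OF fB] by auto
    have bb: "b \<bullet> c = (if b = c then 1 else 0)" if "b \<in> B" "c \<in> B" for b c
      using B(2,3) that by (auto simp: pairwise_def orthogonal_def norm_eq_1)
    have ub: "b \<bullet> g = u b" if "b \<in> B" for b
    proof -
      have "b \<bullet> g = (\<Sum>c\<in>B. if b = c then u c else 0)"
        unfolding u inner_sum_right using bb[OF that] by (intro sum.cong refl) simp
      then show ?thesis using that fB by simp
    qed
    have "g \<bullet> g = (\<Sum>b\<in>B. u b * (b \<bullet> g))" by (subst u) (simp add: inner_sum_left)
    then show ?thesis using ub by simp
  qed
  have "(\<Sum>b\<in>B. \<Psi> b b) = (\<Sum>b\<in>B. 2 * real (N + 1))"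
  proof (intro sum.cong refl)
    fix b assume "b \<in> B"
    then have "b \<in> span R" "b \<bullet> b = 1" using B(1,3) by (auto simp: norm_eq_1)
    then show "\<Psi> b b = 2 * real (N + 1)" using Psi_scalar[of b b] Psi_theta tt by simp
  qed
  also have "\<dots> = 2 * real (card S * (N + 1))" using B(5) dimR by (simp add: algebra_simps)
  also have "(\<Sum>b\<in>B. \<Psi> b b) = (\<Sum>g\<in>R. \<Sum>b\<in>B. 2 * (b \<bullet> g) * (b \<bullet> g) / (g \<bullet> g))"
    unfolding \<Psi>_def by (rule sum.swap)
  also have "\<dots> = (\<Sum>g\<in>R. 2 * (\<Sum>b\<in>B. (b \<bullet> g) * (b \<bullet> g)) / (g \<bullet> g))"
    by (simp add: sum_distrib_left sum_divide_distrib mult.assoc)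
  also have "\<dots> = (\<Sum>g\<in>R. 2)"
    using Parseval[OF span_base] root_inner_pos by (intro sum.cong refl) auto
  finally have "2 * real (card R) = 2 * real (card S * (N + 1))" by simp
  then have "real (card R) = real (card S * (N + 1))" by simp
  then show ?thesis by (simp only: of_nat_eq_iff)
qed

text \<open>If \<open>x\<close> is orthogonal to all roots of this length and \<open>y\<close> of
  this length is not orthogonal to \<open>z\<close>, then \<open>y\<close> and
  \<open>refl z y\<close> are both orthogonal to \<open>x\<close>, hence so is \<open>z\<close>.
  Thus the roots like \<open>x\<close> split off, against irreducibility.\<close>

lemma nonorth_norm_root:
  assumes "b \<in> R" "g \<in> R"
  shows "\<exists>b'\<in>R. b' \<bullet> b' = b \<bullet> b \<and> b' \<bullet> g \<noteq> 0"
proof (rule ccontr)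
  assume no: "\<not> ?thesis"
  let ?O = "{x \<in> R. x \<bullet> x = b \<bullet> b}"
  let ?A = "{x \<in> R. \<forall>y\<in>?O. y \<bullet> x = 0}" and ?B = "{x \<in> R. \<exists>y\<in>?O. y \<bullet> x \<noteq> 0}"
  have "?A \<union> ?B = R" by blast
  moreover have "?A \<noteq> {}" using no assms by blast
  moreover have "?B \<noteq> {}" using assms root_inner_pos[of b] by force
  moreover have "\<forall>x\<in>?A. \<forall>z\<in>?B. x \<bullet> z = 0"
  proof (intro ballI)
    fix x z assume x: "x \<in> ?A" and z: "z \<in> ?B"
    then obtain y where y: "y \<in> ?O" "y \<bullet> z \<noteq> 0" by blast
    have zR: "z \<in> R" using z by blast
    have "refl z y \<in> ?O" using y refl_root[OF zR] by (simp add: refl_inner)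
    then have "refl z y \<bullet> x = 0" "y \<bullet> x = 0" using x y by blast+
    then have "cint y z * (z \<bullet> x) = 0" by (simp add: refl_cint inner_diff_left)
    moreover have "cint y z \<noteq> 0" using y root_inner_pos[OF zR] by (simp add: cint_def)
    ultimately show "x \<bullet> z = 0" by (simp add: inner_commute)
  qed
  ultimately show False using irr unfolding irreducible_rs_def by blast
qed

text \<open>Only the length of \<open>a\<close> matters, so \<open>a\<close> may be replaced by a
  root not orthogonal to \<open>b\<close>. The ratio is then that of two Cartan integers with
  product at most 3.\<close>

lemma norm_ratio:
  assumes "a \<in> R" "b \<in> R" "a \<bullet> a \<le> b \<bullet> b"
  shows "b \<bullet> b = a \<bullet> a \<or> b \<bullet> b = 2 * (a \<bullet> a) \<or> b \<bullet> b = 3 * (a \<bullet> a)"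
proof -
  obtain a' where a': "a' \<in> R" "a' \<bullet> a' = a \<bullet> a" "a' \<bullet> b \<noteq> 0" using nonorth_norm_root assms by blast
  show ?thesis
  proof (cases "a' = b \<or> a' = - b")
    case True
    then show ?thesis using a'(2) by auto
  next
    case False
    have pa: "a \<bullet> a > 0" "b \<bullet> b > 0" using root_inner_pos assms by auto
    obtain m n :: int where mn: "1 \<le> m * n" "m * n \<le> 3" and
      e1: "of_int m * (b \<bullet> b) = 2 * (a' \<bullet> b)" and e2: "of_int n * (a \<bullet> a) = 2 * (a' \<bullet> b)"
      using cint_pair[OF a'(1) assms(2) _ _ a'(3)] False a'(2) by metis
    have m0: "m \<noteq> 0" using mn by auto
    have "\<bar>of_int m\<bar> * (a \<bullet> a) \<le> \<bar>of_int m\<bar> * (b \<bullet> b)" using assms(3) by (intro mult_left_mono) auto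
    also have "\<dots> = \<bar>of_int n\<bar> * (a \<bullet> a)" using e1 e2 pa by (metis abs_mult abs_of_pos)
    finally have "\<bar>m\<bar> \<le> \<bar>n\<bar>" using pa by simp
    have "\<bar>m\<bar> = 1"
    proof (rule ccontr)
      assume "\<bar>m\<bar> \<noteq> 1"
      then have "\<bar>m\<bar> \<ge> 2" using m0 by linarith
      then have "2 * 2 \<le> \<bar>m\<bar> * \<bar>n\<bar>" using \<open>\<bar>m\<bar> \<le> \<bar>n\<bar>\<close> by (intro mult_mono) auto
      then show False using mn by (simp add: abs_mult[symmetric])
    qed
    then have "m = 1 \<or> m = -1" by auto
    then have "(n = 1 \<or> n = 2 \<or> n = 3) \<and> m = 1 \<or> (n = -1 \<or> n = -2 \<or> n = -3) \<and> m = -1"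
      using mn by auto
    then show ?thesis using e1 e2 by auto
  qed
qed

end

section \<open>Root strings\<close>

context irr_roots begin

lemma two_lengths:
  obtains n M :: real where "n > 0" "M = 2 \<or> M = 3" "\<And>g. g \<in> R \<Longrightarrow> g \<bullet> g = n \<or> g \<bullet> g = M * n"
proof -
  define n where "n = Min ((\<lambda>g. g \<bullet> g) ` R)"
  have ne: "(\<lambda>g. g \<bullet> g) ` R \<noteq> {}" "finite ((\<lambda>g. g \<bullet> g) ` R)" using theta_root finite_R by auto
  obtain a where a: "a \<in> R" "a \<bullet> a = n" using Min_in[OF ne(2,1)] by (auto simp: n_def)
  have le: "n \<le> g \<bullet> g" if "g \<in> R" for g using that ne by (simp add: n_def)
  have r: "g \<bullet> g = n \<or> g \<bullet> g = 2 * n \<or> g \<bullet> g = 3 * n" if "g \<in> R" for g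
    using norm_ratio[OF a(1) that] le[OF that] a(2) by simp
  have n0: "n > 0" using root_inner_pos a by auto
  show ?thesis
  proof (cases "\<exists>b\<in>R. b \<bullet> b = 2 * n")
    case True
    then obtain b where b: "b \<in> R" "b \<bullet> b = 2 * n" by blast
    have "g \<bullet> g \<noteq> 3 * n" if "g \<in> R" for g
      using norm_ratio[OF b(1) that] b(2) n0 by auto
    then show ?thesis using that[of n 2] n0 r by auto
  next
    case False
    \<comment> \<open>The value 3 also serves when there is a single root length.\<close>
    then show ?thesis using that[of n 3] n0 r by auto
  qed
qed

lemma cint_abs_le3:
  assumes "x \<in> R" "a \<in> R" "x \<noteq> a" "x \<noteq> - a"
  obtains k :: int where "cint x a = of_int k" "-3 \<le> k" "k \<le> 3"
proof (cases "x \<bullet> a = 0")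
  case True
  then show ?thesis using that[of 0] by (simp add: cint_def)
next
  case False
  obtain k l :: int where kl: "cint x a = of_int k" "1 \<le> k * l" "k * l \<le> 3"
    using cint_pair[OF assms False] by metis
  have "l \<noteq> 0" using kl by auto
  then have "\<bar>k\<bar> * 1 \<le> \<bar>k\<bar> * \<bar>l\<bar>" by (intro mult_left_mono) auto
  then have "\<bar>k\<bar> \<le> 3" using kl by (simp add: abs_mult[symmetric])
  then show ?thesis using that[of k] kl(1) by auto
qed

lemma cint_norm_sq:
  assumes "x \<in> R" "a \<in> R" "x \<noteq> a" "x \<noteq> - a" "cint x a = - of_nat k" "k \<ge> 2"
  shows "x \<bullet> x = of_nat k * (a \<bullet> a)"
proof -
  have "x \<bullet> a \<noteq> 0" using assms(5,6) by (auto simp: cint_def)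
  then obtain m l :: int where ml: "cint x a = of_int m" "of_int m * (a \<bullet> a) = 2 * (x \<bullet> a)"
    "of_int l * (x \<bullet> x) = 2 * (x \<bullet> a)" "1 \<le> m * l" "m * l \<le> 3"
    using cint_pair[OF assms(1-4)] by metis
  have "real_of_int m = of_int (- int k)" using ml(1) assms(5) by simp
  then have m: "m = - int k" by (simp only: of_int_eq_iff)
  have "l < 0" using ml(4) m by (metis mult_nonpos_nonneg not_le not_one_le_zero of_nat_0_le_iff order_trans neg_le_0_iff_le)
  moreover have "l > -2"
  proof (rule ccontr)
    assume "\<not> l > -2"
    then have "2 * 2 \<le> int k * (- l)" using assms(6) by (intro mult_mono) auto
    then show False using ml(5) m by simp
  qed
  ultimately have "l = -1" by linarith
  then show ?thesis using ml(2,3) m by simp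
qed

text \<open>With \<open>p\<close> and \<open>q\<close> the lengths of the \<open>a\<close>-string below and above \<open>x\<close>, this is \<open>(p + 1) q\<close>,
  the squared matrix coefficient of the raising operator in an orthonormal weight basis of the
  corresponding simple \<open>sl\<^sub>2\<close>-module.\<close>

definition strw :: "'a \<Rightarrow> 'a \<Rightarrow> real" where
  "strw a x = (if x \<in> R \<and> x + a \<in> R then
     (if x \<bullet> x = (x + a) \<bullet> (x + a) then (if x - a \<in> R then 4 else 1)
      else max (x \<bullet> x) ((x + a) \<bullet> (x + a)) / min (x \<bullet> x) ((x + a) \<bullet> (x + a))) else 0)"

lemma strw_nonneg: "strw a x \<ge> 0"
  unfolding strw_def by (auto simp: max_def min_def)

lemma strw_0: "x \<notin> R \<or> x + a \<notin> R \<Longrightarrow> strw a x = 0"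
  by (auto simp: strw_def)

lemma inner_add_norm: "(x + a) \<bullet> (x + a) = x \<bullet> x + (1 + cint x a) * (a \<bullet> a)"
proof (cases "a = 0")
  case False
  then show ?thesis
    by (simp add: cint_def inner_add_left inner_add_right inner_commute field_simps)
qed simp

lemma cint_add_self: "a \<noteq> 0 \<Longrightarrow> cint (x + c *\<^sub>R a) a = cint x a + 2 * c"
  by (simp add: cint_def inner_add_left add_divide_distrib distrib_left)

lemma norm_eq_cint: assumes "a \<in> R" shows "x \<bullet> x = (x + a) \<bullet> (x + a) \<longleftrightarrow> cint x a = -1"
  unfolding inner_add_norm using root_inner_pos[OF assms] by auto

lemma string_flip:
  assumes "a \<in> R" "cint x a = -1" shows "x + 2 *\<^sub>R a \<in> R \<longleftrightarrow> x - a \<in> R"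
proof -
  have "refl a (x - a) = x + 2 *\<^sub>R a"
    unfolding refl_diff refl_self using assms(2) by (simp add: refl_cint[of a x] scaleR_2)
  then show ?thesis using refl_root_iff[OF assms(1), of "x - a"] by simp
qed

text \<open>Negation turns the string around and exchanges p + 1 with q.\<close>

lemma strw_reverse: assumes a: "a \<in> R" shows "strw a (- x - a) = strw a x"
proof -
  have 1: "- x - a \<in> R \<longleftrightarrow> x + a \<in> R" using uminus_root_iff[of "x + a"] by simp
  have 2: "- x - a + a \<in> R \<longleftrightarrow> x \<in> R" by simp
  have 3: "- x - a - a \<in> R \<longleftrightarrow> x + 2 *\<^sub>R a \<in> R"
  proof -
    have "- x - a - a = - (x + 2 *\<^sub>R a)" by (simp add: scaleR_2)
    then show ?thesis by (simp only: uminus_root_iff)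
  qed
  have 4: "(- x - a) \<bullet> (- x - a) = (x + a) \<bullet> (x + a)" "(- x - a + a) \<bullet> (- x - a + a) = x \<bullet> x"
    by (simp_all add: inner_diff_left inner_diff_right inner_add_left inner_add_right inner_commute)
  show ?thesis
    unfolding strw_def 1 2 3 4 using string_flip[OF a, of x] norm_eq_cint[OF a, of x]
    by (auto simp: max.commute min.commute)
qed

text \<open>(p + 1) q - p (q + 1) = q - p, the relation [e, f] = h on one string, checked for each
  possible Cartan integer.\<close>

lemma strw_diff_nonpos:
  assumes g: "g \<in> R" and a: "a \<in> R" and ne: "g \<noteq> a" "g \<noteq> - a" and le: "cint g a \<le> 0"
  shows "strw a g - strw a (g - a) = - cint g a"
proof -
  obtain k :: int where k: "cint g a = of_int k" "-3 \<le> k" "k \<le> 3" using cint_abs_le3[OF g a ne] by blast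
  have aa: "a \<bullet> a > 0" "g \<bullet> g > 0" using root_inner_pos g a by auto
  have a0: "a \<noteq> 0" using root_nonzero a by blast
  have cm: "cint (g - a) a = of_int k - 2" using cint_add_self[OF a0, of g "-1"] k by simp
  have nm: "(g - a) \<bullet> (g - a) = g \<bullet> g + (1 - of_int k) * (a \<bullet> a)"
    using inner_add_norm[of "g - a" a] cm by (simp add: algebra_simps)
  have ga: "g + a \<in> R" if "k < 0"
  proof -
    have "2 * (g \<bullet> a) = of_int k * (a \<bullet> a)" using k(1) aa by (simp add: cint_def field_simps)
    moreover have "of_int k * (a \<bullet> a) < 0" using that aa by (intro mult_neg_pos) auto
    ultimately have "g \<bullet> a < 0" by linarith
    then show ?thesis using add_root g a ne by blast
  qed
  have nga: "g - a \<notin> R" if "k \<le> -2"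
  proof
    assume r: "g - a \<in> R"
    have "g - a \<noteq> a" by (rule root_diff_ne[OF a g])
    moreover have "g - a \<noteq> - a" using root_nonzero[OF g] by auto
    ultimately obtain l :: int where "cint (g - a) a = of_int l" "-3 \<le> l" using cint_abs_le3[OF r a] by blast
    then show False using cm that by linarith
  qed
  have ng: "(g + a) \<bullet> (g + a) = g \<bullet> g + (1 + of_int k) * (a \<bullet> a)" using inner_add_norm[of g a] k by simp
  have "k \<le> 0" using le k by simp
  then consider "k = 0" | "k = -1" | "k = -2" | "k = -3" using k by linarith
  then show ?thesis
  proof cases
    case 1
    have "refl a (g + a) = g - a" unfolding refl_add refl_self using 1 k by (simp add: refl_cint[of a g])
    then have "g + a \<in> R \<longleftrightarrow> g - a \<in> R" using refl_root_iff[OF a, of "g + a"] by simp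
    then show ?thesis using g 1 k aa ng nm not_le[of "a \<bullet> a" 0]
      by (auto simp: strw_def max_def min_def simp del: inner_gt_zero_iff)
  next
    case 2
    \<comment> \<open>If \<open>g - a\<close> is a root, then \<open>g\<close> is the second of a
      string of four, with p = 1 and q = 2; this is where the value 4 in \<open>strw\<close> comes
      from.\<close>
    show ?thesis
    proof (cases "g - a \<in> R")
      case True
      have "g - a \<noteq> a" by (rule root_diff_ne[OF a g])
      moreover have "g - a \<noteq> - a" using root_nonzero[OF g] by auto
      ultimately have "(g - a) \<bullet> (g - a) = of_nat 3 * (a \<bullet> a)"
        using cint_norm_sq[OF True a, of 3] cm 2 by simp
      then have "g \<bullet> g = a \<bullet> a" "(g - a) \<bullet> (g - a) = 3 * (g \<bullet> g)" using nm 2 by simp_all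
      then show ?thesis using g ga 2 k aa ng True by (simp add: strw_def)
    next
      case False
      then show ?thesis using g ga 2 k ng by (simp add: strw_def)
    qed
  next
    case 3
    then have "g \<bullet> g = 2 * (a \<bullet> a)" using cint_norm_sq[OF g a ne, of 2] k by simp
    then show ?thesis using g ga nga 3 k aa ng by (simp add: strw_def)
  next
    case 4
    then have "g \<bullet> g = 3 * (a \<bullet> a)" using cint_norm_sq[OF g a ne, of 3] k by simp
    then show ?thesis using g ga nga 4 k aa ng by (simp add: strw_def)
  qed
qed

lemma strw_diff:
  assumes g: "g \<in> R" and a: "a \<in> R" and ne: "g \<noteq> a" "g \<noteq> - a"
  shows "strw a g - strw a (g - a) = - cint g a"
proof (cases "cint g a \<le> 0")
  case False
  have "strw a (- g) - strw a (- g - a) = - cint (- g) a"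
    using False g a ne by (intro strw_diff_nonpos) (auto simp: cint_minus)
  moreover have "strw a (- g - a) = strw a g" by (rule strw_reverse[OF a])
  moreover have "strw a (- g) = strw a (g - a)" using strw_reverse[OF a, of "g - a"] by simp
  ultimately show ?thesis by (simp add: cint_minus)
qed (rule strw_diff_nonpos[OF assms])

text \<open>If the last corner were missing, \<open>(x + a) \<bullet> b\<close> and
  \<open>(x + b) \<bullet> a\<close> would be nonnegative. This makes
  \<open>(x + a) \<bullet> (x + b)\<close> positive and the difference \<open>a - b\<close> a
  root.\<close>

lemma square_completes:
  assumes a: "a \<in> R" "b \<in> R" "a \<noteq> b" "a - b \<notin> R"
    and x: "x \<in> R" "x + a \<in> R" "x + b \<in> R" "x + a + b \<noteq> 0"
  shows "x + a + b \<in> R"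
proof (rule ccontr)
  assume n: "x + a + b \<notin> R"
  have ab: "a \<bullet> b \<le> 0" using diff_root[OF a(1,2) _ a(3)] a(4) by force
  have "(x + a) \<bullet> b \<ge> 0"
    using add_root[OF x(2) a(2)] n x(4) by (metis eq_neg_iff_add_eq_0 not_le)
  then have 1: "x \<bullet> b + a \<bullet> b \<ge> 0" by (simp add: inner_add_left)
  have "x + b + a = x + a + b" by simp
  then have "(x + b) \<bullet> a \<ge> 0"
    using add_root[OF x(3) a(1)] n x(4) by (metis eq_neg_iff_add_eq_0 not_le)
  then have 2: "x \<bullet> a + a \<bullet> b \<ge> 0" by (simp add: inner_add_left inner_commute[of b a])
  have "(x + a) \<bullet> (x + b) = x \<bullet> x + x \<bullet> a + x \<bullet> b + a \<bullet> b"
    by (simp add: inner_add_left inner_add_right inner_commute)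
  also have "\<dots> > 0" using 1 2 ab root_inner_pos[OF x(1)] by linarith
  finally have "(x + a) - (x + b) \<in> R" using diff_root[OF x(2,3)] a(3) by simp
  then show False using a(4) by simp
qed

context
  fixes a b x :: 'a
  assumes a: "a \<in> R" "b \<in> R" "a \<noteq> b" "a - b \<notin> R" "a \<noteq> - b"
    and x: "x \<in> R" "x + a \<in> R" "x + b \<in> R" "x + a + b \<in> R"
begin

lemma square_obtuse: "a \<bullet> b \<le> 0"
  using diff_root[OF a(1,2) _ a(3)] a(4) by force

lemma square_parallelogram:
  "2 * (a \<bullet> b) = (x + a + b) \<bullet> (x + a + b) + x \<bullet> x - (x + a) \<bullet> (x + a) - (x + b) \<bullet> (x + b)"
  by (simp add: inner_add_left inner_add_right inner_commute)

text \<open>With squared lengths \<open>n\<close> and \<open>3 * n\<close>, integrality of the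
  Cartan integers rules out a long root, and two short roots with this inner product are
  opposite.\<close>

lemma square_short_false:
  assumes "2 * (a \<bullet> b) = - 2 * n" "n > 0" "a \<bullet> a = n \<or> a \<bullet> a = 3 * n" "b \<bullet> b = n \<or> b \<bullet> b = 3 * n"
  shows False
proof -
  obtain k where k: "cint b a = of_int k" using cint_obtain a by blast
  obtain l where l: "cint a b = of_int l" using cint_obtain a by blast
  have "of_int k * (a \<bullet> a) = - 2 * n" "of_int l * (b \<bullet> b) = - 2 * n"
    using k l assms(1) root_inner_pos[OF a(1)] root_inner_pos[OF a(2)] by (simp_all add: cint_def inner_commute field_simps)
  moreover have "\<not> of_int m * (3 * n) = - 2 * n" for m
  proof
    assume "of_int m * (3 * n) = - 2 * n"
    then have "(3 * of_int m + 2) * n = 0" by (simp add: algebra_simps)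
    then have "3 * of_int m + 2 = (0::real)" using assms(2) by simp
    then have "of_int (3 * m) = (of_int (-2) :: real)" by simp
    then have "3 * m = -2" by (simp only: of_int_eq_iff)
    then show False by presburger
  qed
  ultimately have "a \<bullet> a = n" "b \<bullet> b = n" using assms(3,4) by auto
  then have "(a + b) \<bullet> (a + b) = 0" using assms(1) by (simp add: inner_add_left inner_add_right inner_commute)
  then show False using a(5) by (simp add: eq_neg_iff_add_eq_0)
qed

text \<open>Otherwise the parallelogram identity makes \<open>2 * (a \<bullet> b)\<close> equal to
  \<open>(M - 1) * n\<close> or \<open>(1 - M) * n\<close>. The first is positive; the second makes
  \<open>a - b\<close> a root if \<open>M = 2\<close> and contradicts
  \<open>square_short_false\<close> if \<open>M = 3\<close>.\<close>

lemma square_norms: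
  assumes "(x + a) \<bullet> (x + a) = (x + b) \<bullet> (x + b)"
  shows "x \<bullet> x = (x + a + b) \<bullet> (x + a + b)"
proof (rule ccontr)
  assume ne: "x \<bullet> x \<noteq> (x + a + b) \<bullet> (x + a + b)"
  obtain n M :: real where n: "n > 0" "M = 2 \<or> M = 3" "\<And>g. g \<in> R \<Longrightarrow> g \<bullet> g = n \<or> g \<bullet> g = M * n"
    using two_lengths by blast
  have s: "x \<bullet> x + (x + a + b) \<bullet> (x + a + b) = (M + 1) * n"
    using n(3)[OF x(1)] n(3)[OF x(4)] ne by (auto simp: algebra_simps)
  have e: "2 * (a \<bullet> b) = (M + 1) * n - 2 * ((x + a) \<bullet> (x + a))" using square_parallelogram s assms by linarith
  have "(x + a) \<bullet> (x + a) \<noteq> n"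
  proof
    assume "(x + a) \<bullet> (x + a) = n"
    then have "2 * (a \<bullet> b) = (M - 1) * n" using e by (simp add: algebra_simps)
    moreover have "(M - 1) * n > 0" using n by auto
    ultimately show False using square_obtuse by linarith
  qed
  then have X: "(x + a) \<bullet> (x + a) = M * n" using n(3)[OF x(2)] by blast
  then have ab: "2 * (a \<bullet> b) = (1 - M) * n" using e by (simp add: algebra_simps)
  show False
  proof (cases "M = 2")
    case True
    obtain k where k: "cint b a = of_int k" using cint_obtain a by blast
    obtain l where l: "cint a b = of_int l" using cint_obtain a by blast
    have kl: "of_int k * (a \<bullet> a) = - n" "of_int l * (b \<bullet> b) = - n"
      using k l ab True root_inner_pos[OF a(1)] root_inner_pos[OF a(2)] by (simp_all add: cint_def inner_commute field_simps)
    have "\<not> of_int m * (2 * n) = - n" for m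
    proof
      assume "of_int m * (2 * n) = - n"
      then have "(of_int (2 * m) + 1) * n = 0" by (simp add: algebra_simps)
      then have "of_int (2 * m + 1) = (of_int 0 :: real)" using n(1) by simp
      then have "2 * m + 1 = 0" by (simp only: of_int_eq_iff)
      then show False by presburger
    qed
    then have "a \<bullet> a = n" "b \<bullet> b = n" using kl n(3)[OF a(1)] n(3)[OF a(2)] True by auto
    then have "(a - b) \<bullet> (a - b) = 3 * n" using ab True by (simp add: inner_diff_left inner_diff_right inner_commute)
    moreover have "(a - b) \<bullet> (a - b) = (x + a) \<bullet> (x + a) + (x + b) \<bullet> (x + b) - 2 * ((x + a) \<bullet> (x + b))"
      by (simp add: inner_diff_left inner_diff_right inner_add_left inner_add_right inner_commute)
    ultimately have "(x + a) \<bullet> (x + b) > 0" using X assms True n(1) by simp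
    then have "(x + a) - (x + b) \<in> R" using diff_root[OF x(2,3)] a(3) by simp
    then show False using a(4) by simp
  next
    case False
    then show False using n ab square_short_false[OF _ n(1)] n(3)[OF a(1)] n(3)[OF a(2)] by auto
  qed
qed

text \<open>Strings of four roots require \<open>M = 3\<close>. The parallelogram identity then
  leaves only \<open>a \<bullet> b = 0\<close>, so the shifted edge has equal norms too; without
  \<open>x + b - a\<close> some Cartan integer would be 4/3.\<close>

lemma square_long_string:
  assumes eq: "x \<bullet> x = (x + a) \<bullet> (x + a)" and xa: "x - a \<in> R"
  shows "(x + b) \<bullet> (x + b) = (x + b + a) \<bullet> (x + b + a) \<and> x + b - a \<in> R"
proof -
  obtain n M :: real where n: "n > 0" "M = 2 \<or> M = 3" "\<And>g. g \<in> R \<Longrightarrow> g \<bullet> g = n \<or> g \<bullet> g = M * n"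
    using two_lengths by blast
  have a0: "a \<noteq> 0" using root_nonzero a by blast
  have c: "cint x a = -1" using eq norm_eq_cint[OF a(1)] by blast
  then have cm: "cint (x - a) a = -3" using cint_add_self[OF a0, of x "-1"] by simp
  have "x - a \<noteq> a" by (rule root_diff_ne[OF a(1) x(1)])
  moreover have "x - a \<noteq> - a" using root_nonzero[OF x(1)] by auto
  ultimately have l: "(x - a) \<bullet> (x - a) = 3 * (a \<bullet> a)" using cint_norm_sq[OF xa a(1), of 3] cm by simp
  have aa: "a \<bullet> a > 0" "b \<bullet> b > 0" using root_inner_pos a by auto
  have "(x - a) \<bullet> (x - a) = x \<bullet> x + 2 * (a \<bullet> a)"
    using inner_add_norm[of "x - a" a] cm by simp
  then have xx: "x \<bullet> x = a \<bullet> a" using l by simp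
  have M: "M = 3" "a \<bullet> a = n" using n(1,2) n(3)[OF a(1)] n(3)[OF xa] l aa by auto
  have xa2: "2 * (x \<bullet> a) = - n" using c M aa by (simp add: cint_def field_simps)
  have T: "(x + a + b) \<bullet> (x + a + b) = (x + b) \<bullet> (x + b) + 2 * (a \<bullet> b)"
    using square_parallelogram eq by simp
  have ab: "a \<bullet> b = 0"
  proof (rule ccontr)
    assume "a \<bullet> b \<noteq> 0"
    then have "a \<bullet> b < 0" using square_obtuse by simp
    then have "(x + a + b) \<bullet> (x + a + b) < (x + b) \<bullet> (x + b)" using T by simp
    then have "2 * (a \<bullet> b) = - 2 * n" using T M n(1) n(3)[OF x(3)] n(3)[OF x(4)] by auto
    then show False using square_short_false[OF _ n(1)] n(3)[OF a(1)] n(3)[OF a(2)] M by simp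
  qed
  have e: "x + b + a = x + a + b" by simp
  have "x + b - a \<in> R"
  proof (rule ccontr)
    assume n': "x + b - a \<notin> R"
    have "x - a \<noteq> - b"
    proof
      assume "x - a = - b"
      then have "x = a - b" by (simp add: diff_eq_eq)
      then show False using x(1) a(4) by simp
    qed
    moreover have "x - a + b \<notin> R" using n' by (simp add: algebra_simps)
    ultimately have "(x - a) \<bullet> b \<ge> 0" using add_root[OF xa a(2)] by force
    then have xb: "x \<bullet> b \<ge> 0" using ab by (simp add: inner_diff_left)
    have X': "(x + b) \<bullet> (x + b) = n + b \<bullet> b + 2 * (x \<bullet> b)"
      using xx M by (simp add: inner_add_left inner_add_right inner_commute)
    then have "(x + b) \<bullet> (x + b) = 3 * n" using n(1) n(3)[OF x(3)] M xb aa(2) by auto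
    then have xb2: "2 * (x \<bullet> b) = n" "b \<bullet> b = n" using X' n(3)[OF a(2)] M xb n(1) by auto
    have "(x - a) \<bullet> (x + b) = 2 * n"
    proof -
      have "(x - a) \<bullet> (x + b) = x \<bullet> x + x \<bullet> b - x \<bullet> a - a \<bullet> b"
        by (simp add: inner_diff_left inner_add_right inner_commute[of a x])
      then show ?thesis using xx M xb2 xa2 ab by linarith
    qed
    moreover obtain k where k: "cint (x - a) (x + b) = of_int k" using cint_obtain xa x(3) by blast
    ultimately have "of_int k = 4 * n / (3 * n)" using \<open>(x + b) \<bullet> (x + b) = 3 * n\<close> by (simp add: cint_def)
    then have "of_int (3 * k) = (of_int 4 :: real)" using n(1) by (simp add: field_simps)
    then have "3 * k = 4" by (simp only: of_int_eq_iff)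
    then show False by presburger
  qed
  then show ?thesis unfolding e using T ab by simp
qed

end

text \<open>A length factor times a factor for the middle of a four-root string; around a square the
  two factors are compared separately.\<close>

lemma strw_cases:
  "\<exists>M::real. (M = 2 \<or> M = 3) \<and>
    (\<forall>a x. x \<in> R \<longrightarrow> x + a \<in> R \<longrightarrow> strw a x = (if x \<bullet> x = (x + a) \<bullet> (x + a) then 1 else M)
       * (if x \<bullet> x = (x + a) \<bullet> (x + a) \<and> x - a \<in> R then 4 else 1)) \<and>
    (\<forall>x\<in>R. \<forall>y\<in>R. \<forall>z\<in>R. x \<bullet> x \<noteq> y \<bullet> y \<longrightarrow> x \<bullet> x \<noteq> z \<bullet> z \<longrightarrow> y \<bullet> y = z \<bullet> z)"
proof -
  obtain n M :: real where n: "n > 0" "M = 2 \<or> M = 3" "\<And>g. g \<in> R \<Longrightarrow> g \<bullet> g = n \<or> g \<bullet> g = M * n"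
    using two_lengths by blast
  have "strw a x = (if x \<bullet> x = (x + a) \<bullet> (x + a) then 1 else M)
       * (if x \<bullet> x = (x + a) \<bullet> (x + a) \<and> x - a \<in> R then 4 else 1)" if "x \<in> R" "x + a \<in> R" for a x
    using that n(1,2) n(3)[OF that(1)] n(3)[OF that(2)] unfolding strw_def by (auto simp: max_def min_def)
  moreover have "y \<bullet> y = z \<bullet> z" if "x \<in> R" "y \<in> R" "z \<in> R" "x \<bullet> x \<noteq> y \<bullet> y" "x \<bullet> x \<noteq> z \<bullet> z" for x y z
    using that(4,5) n(3)[OF that(1)] n(3)[OF that(2)] n(3)[OF that(3)] by metis
  ultimately show ?thesis using n(2) by blast
qed

lemma four_values:
  fixes p q r t M :: real
  assumes "q = r \<Longrightarrow> p = t" "p \<noteq> q \<Longrightarrow> p \<noteq> r \<Longrightarrow> q = r" "q \<noteq> r \<Longrightarrow> q \<noteq> t \<Longrightarrow> r = t"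
  shows "(if p = q then 1 else M) * (if p = r then 1 else M) = (if r = t then 1 else M) * (if q = t then 1 else M)"
proof (cases "q = r")
  case True
  then show ?thesis using assms(1) by simp
next
  case False
  then have "p = q \<or> p = r" "t = q \<or> t = r" using assms(2,3) by blast+
  then show ?thesis using False by auto
qed

text \<open>In absolute value this is [e_a, f_b] = 0 for a - b not a root: the paths from
  \<open>x + b\<close> to \<open>x + a\<close> through \<open>x\<close> and through
  \<open>x + a + b\<close> have equal coefficients.\<close>

lemma square_strw:
  assumes a: "a \<in> R" "b \<in> R" "a \<noteq> b" "a - b \<notin> R" "a \<noteq> - b"
    and x: "x \<in> R" "x + a \<in> R" "x + b \<in> R" "x + a + b \<in> R"
  shows "strw a x * strw b x = strw a (x + b) * strw b (x + a)"
proof -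
  have a': "b \<in> R" "a \<in> R" "b \<noteq> a" "b - a \<notin> R" "b \<noteq> - a"
    using a root_diff_commute by auto
  have x': "x + b + a \<in> R" using x(4) by (simp add: algebra_simps)
  have flip: "(c \<bullet> c = (c + u) \<bullet> (c + u) \<and> c - u \<in> R) \<longleftrightarrow>
      ((c + v) \<bullet> (c + v) = (c + v + u) \<bullet> (c + v + u) \<and> c + v - u \<in> R)"
    if u: "u \<in> R" "v \<in> R" "u \<noteq> v" "u - v \<notin> R" "u \<noteq> - v"
      and c: "c \<in> R" "c + u \<in> R" "c + v \<in> R" "c + u + v \<in> R" for u v c
  proof
    assume "c \<bullet> c = (c + u) \<bullet> (c + u) \<and> c - u \<in> R"
    then show "(c + v) \<bullet> (c + v) = (c + v + u) \<bullet> (c + v + u) \<and> c + v - u \<in> R"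
      using square_long_string[OF u c] by blast
  next
    assume h: "(c + v) \<bullet> (c + v) = (c + v + u) \<bullet> (c + v + u) \<and> c + v - u \<in> R"
    define y where "y = - (c + u + v)"
    have y: "y + u = - (c + v)" "y + v = - (c + u)" "y + u + v = - c" "y - u = - (c + v + 2 *\<^sub>R u)"
      "y + v - u = - (c + 2 *\<^sub>R u)" "y + v + u = - c"
      by (simp_all add: y_def scaleR_2)
    have yR: "y \<in> R" "y + u \<in> R" "y + v \<in> R" "y + u + v \<in> R"
    proof -
      show "y \<in> R" using c(4) unfolding y_def uminus_root_iff .
      show "y + u \<in> R" using c(3) unfolding y(1) uminus_root_iff .
      show "y + v \<in> R" using c(2) unfolding y(2) uminus_root_iff .
      show "y + u + v \<in> R" using c(1) unfolding y(3) uminus_root_iff .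
    qed
    have cv: "cint (c + v) u = -1" using h norm_eq_cint[OF u(1)] by blast
    have "y \<bullet> y = (y + u) \<bullet> (y + u)"
    proof -
      have "y = - (c + v + u)" by (simp add: y_def)
      then show ?thesis using h unfolding y(1) by (simp only: inner_minus_left inner_minus_right minus_minus)
    qed
    moreover have "y - u \<in> R"
      unfolding y(4) uminus_root_iff using string_flip[OF u(1) cv] h by blast
    ultimately have r: "(y + v) \<bullet> (y + v) = (y + v + u) \<bullet> (y + v + u) \<and> y + v - u \<in> R"
      using square_long_string[OF u yR] by blast
    have e: "c \<bullet> c = (c + u) \<bullet> (c + u)" using conjunct1[OF r] unfolding y(6) unfolding y(2) by (simp add: inner_add_left inner_add_right inner_diff_left inner_diff_right)
    have "c + 2 *\<^sub>R u \<in> R" using r unfolding y(5) uminus_root_iff by blast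
    then show "c \<bullet> c = (c + u) \<bullet> (c + u) \<and> c - u \<in> R"
      using e string_flip[OF u(1)] norm_eq_cint[OF u(1)] by blast
  qed
  obtain M :: real where M0: "(\<forall>a x. x \<in> R \<longrightarrow> x + a \<in> R \<longrightarrow> strw a x = (if x \<bullet> x = (x + a) \<bullet> (x + a) then 1 else M)
       * (if x \<bullet> x = (x + a) \<bullet> (x + a) \<and> x - a \<in> R then 4 else 1)) \<and>
    (\<forall>x\<in>R. \<forall>y\<in>R. \<forall>z\<in>R. x \<bullet> x \<noteq> y \<bullet> y \<longrightarrow> x \<bullet> x \<noteq> z \<bullet> z \<longrightarrow> y \<bullet> y = z \<bullet> z)"
    using strw_cases by (elim exE conjE) blast
  note M1 = conjunct1[OF M0, rule_format] and M2 = conjunct2[OF M0, rule_format]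
  have e: "x + b + a = x + a + b" by simp
  note b1 = flip[OF a x] and b2 = flip[OF a' x(1,3,2) x']
  have sn: "(x + a) \<bullet> (x + a) = (x + b) \<bullet> (x + b) \<Longrightarrow> x \<bullet> x = (x + a + b) \<bullet> (x + a + b)"
    by (rule square_norms[OF a x])
  define f where "f u v = (if u = v then 1 else M)" for u v :: real
  define g where "g B = (if B then 4 else 1::real)" for B
  have "f (x \<bullet> x) ((x + a) \<bullet> (x + a)) * f (x \<bullet> x) ((x + b) \<bullet> (x + b))
    = f ((x + b) \<bullet> (x + b)) ((x + a + b) \<bullet> (x + a + b)) * f ((x + a) \<bullet> (x + a)) ((x + a + b) \<bullet> (x + a + b))"
    unfolding f_def using sn M2[OF x(1,2,3)] M2[OF x(2,3,4)]
    by (rule four_values)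
  then show ?thesis
    unfolding M1[OF x(1,2)] M1[OF x(1,3)] M1[OF x(3) x'] M1[OF x(2,4)]
    unfolding b1 b2 unfolding e f_def[symmetric] g_def[symmetric] by (simp add: mult_ac)
qed

end

section \<open>Raising operators\<close>

text \<open>The operators \<open>Up\<close> and \<open>Dn\<close> model \<open>\<Sum>i\<in>I. sqrt (c i) e\<^sub>i\<close> and its adjoint on the root part of the
  adjoint module; the zero weight space is left out, so their commutator is diagonal only away
  from \<open>I\<close> and \<open>- I\<close>.\<close>

locale raising = irr_roots R S \<theta>
  for R S :: "'a::euclidean_space set" and \<theta> +
  fixes I :: "'a set" and c :: "'a \<Rightarrow> real" and s :: "'a \<Rightarrow> 'a \<Rightarrow> real"
  assumes I_sub: "I \<subseteq> R"
    and I_diff: "\<And>i j. i \<in> I \<Longrightarrow> j \<in> I \<Longrightarrow> i \<noteq> j \<Longrightarrow> i - j \<notin> R \<and> i \<noteq> - j"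
    and c_nonneg: "\<And>i. i \<in> I \<Longrightarrow> c i \<ge> 0"
    and s_sq: "\<And>i x. s i x * s i x = 1"
    and s_square: "\<And>i j x. i \<in> I \<Longrightarrow> j \<in> I \<Longrightarrow> i \<noteq> j \<Longrightarrow> x \<in> R \<Longrightarrow> x + i \<in> R \<Longrightarrow> x + j \<in> R \<Longrightarrow>
       x + i + j \<in> R \<Longrightarrow> s i x * s j x = s i (x + j) * s j (x + i)"
begin

lemma finite_I: "finite I"
  using I_sub finite_R finite_subset by blast

definition co :: "'a \<Rightarrow> 'a \<Rightarrow> real" where "co i x = s i x * sqrt (c i * strw i x)"

definition Dn :: "('a \<Rightarrow> real) \<Rightarrow> 'a \<Rightarrow> real" where
  "Dn f x = (\<Sum>i\<in>I. co i x * f (x + i))"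

definition Up :: "('a \<Rightarrow> real) \<Rightarrow> 'a \<Rightarrow> real" where
  "Up f x = (\<Sum>i\<in>I. co i (x - i) * f (x - i))"

lemma co_0: "x \<notin> R \<or> x + i \<notin> R \<Longrightarrow> co i x = 0"
  by (simp add: co_def strw_0)

lemma co_sq: "i \<in> I \<Longrightarrow> co i x * co i x = c i * strw i x"
proof -
  assume "i \<in> I"
  then have "c i * strw i x \<ge> 0" using c_nonneg strw_nonneg by simp
  have "co i x * co i x = (s i x * s i x) * (sqrt (c i * strw i x) * sqrt (c i * strw i x))"
    by (simp only: co_def mult_ac)
  then show ?thesis using \<open>c i * strw i x \<ge> 0\<close> by (simp add: s_sq)
qed

lemma Dn_supp: "Dn f x \<noteq> 0 \<Longrightarrow> \<exists>i\<in>I. x \<in> R \<and> x + i \<in> R \<and> f (x + i) \<noteq> 0"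
  unfolding Dn_def using co_0 by (metis (no_types, lifting) mult_zero_left mult_zero_right sum.neutral)

lemma Up_supp: "Up f x \<noteq> 0 \<Longrightarrow> \<exists>i\<in>I. x \<in> R \<and> x - i \<in> R \<and> f (x - i) \<noteq> 0"
proof -
  assume "Up f x \<noteq> 0"
  then obtain i where i: "i \<in> I" "co i (x - i) * f (x - i) \<noteq> 0"
    unfolding Up_def by (metis (no_types, lifting) sum.neutral)
  then show ?thesis using co_0[of "x - i" i] by auto
qed

text \<open>Both operators use the coefficient \<open>co i x\<close> on the edge from
  \<open>x\<close> to \<open>x + i\<close>; it vanishes unless both ends are roots, which allows
  shifting the summation.\<close>

lemma adjoint: "(\<Sum>x\<in>R. Up f x * g x) = (\<Sum>x\<in>R. f x * Dn g x)"
proof -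
  have *: "(\<Sum>x\<in>R. h (x - i)) = sum h R" if h: "\<And>x. x \<notin> R \<or> x + i \<notin> R \<Longrightarrow> h x = 0" for h :: "'a \<Rightarrow> real" and i
  proof -
    let ?A = "{x \<in> R. x + i \<in> R}"
    have "sum h R = sum h ?A" using finite_R h by (intro sum.mono_neutral_right) auto
    also have "\<dots> = (\<Sum>x\<in>(\<lambda>x. x + i) ` ?A. h (x - i))"
      by (subst sum.reindex) (auto simp: inj_on_def)
    also have "\<dots> = (\<Sum>x\<in>R. h (x - i))"
    proof (rule sum.mono_neutral_left[OF finite_R])
      show "\<forall>x\<in>R - (\<lambda>x. x + i) ` ?A. h (x - i) = 0"
      proof
        fix x assume x: "x \<in> R - (\<lambda>x. x + i) ` ?A"
        have "x - i \<notin> R"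
        proof
          assume "x - i \<in> R"
          then have "x - i \<in> ?A" using x by simp
          then have "x - i + i \<in> (\<lambda>x. x + i) ` ?A" by (rule imageI)
          then show False using x by simp
        qed
        then show "h (x - i) = 0" using h by blast
      qed
    qed auto
    finally show ?thesis by simp
  qed
  have "(\<Sum>x\<in>R. Up f x * g x) = (\<Sum>i\<in>I. \<Sum>x\<in>R. co i (x - i) * f (x - i) * g (x - i + i))"
    unfolding Up_def by (subst sum.swap) (simp add: sum_distrib_right)
  also have "\<dots> = (\<Sum>i\<in>I. \<Sum>x\<in>R. co i x * f x * g (x + i))"
    by (intro sum.cong refl * ) (auto simp: co_0)
  also have "\<dots> = (\<Sum>x\<in>R. f x * Dn g x)"
    unfolding Dn_def by (subst sum.swap) (simp add: sum_distrib_left mult_ac)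
  finally show ?thesis .
qed

lemma Up_zero:
  assumes "\<And>x. x \<in> R \<Longrightarrow> f x \<noteq> 0 \<Longrightarrow> Dn (Up f) x = 0" and "x \<in> R" shows "Up f x = 0"
proof -
  have "(\<Sum>x\<in>R. Up f x * Up f x) = (\<Sum>x\<in>R. f x * Dn (Up f) x)" by (rule adjoint)
  also have "\<dots> = 0" using assms(1) by (intro sum.neutral) auto
  finally have "\<forall>x\<in>R. Up f x * Up f x = 0" using finite_R by (simp add: sum_nonneg_eq_0_iff)
  then show ?thesis using assms(2) by simp
qed

lemma Dn_zero:
  assumes "\<And>x. x \<in> R \<Longrightarrow> f x \<noteq> 0 \<Longrightarrow> Up (Dn f) x = 0" and "x \<in> R" shows "Dn f x = 0"
proof -
  have "(\<Sum>x\<in>R. Dn f x * Dn f x) = (\<Sum>x\<in>R. Up (Dn f) x * f x)" by (rule adjoint[symmetric])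
  also have "\<dots> = 0" using assms(1) by (intro sum.neutral) auto
  finally have "\<forall>x\<in>R. Dn f x * Dn f x = 0" using finite_R by (simp add: sum_nonneg_eq_0_iff)
  then show ?thesis using assms(2) by simp
qed

text \<open>Excluding \<open>I\<close> and its negatives keeps the square away from the zero weight
  space. By \<open>square_completes\<close>, for the square or its negative, either all corners are
  roots or both products vanish.\<close>

lemma co_square:
  assumes i: "i \<in> I" "j \<in> I" "i \<noteq> j" and x: "x \<in> R" "x \<notin> I" "- x \<notin> I"
  shows "co i x * co j (x + i - j) = co j (x - j) * co i (x - j)"
proof -
  let ?k = "x - j"
  have ij: "i \<in> R" "j \<in> R" "i - j \<notin> R" "i \<noteq> - j" using i I_sub I_diff by auto
  have e: "x + i - j = ?k + i" "?k + j = x" "?k + i + j = x + i" by simp_all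
  have x0: "x + i \<noteq> 0" "x - j \<noteq> 0" using x(2,3) i by (auto simp: eq_neg_iff_add_eq_0[symmetric])
  show ?thesis
  proof (cases "?k + i \<in> R")
    case False
    then show ?thesis using co_0[of "?k + i" j] co_0[of ?k i] unfolding e(1) by simp
  next
    case ki: True
    show ?thesis
    proof (cases "?k \<in> R")
      case k: True
      have t: "?k + i + j \<in> R"
        using square_completes[OF ij(1,2) i(3) ij(3) k ki] x(1) x0(1) unfolding e by simp
      have kj: "?k + j \<in> R" using x(1) by simp
      have st: "strw i ?k * strw j ?k = strw i (?k + j) * strw j (?k + i)"
        by (rule square_strw[OF ij(1,2) i(3) ij(3,4) k ki kj t])
      have ss: "s i ?k * s j ?k = s i (?k + j) * s j (?k + i)"
        by (rule s_square[OF i k ki kj t])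
      have "co i x * co j (x + i - j) = (s i (?k + j) * s j (?k + i)) * sqrt ((c i * c j) * (strw i (?k + j) * strw j (?k + i)))"
        unfolding co_def e by (simp add: real_sqrt_mult mult_ac)
      also have "\<dots> = co j ?k * co i ?k"
        unfolding st[symmetric] ss[symmetric] co_def by (simp add: real_sqrt_mult mult_ac)
      finally show ?thesis .
    next
      case k: False
      have "x + i \<notin> R"
      proof
        assume xi: "x + i \<in> R"
        have ji: "j - i \<notin> R" using ij(3) root_diff_commute by blast
        have r: "- (x + i) \<in> R" "- (x + i) + i \<in> R" "- (x + i) + j \<in> R" "- (x + i) + i + j \<noteq> 0"
        proof -
          show "- (x + i) \<in> R" using xi unfolding uminus_root_iff .
          have "- (x + i) + i = - x" by simp
          then show "- (x + i) + i \<in> R" using x(1) by (simp only: uminus_root_iff)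
          have "- (x + i) + j = - (?k + i)" by simp
          then show "- (x + i) + j \<in> R" using ki by (simp only: uminus_root_iff)
          show "- (x + i) + i + j \<noteq> 0" using x0(2) by auto
        qed
        have "- (x + i) + i + j \<in> R"
          by (rule square_completes[OF ij(1,2) i(3) ij(3) r])
        moreover have "- (x + i) + i + j = - ?k" by simp
        ultimately show False using k by (simp only: uminus_root_iff)
      qed
      then show ?thesis using co_0[of x i] co_0[of ?k i] k by simp
    qed
  qed
qed

text \<open>The off-diagonal terms agree by \<open>co_square\<close>; each diagonal term leaves one
  Cartan integer by \<open>strw_diff\<close>.\<close>

lemma commutator:
  assumes x: "x \<in> R" "x \<notin> I" "- x \<notin> I"
  shows "Dn (Up f) x = Up (Dn f) x - (\<Sum>i\<in>I. c i * cint x i) * f x"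
proof -
  have D: "Dn (Up f) x = (\<Sum>i\<in>I. \<Sum>j\<in>I. co i x * co j (x + i - j) * f (x + i - j))"
    by (simp add: Dn_def Up_def sum_distrib_left mult.assoc)
  have "Up (Dn f) x = (\<Sum>j\<in>I. \<Sum>i\<in>I. co j (x - j) * co i (x - j) * f (x - j + i))"
    by (simp add: Dn_def Up_def sum_distrib_left mult.assoc)
  also have "\<dots> = (\<Sum>i\<in>I. \<Sum>j\<in>I. co j (x - j) * co i (x - j) * f (x - j + i))"
    by (rule sum.swap)
  also have "\<dots> = (\<Sum>i\<in>I. \<Sum>j\<in>I. co i x * co j (x + i - j) * f (x + i - j)
       + (if j = i then c i * cint x i * f x else 0))"
  proof (intro sum.cong refl)
    fix i j assume ij: "i \<in> I" "j \<in> I"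
    show "co j (x - j) * co i (x - j) * f (x - j + i) = co i x * co j (x + i - j) * f (x + i - j)
       + (if j = i then c i * cint x i * f x else 0)"
    proof (cases "j = i")
      case True
      have "i \<in> R" using ij I_sub by blast
      moreover have "x \<noteq> i" "x \<noteq> - i" using x ij by auto
      ultimately have "strw i (x - i) = strw i x + cint x i" using strw_diff[OF x(1), of i] by simp
      then show ?thesis using True co_sq[OF ij(1), of x] co_sq[OF ij(1), of "x - i"] by (simp add: algebra_simps)
    next
      case False
      have e: "x - j + i = x + i - j" by simp
      show ?thesis using co_square[OF ij _ x] False unfolding e by auto
    qed
  qed
  also have "\<dots> = Dn (Up f) x + (\<Sum>i\<in>I. c i * cint x i) * f x"
    using finite_I by (simp add: D sum.distrib sum_distrib_right)
  finally show ?thesis by simp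
qed

lemma commutator_pairing:
  assumes "\<And>x. f x \<noteq> 0 \<Longrightarrow> x \<in> R \<and> x \<notin> I \<and> - x \<notin> I"
  shows "(\<Sum>x\<in>R. Up f x * Up f x) = (\<Sum>x\<in>R. Dn f x * Dn f x) - (\<Sum>x\<in>R. (\<Sum>i\<in>I. c i * cint x i) * (f x * f x))"
proof -
  have "(\<Sum>x\<in>R. Up f x * Up f x) = (\<Sum>x\<in>R. f x * Dn (Up f) x)" by (rule adjoint)
  also have "\<dots> = (\<Sum>x\<in>R. Up (Dn f) x * f x - (\<Sum>i\<in>I. c i * cint x i) * (f x * f x))"
  proof (intro sum.cong refl)
    fix x assume "x \<in> R"
    show "f x * Dn (Up f) x = Up (Dn f) x * f x - (\<Sum>i\<in>I. c i * cint x i) * (f x * f x)"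
    proof (cases "f x = 0")
      case False
      then have "Dn (Up f) x = Up (Dn f) x - (\<Sum>i\<in>I. c i * cint x i) * f x"
        using assms commutator by blast
      then show ?thesis by (simp only: right_diff_distrib mult_ac)
    qed simp
  qed
  also have "\<dots> = (\<Sum>x\<in>R. Dn f x * Dn f x) - (\<Sum>x\<in>R. (\<Sum>i\<in>I. c i * cint x i) * (f x * f x))"
    by (simp add: sum_subtractf adjoint)
  finally show ?thesis .
qed

lemma Dn_sum: "finite C \<Longrightarrow> Dn (\<lambda>x. \<Sum>k\<in>C. w k * F k x) = (\<lambda>x. \<Sum>k\<in>C. w k * Dn (F k) x)"
  unfolding Dn_def by (rule ext) (simp add: sum_distrib_left sum.swap[of _ _ C] mult_ac)

lemma Up_sum: "finite C \<Longrightarrow> Up (\<lambda>x. \<Sum>k\<in>C. w k * F k x) = (\<lambda>x. \<Sum>k\<in>C. w k * Up (F k) x)"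
  unfolding Up_def by (rule ext) (simp add: sum_distrib_left sum.swap[of _ _ C] mult_ac)

lemma Dn_pow_sum: "finite C \<Longrightarrow> (Dn ^^ n) (\<lambda>x. \<Sum>k\<in>C. w k * F k x) = (\<lambda>x. \<Sum>k\<in>C. w k * (Dn ^^ n) (F k) x)"
  by (induction n) (simp_all add: Dn_sum)

end

section \<open>Definiteness for the simple roots\<close>

context irr_roots begin

text \<open>The coefficient of the simple coroot of \<open>i\<close> in \<open>rhoc\<close>, as for
  the principal sl2-triple; see \<open>sum_crho\<close>.\<close>

definition crho :: "'a \<Rightarrow> real" where "crho i = (rhoc \<bullet> dualv i) * (i \<bullet> i) / 2"

lemma rhoc_expand: "rhoc = (\<Sum>i\<in>S. (rhoc \<bullet> dualv i) *\<^sub>R i)"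
proof -
  have "(\<Sum>i\<in>S. (rhoc \<bullet> dualv i) *\<^sub>R i) = (\<Sum>i\<in>S. \<Sum>g\<in>P. (1 / (g \<bullet> g)) *\<^sub>R (g \<bullet> dualv i) *\<^sub>R i)"
    by (simp add: rhoc_def inner_sum_left scaleR_sum_left)
  also have "\<dots> = (\<Sum>g\<in>P. (1 / (g \<bullet> g)) *\<^sub>R (\<Sum>i\<in>S. (g \<bullet> dualv i) *\<^sub>R i))"
    by (subst sum.swap) (simp only: scaleR_sum_right)
  also have "\<dots> = rhoc"
    unfolding rhoc_def using Qplus_expand[OF pos_Qplus] by (intro sum.cong refl) metis
  finally show ?thesis by simp
qed

lemma sum_crho: "(\<Sum>i\<in>S. crho i * cint x i) = x \<bullet> rhoc"
proof -
  have "(\<Sum>i\<in>S. crho i * cint x i) = (\<Sum>i\<in>S. (rhoc \<bullet> dualv i) * (x \<bullet> i))"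
    using root_inner_pos[OF S_root] by (intro sum.cong refl) (auto simp: crho_def cint_def)
  also have "\<dots> = x \<bullet> (\<Sum>i\<in>S. (rhoc \<bullet> dualv i) *\<^sub>R i)" by (simp add: inner_sum_right)
  finally show ?thesis using rhoc_expand by simp
qed

lemma crho_pos: assumes "i \<in> S" shows "crho i > 0"
proof -
  have "rhoc \<bullet> dualv i = (\<Sum>g\<in>P. (1 / (g \<bullet> g)) * (g \<bullet> dualv i))" by (simp add: rhoc_def inner_sum_left)
  moreover have "\<dots> \<ge> (1 / (i \<bullet> i)) * (i \<bullet> dualv i)"
    using finite_P simple_pos[OF assms] Qplus_coord_nonneg[OF pos_Qplus assms]
    by (intro member_le_sum[of i P "\<lambda>g. (1 / (g \<bullet> g)) * (g \<bullet> dualv i)"]) auto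
  ultimately have "rhoc \<bullet> dualv i \<ge> 1 / (i \<bullet> i)" using assms by (simp add: inner_dualv)
  moreover have "1 / (i \<bullet> i) > 0" using root_inner_pos[OF S_root[OF assms]] by simp
  ultimately have "rhoc \<bullet> dualv i > 0" by linarith
  then show ?thesis using root_inner_pos[OF S_root[OF assms]] by (simp add: crho_def)
qed

end

locale finite_raising = raising R S \<theta> S c s
  for R S :: "'a::euclidean_space set" and \<theta> c s +
  assumes c_pos: "\<And>i. i \<in> S \<Longrightarrow> c i > 0"
begin

sublocale rho: raising R S \<theta> S crho s
proof unfold_locales
  show "S \<subseteq> R" by (rule S_subset)
  show "0 \<le> crho i" if "i \<in> S" for i using crho_pos that less_imp_le by blast
qed (use I_diff s_sq s_square in auto)

text \<open>Multiplying functions by \<open>exp (x \<bullet> resc)\<close> turns the weights \<open>c\<close> into \<open>crho\<close>, for which the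
  commutator is the height and therefore definite.\<close>

definition resc :: 'a where "resc = (SOME v. \<forall>i\<in>S. i \<bullet> v = ln (sqrt (crho i / c i)))"

lemma resc: assumes i: "i \<in> S" shows "exp (i \<bullet> resc) * sqrt (c i) = sqrt (crho i)"
proof -
  have "i \<bullet> resc = ln (sqrt (crho i / c i))"
    unfolding resc_def using someI_ex[OF independent_functional[OF S_indep, of "\<lambda>i. ln (sqrt (crho i / c i))"]] i by blast
  moreover have "sqrt (crho i / c i) > 0" using crho_pos[OF i] c_pos[OF i] by simp
  ultimately have "exp (i \<bullet> resc) = sqrt (crho i / c i)" by simp
  then show ?thesis using c_pos[OF i] by (simp add: real_sqrt_divide)
qed

lemma co_resc: "i \<in> S \<Longrightarrow> exp (i \<bullet> resc) * co i x = rho.co i x"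
  using resc[of i] by (simp add: co_def rho.co_def real_sqrt_mult mult_ac)

lemma rho_definite:
  assumes e: "e = 1 \<or> e = -1" and f: "\<And>x. f x \<noteq> 0 \<Longrightarrow> x \<in> R \<and> e * (x \<bullet> rhoc) > 1"
    and le: "e * ((\<Sum>x\<in>R. rho.Dn f x * rho.Dn f x) - (\<Sum>x\<in>R. rho.Up f x * rho.Up f x)) \<le> 0"
  shows "f x = 0"
proof -
  have "x \<notin> S \<and> - x \<notin> S" if "f x \<noteq> 0" for x
    using f[OF that] e inner_rhoc_simple[of x] inner_rhoc_simple[of "- x"] by auto
  then have "(\<Sum>x\<in>R. (x \<bullet> rhoc) * (f x * f x)) = (\<Sum>x\<in>R. rho.Dn f x * rho.Dn f x) - (\<Sum>x\<in>R. rho.Up f x * rho.Up f x)"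
    using rho.commutator_pairing[of f] f by (simp add: sum_crho)
  moreover have "(\<Sum>x\<in>R. e * (x \<bullet> rhoc) * (f x * f x)) = e * (\<Sum>x\<in>R. (x \<bullet> rhoc) * (f x * f x))"
    by (simp only: sum_distrib_left mult.assoc)
  ultimately have le': "(\<Sum>x\<in>R. e * (x \<bullet> rhoc) * (f x * f x)) \<le> 0" using le by simp
  have nn: "e * (x \<bullet> rhoc) * (f x * f x) \<ge> 0" for x
    using f[of x] by (cases "f x = 0") (auto intro!: mult_nonneg_nonneg[of "e * (x \<bullet> rhoc)"])
  then have "(\<Sum>x\<in>R. e * (x \<bullet> rhoc) * (f x * f x)) = 0" using le' by (meson order_antisym sum_nonneg)
  then have "\<forall>x\<in>R. e * (x \<bullet> rhoc) * (f x * f x) = 0" using nn finite_R by (simp add: sum_nonneg_eq_0_iff)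
  then show ?thesis using f[of x] by force
qed

text \<open>The dual form of the surjectivity of raising in positive degrees.\<close>

lemma Dn_inj:
  assumes f: "\<And>x. f x \<noteq> 0 \<Longrightarrow> x \<in> R \<and> x \<bullet> rhoc > 1" and D: "\<And>x. x \<in> R \<Longrightarrow> Dn f x = 0"
  shows "f x = 0"
proof -
  define f' where "f' x = exp (- (x \<bullet> resc)) * f x" for x
  have D': "rho.Dn f' x = exp (- (x \<bullet> resc)) * Dn f x" for x
  proof -
    have "rho.co i x * f' (x + i) = exp (- (x \<bullet> resc)) * (co i x * f (x + i))" if "i \<in> S" for i
    proof -
      have "exp (- ((x + i) \<bullet> resc)) * exp (i \<bullet> resc) = exp (- (x \<bullet> resc))"
        by (simp add: inner_add_left flip: exp_add)
      then show ?thesis unfolding f'_def co_resc[OF that, symmetric] by (metis mult.assoc mult.left_commute)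
    qed
    then show ?thesis by (simp add: rho.Dn_def Dn_def sum_distrib_left)
  qed
  have "f' x = 0"
  proof (rule rho_definite[of 1])
    show "1 * ((\<Sum>x\<in>R. rho.Dn f' x * rho.Dn f' x) - (\<Sum>x\<in>R. rho.Up f' x * rho.Up f' x)) \<le> 0"
      using D D' by (simp add: sum_nonneg)
  qed (use f in \<open>auto simp: f'_def\<close>)
  then show ?thesis by (simp add: f'_def)
qed

lemma Up_inj:
  assumes f: "\<And>x. f x \<noteq> 0 \<Longrightarrow> x \<in> R \<and> x \<bullet> rhoc < -1" and U: "\<And>x. x \<in> R \<Longrightarrow> Up f x = 0"
  shows "f x = 0"
proof -
  define f' where "f' x = exp (x \<bullet> resc) * f x" for x
  have U': "rho.Up f' x = exp (x \<bullet> resc) * Up f x" for x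
  proof -
    have "rho.co i (x - i) * f' (x - i) = exp (x \<bullet> resc) * (co i (x - i) * f (x - i))" if "i \<in> S" for i
    proof -
      have "exp ((x - i) \<bullet> resc) * exp (i \<bullet> resc) = exp (x \<bullet> resc)"
        by (simp add: inner_diff_left flip: exp_add)
      then show ?thesis unfolding f'_def co_resc[OF that, symmetric] by (metis mult.assoc mult.left_commute)
    qed
    then show ?thesis by (simp add: rho.Up_def Up_def sum_distrib_left)
  qed
  have "f' x = 0"
  proof (rule rho_definite[of "-1"])
    show "(-1) * ((\<Sum>x\<in>R. rho.Dn f' x * rho.Dn f' x) - (\<Sum>x\<in>R. rho.Up f' x * rho.Up f' x)) \<le> 0"
      using U U' by (simp add: sum_nonneg)
  qed (use f in \<open>auto simp: f'_def\<close>)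
  then show ?thesis by (simp add: f'_def)
qed

end

section \<open>Signs\<close>

definition sgm :: "int \<Rightarrow> real" where "sgm m = (if even m then 1 else -1)"

lemma sgm_add: "sgm (m + n) = sgm m * sgm n" and sgm_sq: "sgm m * sgm m = 1"
  by (auto simp: sgm_def)

context irr_roots begin

definition crd :: "'a \<Rightarrow> 'a \<Rightarrow> int" where "crd x k = \<lfloor>x \<bullet> dualv k\<rfloor>"

lemma crd: assumes "x \<in> R" "k \<in> S" shows "real_of_int (crd x k) = x \<bullet> dualv k"
proof -
  have "x \<in> Qplus S \<or> - x \<in> Qplus S" using root_cases[OF assms(1)] pos_Qplus by blast
  then have "x \<bullet> dualv k \<in> \<nat> \<or> (- x) \<bullet> dualv k \<in> \<nat>" using Qplus_coord assms(2) by blast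
  then have "x \<bullet> dualv k \<in> \<int>"
    by (metis Nats_subset_Ints Ints_minus inner_minus_left minus_minus subsetD)
  then show ?thesis by (simp add: crd_def)
qed

lemma crd_add: "x \<in> R \<Longrightarrow> y \<in> R \<Longrightarrow> x + y \<in> R \<Longrightarrow> k \<in> S \<Longrightarrow> crd (x + y) k = crd x k + crd y k"
  using crd[of x k] crd[of y k] crd[of "x + y" k] by (simp add: inner_add_left)

lemma root_expand: assumes "x \<in> R" shows "x = (\<Sum>k\<in>S. (x \<bullet> dualv k) *\<^sub>R k)"
proof -
  have "x \<in> Qplus S \<or> - x \<in> Qplus S" using root_cases[OF assms] pos_Qplus by blast
  then show ?thesis
  proof
    assume "- x \<in> Qplus S"
    then have "- x = - (\<Sum>k\<in>S. (x \<bullet> dualv k) *\<^sub>R k)" using Qplus_expand[of "- x"] by (simp add: sum_negf)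
    then show ?thesis by simp
  qed (rule Qplus_expand)
qed

text \<open>\<open>s i x\<close> is the sign of the coefficient with which \<open>e\<^sub>i\<close> maps the root vector of \<open>x\<close> to that of \<open>x + i\<close>.
  The last condition concerns the squares through the zero weight space, where
  the vector of \<open>i\<close> is paired with \<open>\<sigma> i\<close> times the root \<open>i\<close> itself.\<close>

definition sign_system :: "'a set \<Rightarrow> ('a \<Rightarrow> 'a \<Rightarrow> real) \<Rightarrow> ('a \<Rightarrow> real) \<Rightarrow> bool" where
  "sign_system I s \<sigma> \<longleftrightarrow> (\<forall>i x. s i x * s i x = 1) \<and> (\<forall>i. \<sigma> i * \<sigma> i = 1)
    \<and> (\<forall>i\<in>I. \<forall>j\<in>I. \<forall>x\<in>R. i \<noteq> j \<longrightarrow> x + i \<in> R \<longrightarrow> x + j \<in> R \<longrightarrow> x + i + j \<in> R \<longrightarrow>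
          s i x * s j x = s i (x + j) * s j (x + i))
    \<and> (\<forall>i\<in>I. \<forall>j\<in>I. i \<noteq> j \<longrightarrow> i \<bullet> j \<noteq> 0 \<longrightarrow> s j i * s i j = - (\<sigma> i * \<sigma> j))"

text \<open>For a simply laced system the structure constants are the Frenkel-Kac cocycle.\<close>

lemma simply_laced_signs:
  assumes same: "\<And>x. x \<in> R \<Longrightarrow> x \<bullet> x = n" and I: "I \<subseteq> R" "\<And>i j. i \<in> I \<Longrightarrow> j \<in> I \<Longrightarrow> i \<noteq> j \<Longrightarrow> i \<noteq> - j"
  shows "\<exists>s. sign_system I s (\<lambda>_. 1)"
proof -
  obtain od :: "'a \<Rightarrow> nat" where od: "inj_on od S"
    using finite_imp_inj_to_nat_seg[OF finite_S] by blast
  have n: "n > 0" using same[OF theta_root] root_inner_pos[OF theta_root] by simp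
  define A where "A k l = \<lfloor>cint k l\<rfloor>" for k l :: 'a
  have A: "real_of_int (A k l) = 2 * (k \<bullet> l) / n" if "k \<in> S" "l \<in> S" for k l
    using cint_Ints[OF S_root S_root, OF that] same[OF S_root[OF that(2)]] by (simp add: A_def cint_def)
  \<comment> \<open>One triangular half of the invariant form, for an arbitrary order of the simple
    roots. Its symmetrisation misses only the diagonal terms, which are even since
    \<open>A k k = 2\<close>; so modulo 2 it is the form.\<close>
  define F where "F i x = (\<Sum>k\<in>S. \<Sum>l\<in>S. if od k < od l then crd i k * crd x l * A k l else 0)" for i x
  define s where "s i x = sgm (F i x)" for i x
  have Fadd: "F i (x + y) = F i x + F i y" if "x \<in> R" "y \<in> R" "x + y \<in> R" for i x y
    unfolding F_def sum.distrib[symmetric] using that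
    by (intro sum.cong refl) (simp add: crd_add algebra_simps)
  have FF: "sgm (F i j + F j i) = sgm m" if ij: "i \<in> R" "j \<in> R" "cint i j = of_int m" for i j m
  proof -
    have swap: "F j i = (\<Sum>k\<in>S. \<Sum>l\<in>S. if od l < od k then crd i k * crd j l * A k l else 0)"
    proof -
      have sym: "A k l = A l k" if "k \<in> S" "l \<in> S" for k l
        using A[OF that] A[OF that(2,1)] by (simp add: inner_commute)
      have "F j i = (\<Sum>l\<in>S. \<Sum>k\<in>S. if od l < od k then crd j l * crd i k * A l k else 0)" by (simp add: F_def)
      also have "\<dots> = (\<Sum>k\<in>S. \<Sum>l\<in>S. if od l < od k then crd j l * crd i k * A l k else 0)" by (rule sum.swap)
      also have "\<dots> = (\<Sum>k\<in>S. \<Sum>l\<in>S. if od l < od k then crd i k * crd j l * A k l else 0)"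
        by (intro sum.cong refl) (simp add: sym mult_ac)
      finally show ?thesis .
    qed
    have "real_of_int m = 2 * (i \<bullet> j) / n" using ij same[OF ij(2)] by (simp add: cint_def)
    also have "i \<bullet> j = (\<Sum>k\<in>S. \<Sum>l\<in>S. (i \<bullet> dualv k) * (j \<bullet> dualv l) * (k \<bullet> l))"
      by (subst root_expand[OF ij(1)], subst root_expand[OF ij(2)])
        (simp add: inner_sum_left inner_sum_right sum_distrib_left mult_ac, rule sum.swap)
    also have "2 * \<dots> / n = (\<Sum>k\<in>S. \<Sum>l\<in>S. (i \<bullet> dualv k) * (j \<bullet> dualv l) * (2 * (k \<bullet> l) / n))"
      by (simp add: sum_distrib_left sum_divide_distrib mult_ac)
    also have "\<dots> = real_of_int (\<Sum>k\<in>S. \<Sum>l\<in>S. crd i k * crd j l * A k l)"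
      using ij by (simp add: A crd)
    finally have m: "m = (\<Sum>k\<in>S. \<Sum>l\<in>S. crd i k * crd j l * A k l)" by (simp only: of_int_eq_iff)
    have "(\<Sum>k\<in>S. \<Sum>l\<in>S. crd i k * crd j l * A k l)
      = (\<Sum>k\<in>S. \<Sum>l\<in>S. (if od k < od l then crd i k * crd j l * A k l else 0)
         + (if od l < od k then crd i k * crd j l * A k l else 0) + (if k = l then crd i k * crd j l * A k l else 0))"
    proof (intro sum.cong refl)
      fix k l assume "k \<in> S" "l \<in> S"
      then have "od k = od l \<longleftrightarrow> k = l" using od by (auto dest: inj_onD)
      then show "crd i k * crd j l * A k l = (if od k < od l then crd i k * crd j l * A k l else 0)
         + (if od l < od k then crd i k * crd j l * A k l else 0) + (if k = l then crd i k * crd j l * A k l else 0)"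
        by (cases "od k < od l"; cases "od l < od k") auto
    qed
    also have "\<dots> = F i j + F j i + (\<Sum>k\<in>S. \<Sum>l\<in>S. if k = l then crd i k * crd j l * A k l else 0)"
      by (simp only: sum.distrib swap F_def[of i j])
    also have "(\<Sum>k\<in>S. \<Sum>l\<in>S. if k = l then crd i k * crd j l * A k l else 0) = (\<Sum>k\<in>S. crd i k * crd j k * A k k)"
      using finite_S by simp
    also have "\<dots> = (\<Sum>k\<in>S. 2 * (crd i k * crd j k))"
    proof (intro sum.cong refl)
      fix k assume "k \<in> S"
      then have "A k k = 2" using cint_self[OF S_root] by (simp add: A_def)
      then show "crd i k * crd j k * A k k = 2 * (crd i k * crd j k)" by simp
    qed
    also have "\<dots> = 2 * (\<Sum>k\<in>S. crd i k * crd j k)" by (simp add: sum_distrib_left)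
    finally have "m = F i j + F j i + 2 * (\<Sum>k\<in>S. crd i k * crd j k)" using m by simp
    then show ?thesis by (simp add: sgm_def)
  qed
  have "s i x * s j x = s i (x + j) * s j (x + i)"
    if h: "i \<in> I" "j \<in> I" "x \<in> R" "i \<noteq> j" "x + i \<in> R" "x + j \<in> R" "x + i + j \<in> R" for i j x
  proof -
    have R: "i \<in> R" "j \<in> R" using h I by auto
    \<comment> \<open>The corners of the square have equal norms, so \<open>i\<close> and
      \<open>j\<close> are orthogonal and the cocycle is symmetric on them.\<close>
    have "2 * (i \<bullet> j) = (x + i + j) \<bullet> (x + i + j) + x \<bullet> x - (x + i) \<bullet> (x + i) - (x + j) \<bullet> (x + j)"
      by (simp add: inner_add_left inner_add_right inner_commute)
    then have "i \<bullet> j = 0" using same h by simp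
    then have "cint i j = of_int 0" by (simp add: cint_def)
    then have "sgm (F i j + F j i) = 1" using FF[OF R] by (simp add: sgm_def)
    then have "s i j * s j i = 1" by (simp add: s_def sgm_add)
    moreover have "s i (x + j) = s i x * s i j" "s j (x + i) = s j x * s j i"
      using Fadd[OF h(3) R(2) h(6)] Fadd[OF h(3) R(1) h(5)] by (simp_all add: s_def sgm_add)
    ultimately show ?thesis by (metis mult.assoc mult.left_commute mult.right_neutral)
  qed
  moreover have "s j i * s i j = -1" if h: "i \<in> I" "j \<in> I" "i \<noteq> j" "i \<bullet> j \<noteq> 0" for i j
  proof -
    have R: "i \<in> R" "j \<in> R" using h I by auto
    obtain m n' :: int where m: "cint i j = of_int m" "cint j i = of_int n'" "1 \<le> m * n'" "m * n' \<le> 3"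
      using cint_pair[OF R h(3) _ h(4)] I h by metis
    have "real_of_int n' = of_int m" using m(1,2) same R by (simp add: cint_def inner_commute)
    then have mm: "1 \<le> m * m" "m * m \<le> 3" using m(3,4) by (simp_all only: of_int_eq_iff)
    have "\<bar>m\<bar> < 2"
    proof (rule ccontr)
      assume "\<not> ?thesis"
      then have "2 * 2 \<le> \<bar>m\<bar> * \<bar>m\<bar>" by (intro mult_mono) auto
      then show False using mm by simp
    qed
    moreover have "m \<noteq> 0" using mm by auto
    ultimately have "m = 1 \<or> m = -1" by auto
    then have "sgm m = -1" by (auto simp: sgm_def)
    then show ?thesis using FF[OF R m(1)] by (simp add: s_def sgm_add mult.commute)
  qed
  moreover have "s i x * s i x = 1" for i x by (simp add: s_def sgm_sq)
  ultimately show ?thesis unfolding sign_system_def by (intro exI[of _ s]) simp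
qed

lemma simple_norms_imp_all:
  assumes "\<And>i. i \<in> S \<Longrightarrow> i \<bullet> i = n" and x: "x \<in> R" shows "x \<bullet> x = n"
proof -
  have *: "x \<bullet> x = n" if "x \<in> P" for x
    using that
  proof (induction "height S x" arbitrary: x rule: less_induct)
    case less
    show ?case
    proof (cases "x \<in> S")
      case False
      then obtain a where a: "a \<in> S" "x \<bullet> a > 0" "x - a \<in> P" using simple_descent less.prems by blast
      obtain k :: nat where k: "k \<ge> 1" "cint x a = real k"
        using cint_pos_int[OF pos_root[OF less.prems] S_root[OF a(1)] a(2)] by blast
      have "x \<noteq> a" using False a(1) by auto
      then have r: "refl a x \<in> P" using refl_pos less.prems a(1) by blast
      then have "height S x = height S (refl a x) + k"
        using height_diff_simple[OF less.prems a(1), of k] k by (simp add: refl_cint)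
      then have "refl a x \<bullet> refl a x = n" using less.hyps r k by simp
      then show ?thesis by (simp add: refl_inner)
    qed (use assms in auto)
  qed
  then show ?thesis using root_cases[OF x] *[of "- x"] by auto
qed

lemma theta_coord_pos: assumes "k \<in> S" shows "\<theta> \<bullet> dualv k \<ge> 1"
  using Qplus_coord_nonneg[OF theta_above[OF S_root[OF assms]] assms] assms
  by (simp add: inner_diff_left inner_dualv)

text \<open>Descending from \<open>x\<close> to \<open>x - a\<close>, the root \<open>a\<close> must
  belong to the part that carries \<open>x - a\<close>. Otherwise it is orthogonal to
  \<open>x - a\<close>, and \<open>refl a x = x - a - a\<close> would be positive with
  \<open>a\<close>-coordinate -1.\<close>

lemma orthogonal_simple_split:
  assumes AB: "A \<union> B = S" "A \<inter> B = {}" and orth: "\<And>a b. a \<in> A \<Longrightarrow> b \<in> B \<Longrightarrow> a \<bullet> b = 0"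
    and x: "x \<in> P"
  shows "(\<forall>b\<in>B. x \<bullet> dualv b = 0) \<or> (\<forall>a\<in>A. x \<bullet> dualv a = 0)"
  using x
proof (induction "height S x" arbitrary: x rule: less_induct)
  case less
  show ?case
  proof (cases "x \<in> S")
    case True
    then show ?thesis using AB by (auto simp: inner_dualv)
  next
    case False
    then obtain a where a: "a \<in> S" "x \<bullet> a > 0" "x - a \<in> P" using simple_descent less.prems by blast
    have "height S (x - a) < height S x" using height_diff_simple[OF less.prems a(1), of 1] a(3) by simp
    then have ih: "(\<forall>b\<in>B. (x - a) \<bullet> dualv b = 0) \<or> (\<forall>a'\<in>A. (x - a) \<bullet> dualv a' = 0)"
      using less.hyps a(3) by blast
    have key: False if C: "C \<subseteq> S" "a \<notin> C" and od: "\<And>d. d \<in> C \<Longrightarrow> a \<bullet> d = 0"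
      and z: "\<And>d. d \<in> S \<Longrightarrow> d \<notin> C \<Longrightarrow> (x - a) \<bullet> dualv d = 0" for C
    proof -
      have "(x - a) \<bullet> a = (\<Sum>d\<in>S. ((x - a) \<bullet> dualv d) * (d \<bullet> a))"
        by (subst Qplus_expand[OF pos_Qplus[OF a(3)]]) (simp add: inner_sum_left)
      also have "\<dots> = 0" using od z by (intro sum.neutral) (metis inner_commute mult_eq_0_iff)
      finally have xa: "x \<bullet> a = a \<bullet> a" by (simp add: inner_diff_left)
      then have "cint x a = 2" using root_inner_pos[OF S_root[OF a(1)]] by (simp add: cint_def)
      then have "refl a x = x - a - a" by (simp add: refl_cint scaleR_2)
      moreover have "refl a x \<in> P" using refl_pos[OF less.prems a(1)] False a(1) by blast
      ultimately have "(x - a - a) \<bullet> dualv a \<ge> 0" using Qplus_coord_nonneg pos_Qplus a(1) by metis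
      then show False using z[OF a(1) C(2)] a(1) by (simp add: inner_diff_left inner_dualv)
    qed
    from ih show ?thesis
    proof
      assume h: "\<forall>b\<in>B. (x - a) \<bullet> dualv b = 0"
      have "a \<in> A"
      proof (rule ccontr)
        assume n: "a \<notin> A"
        then have "a \<in> B" using a AB by blast
        show False
          by (rule key[of A]) (use n AB h orth \<open>a \<in> B\<close> in \<open>auto simp: inner_commute\<close>)
      qed
      then have "\<forall>b\<in>B. x \<bullet> dualv b = 0" using h AB a(1) by (auto simp: inner_diff_left inner_dualv)
      then show ?thesis by blast
    next
      assume h: "\<forall>a'\<in>A. (x - a) \<bullet> dualv a' = 0"
      have "a \<in> B"
      proof (rule ccontr)
        assume n: "a \<notin> B"
        then have "a \<in> A" using a AB by blast
        show False
          by (rule key[of B]) (use n AB h orth \<open>a \<in> A\<close> in auto)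
      qed
      then have "\<forall>b\<in>A. x \<bullet> dualv b = 0" using h AB a(1) by (auto simp: inner_diff_left inner_dualv)
      then show ?thesis by blast
    qed
  qed
qed

text \<open>Sorting \<open>S\<close> by length gives orthogonal parts, and \<open>\<theta>\<close>
  involves every simple root, so one part is empty. Some simple root is not orthogonal to
  \<open>\<theta>\<close>, so it is the other lengths that do not occur.\<close>

lemma adjacent_norms_imp_all:
  assumes adj: "\<And>i j. i \<in> insert (- \<theta>) S \<Longrightarrow> j \<in> insert (- \<theta>) S \<Longrightarrow> i \<bullet> j \<noteq> 0 \<Longrightarrow> i \<bullet> i = j \<bullet> j"
    and x: "x \<in> R"
  shows "x \<bullet> x = \<theta> \<bullet> \<theta>"
proof (rule simple_norms_imp_all[OF _ x])
  fix i assume i: "i \<in> S"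
  let ?A = "{k \<in> S. k \<bullet> k = \<theta> \<bullet> \<theta>}" and ?B = "{k \<in> S. k \<bullet> k \<noteq> \<theta> \<bullet> \<theta>}"
  have "(\<forall>b\<in>?B. \<theta> \<bullet> dualv b = 0) \<or> (\<forall>a\<in>?A. \<theta> \<bullet> dualv a = 0)"
  proof (rule orthogonal_simple_split)
    show "a \<bullet> b = 0" if "a \<in> ?A" "b \<in> ?B" for a b using adj[of a b] that by auto
  qed (use theta_pos in auto)
  then have "?B = {} \<or> ?A = {}" using theta_coord_pos by force
  moreover have "?A \<noteq> {}"
  proof -
    have "0 < \<theta> \<bullet> \<theta>" using root_inner_pos theta_root by blast
    also have "\<theta> \<bullet> \<theta> = (\<Sum>k\<in>S. (\<theta> \<bullet> dualv k) * (\<theta> \<bullet> k))"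
      by (subst (2) root_expand[OF theta_root]) (simp add: inner_sum_right)
    finally obtain k where k: "k \<in> S" "\<theta> \<bullet> k \<noteq> 0" by (metis (no_types, lifting) less_irrefl mult_zero_right sum.neutral)
    then have "k \<bullet> k = \<theta> \<bullet> \<theta>" using adj[of "- \<theta>" k] by simp
    then show ?thesis using k by blast
  qed
  ultimately show "i \<bullet> i = \<theta> \<bullet> \<theta>" using i by blast
qed

section \<open>Signs on the affine diagram\<close>

definition nu :: "'a \<Rightarrow> 'a" where "nu x = (1 / norm x) *\<^sub>R x"

text \<open>Four times the squared cosine is the product of the two Cartan integers, hence at least
  1; if it is 1, they coincide and so do the lengths.\<close>

lemma adjacent_half:
  assumes i: "i \<in> R" and j: "j \<in> R" and neg: "i \<bullet> j < 0" and ne: "i \<noteq> - j"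
  shows "nu i \<bullet> nu j \<le> - 1/2" "nu i \<bullet> nu j = - 1/2 \<Longrightarrow> i \<bullet> i = j \<bullet> j"
proof -
  have p: "i \<bullet> i > 0" "j \<bullet> j > 0" using root_inner_pos i j by auto
  have "i \<noteq> j" using neg by (metis inner_ge_zero not_le)
  then obtain k l :: int where e: "of_int k * (j \<bullet> j) = 2 * (i \<bullet> j)" "of_int l * (i \<bullet> i) = 2 * (i \<bullet> j)" and kl: "1 \<le> k * l"
    using cint_pair[OF i j _ ne] neg by (metis less_irrefl)
  have norms: "norm i > 0" "norm j > 0" using root_nonzero i j by auto
  have e1: "nu i \<bullet> nu j = (i \<bullet> j) / (norm i * norm j)" by (simp add: nu_def)
  have ii: "norm i * norm i = i \<bullet> i" "norm j * norm j = j \<bullet> j"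
    by (simp_all add: power2_norm_eq_inner flip: power2_eq_square)
  have "4 * ((nu i \<bullet> nu j) * (nu i \<bullet> nu j)) = (2 * (i \<bullet> j)) * (2 * (i \<bullet> j)) / ((norm i * norm i) * (norm j * norm j))"
    by (simp add: e1)
  also have "\<dots> = (of_int k * (j \<bullet> j)) * (of_int l * (i \<bullet> i)) / ((i \<bullet> i) * (j \<bullet> j))" by (simp only: ii e)
  also have "\<dots> = of_int k * of_int l" using p by simp
  finally have sq: "4 * ((nu i \<bullet> nu j) * (nu i \<bullet> nu j)) = of_int (k * l)" by simp
  have neg': "nu i \<bullet> nu j < 0" unfolding e1 using neg norms by (simp add: divide_neg_pos)
  have "4 * ((nu i \<bullet> nu j) * (nu i \<bullet> nu j)) \<ge> 1" using sq kl by (simp only: of_int_1_le_iff)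
  show "nu i \<bullet> nu j \<le> - 1/2"
  proof (rule ccontr)
    assume "\<not> ?thesis"
    then have "(- (nu i \<bullet> nu j)) * (- (nu i \<bullet> nu j)) < (1/2) * (1/2)"
      using neg' by (intro mult_strict_mono) auto
    then show False using \<open>4 * ((nu i \<bullet> nu j) * (nu i \<bullet> nu j)) \<ge> 1\<close> by simp
  qed
  assume "nu i \<bullet> nu j = - 1/2"
  then have "real_of_int (k * l) = of_int 1" using sq by simp
  then have "k * l = 1" by (simp only: of_int_eq_iff)
  then have "k = l" "k \<noteq> 0" by (auto simp: zmult_eq_1_iff)
  then show "i \<bullet> i = j \<bullet> j" using e by (metis mult_left_cancel of_int_eq_0_iff)
qed

abbreviation Iaff where "Iaff \<equiv> insert (- \<theta>) S"

text \<open>\<open>N \<ge> 2\<close> excludes rank one, where \<open>- \<theta>\<close> is opposite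
  to the simple root.\<close>

lemma Iaff_props:
  assumes N: "N \<ge> 2"
  shows "Iaff \<subseteq> R" "\<And>i j. i \<in> Iaff \<Longrightarrow> j \<in> Iaff \<Longrightarrow> i \<noteq> j \<Longrightarrow> i - j \<notin> R \<and> i \<noteq> - j" "- \<theta> \<notin> S"
proof -
  show "Iaff \<subseteq> R" using S_subset theta_root by auto
  show "- \<theta> \<notin> S" using pos_not_neg[OF theta_pos] simple_pos by blast
  have ts: "\<theta> + i \<notin> R" if "i \<in> S" for i
  proof
    assume "\<theta> + i \<in> R"
    then have "\<theta> - (\<theta> + i) \<in> Qplus S" by (rule theta_above)
    then show False using Qplus_antisym[OF Qplus_simple[OF that]] root_nonzero[OF S_root[OF that]] by simp
  qed
  have tns: "\<theta> \<notin> S" using height_simple[of \<theta>] N by auto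
  fix i j assume ij: "i \<in> Iaff" "j \<in> Iaff" "i \<noteq> j"
  show "i - j \<notin> R \<and> i \<noteq> - j"
  proof (cases "i = - \<theta>")
    case True
    then have j: "j \<in> S" using ij by auto
    have "- \<theta> - j = - (\<theta> + j)" by simp
    then have "- \<theta> - j \<notin> R" using ts[OF j] by (metis uminus_root_iff)
    moreover have "- \<theta> \<noteq> - j" using tns j by auto
    ultimately show ?thesis unfolding True by blast
  next
    case False
    then have i: "i \<in> S" using ij by auto
    show ?thesis
    proof (cases "j = - \<theta>")
      case True
      then show ?thesis using ts[OF i] tns i by (auto simp: add.commute)
    next
      case False
      then have j: "j \<in> S" using ij by auto
      then show ?thesis
        using simple_diff_not_root[OF i j] pos_not_neg[OF simple_pos[OF j]] simple_pos[OF i] by auto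
    qed
  qed
qed

lemma Iaff_obtuse: "N \<ge> 2 \<Longrightarrow> i \<in> Iaff \<Longrightarrow> j \<in> Iaff \<Longrightarrow> i \<noteq> j \<Longrightarrow> i \<bullet> j \<le> 0"
  using Iaff_props diff_root[of i j] by (metis not_le subsetD)

text \<open>Otherwise add the unit vectors along \<open>J\<close>: every node has at least two
  neighbours, each contributing at most -1/2, so the sum \<open>w\<close> has
  \<open>w \<bullet> w \<le> 0\<close> and vanishes, with equality throughout. Such a relation
  involves all of \<open>Iaff\<close>, and all adjacent lengths agree, contrary to
  \<open>ns\<close>.\<close>

lemma low_degree:
  assumes N: "N \<ge> 2" and ns: "\<exists>x\<in>R. x \<bullet> x \<noteq> \<theta> \<bullet> \<theta>" and J: "J \<subseteq> Iaff" "J \<noteq> {}"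
  shows "\<exists>i\<in>J. card {j \<in> J. j \<noteq> i \<and> i \<bullet> j \<noteq> 0} \<le> 1"
proof (rule ccontr)
  assume no: "\<not> ?thesis"
  have fJ: "finite J" using J finite_S finite_subset by blast
  have JR: "i \<in> R" if "i \<in> J" for i using that J Iaff_props(1)[OF N] by blast
  define nb where "nb i = {j \<in> J. j \<noteq> i \<and> i \<bullet> j \<noteq> 0}" for i
  have nb2: "card (nb i) \<ge> 2" if "i \<in> J" for i using no that by (force simp: nb_def)
  have nb_half: "nu i \<bullet> nu j \<le> - 1/2" "nu i \<bullet> nu j = - 1/2 \<Longrightarrow> i \<bullet> i = j \<bullet> j" if "i \<in> J" "j \<in> nb i" for i j
  proof -
    have j: "i \<in> Iaff" "j \<in> Iaff" "i \<noteq> j" "i \<bullet> j \<noteq> 0" using that J by (auto simp: nb_def)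
    then have "i \<bullet> j \<le> 0" "j \<in> R" "i \<noteq> - j"
      using Iaff_obtuse[OF N] Iaff_props[OF N] by blast+
    with j(4)
    show "nu i \<bullet> nu j \<le> - 1/2" "nu i \<bullet> nu j = - 1/2 \<Longrightarrow> i \<bullet> i = j \<bullet> j"
      using adjacent_half[OF JR[OF that(1)], of j] by auto
  qed
  define w where "w = (\<Sum>i\<in>J. nu i)"
  have nw: "nu i \<bullet> w = 1 + (\<Sum>j\<in>nb i. nu i \<bullet> nu j)" if "i \<in> J" for i
  proof -
    have "nu i \<bullet> w = nu i \<bullet> nu i + (\<Sum>j\<in>J - {i}. nu i \<bullet> nu j)"
      unfolding w_def inner_sum_right using sum.remove[OF fJ that] by blast
    moreover have "nu i \<bullet> nu i = 1"
      using root_nonzero[OF JR[OF that]] by (simp add: nu_def power2_norm_eq_inner[symmetric] power2_eq_square)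
    moreover have "(\<Sum>j\<in>J - {i}. nu i \<bullet> nu j) = (\<Sum>j\<in>nb i. nu i \<bullet> nu j)"
      using fJ by (intro sum.mono_neutral_right) (auto simp: nb_def nu_def)
    ultimately show ?thesis by simp
  qed
  have fnb: "finite (nb i)" for i using fJ by (simp add: nb_def)
  have half: "(\<Sum>j\<in>nb i. nu i \<bullet> nu j) \<le> - (real (card (nb i)) / 2)" if "i \<in> J" for i
    using sum_bounded_above[of "nb i" "\<lambda>j. nu i \<bullet> nu j" "- 1/2"] nb_half(1)[OF that] by simp
  have le: "nu i \<bullet> w \<le> 0" if "i \<in> J" for i
    using nw[OF that] half[OF that] nb2[OF that] by linarith
  have "w \<bullet> w = (\<Sum>i\<in>J. nu i \<bullet> w)" by (subst w_def) (simp add: inner_sum_left)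
  also have "\<dots> \<le> 0" using le by (intro sum_nonpos) auto
  finally have w0: "w = 0" by (metis inner_eq_zero_iff inner_ge_zero order_antisym)
  have adjJ: "i \<bullet> i = j \<bullet> j" if "i \<in> J" "j \<in> nb i" for i j
  proof (rule nb_half(2)[OF that], rule ccontr)
    assume "nu i \<bullet> nu j \<noteq> - 1/2"
    then have lt: "nu i \<bullet> nu j < - 1/2" using nb_half(1)[OF that] by simp
    have "(\<Sum>j\<in>nb i. nu i \<bullet> nu j) < (\<Sum>j\<in>nb i. - 1/2)"
      by (rule sum_strict_mono_ex1[OF fnb]) (use nb_half(1)[OF that(1)] lt that(2) in auto)
    then have "(\<Sum>j\<in>nb i. nu i \<bullet> nu j) < - (real (card (nb i)) / 2)" by simp
    then show False using nw[OF that(1)] w0 nb2[OF that(1)] by simp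
  qed
  \<comment> \<open>\<open>rhoc\<close> is positive on simple roots, so they alone admit no relation
    with positive coefficients.\<close>
  have tJ: "- \<theta> \<in> J"
  proof (rule ccontr)
    assume n: "- \<theta> \<notin> J"
    have "w \<bullet> rhoc = (\<Sum>i\<in>J. 1 / norm i)"
      unfolding w_def inner_sum_left nu_def using J n inner_rhoc_simple by (intro sum.cong refl) auto
    also have "\<dots> > 0" using fJ J JR root_nonzero by (intro sum_pos) auto
    finally show False using w0 by simp
  qed
  \<comment> \<open>\<open>\<theta>\<close> has a nonzero coordinate at every simple root, so none
    can be missing from the relation.\<close>
  have "J = Iaff"
  proof (rule ccontr)
    assume "J \<noteq> Iaff"
    then obtain k where k: "k \<in> S" "k \<notin> J" using J tJ by blast
    have "w \<bullet> dualv k = (\<Sum>i\<in>J. if i = - \<theta> then - (\<theta> \<bullet> dualv k) / norm \<theta> else 0)"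
      unfolding w_def inner_sum_left nu_def
    proof (intro sum.cong refl)
      fix i assume i: "i \<in> J"
      have "i \<bullet> dualv k = 0" if "i \<noteq> - \<theta>"
      proof -
        have "i \<in> S" "i \<noteq> k" using i that J k by auto
        then show ?thesis by (simp add: inner_dualv)
      qed
      then show "((1 / norm i) *\<^sub>R i) \<bullet> dualv k = (if i = - \<theta> then - (\<theta> \<bullet> dualv k) / norm \<theta> else 0)"
        by simp
    qed
    also have "\<dots> = - (\<theta> \<bullet> dualv k) / norm \<theta>" using fJ tJ by simp
    finally have "(\<theta> \<bullet> dualv k) / norm \<theta> = 0" using w0 by simp
    then show False using theta_coord_pos[OF k(1)] root_nonzero[OF theta_root] by auto
  qed
  then have "i \<bullet> i = j \<bullet> j" if "i \<in> Iaff" "j \<in> Iaff" "i \<bullet> j \<noteq> 0" for i j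
    using adjJ[of i j] that by (cases "i = j") (auto simp: nb_def)
  then show False using adjacent_norms_imp_all ns by blast
qed

lemma two_colouring:
  assumes N: "N \<ge> 2" and ns: "\<exists>x\<in>R. x \<bullet> x \<noteq> \<theta> \<bullet> \<theta>" and J: "J \<subseteq> Iaff"
  shows "\<exists>\<sigma> :: 'a \<Rightarrow> real. (\<forall>i. \<sigma> i = 1 \<or> \<sigma> i = -1) \<and> (\<forall>i\<in>J. \<forall>j\<in>J. i \<noteq> j \<longrightarrow> i \<bullet> j \<noteq> 0 \<longrightarrow> \<sigma> i * \<sigma> j = -1)"
  using J
proof (induction "card J" arbitrary: J)
  case 0
  then have "J = {}" using finite_S finite_subset by (metis card_0_eq finite_insert)
  then show ?case by (intro exI[of _ "\<lambda>_. 1"]) auto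
next
  case (Suc n)
  have fJ: "finite J" using Suc.prems finite_S finite_subset by blast
  have "J \<noteq> {}" using Suc.hyps(2) by auto
  then obtain i where i: "i \<in> J" "card {j \<in> J. j \<noteq> i \<and> i \<bullet> j \<noteq> 0} \<le> 1" using low_degree[OF N ns Suc.prems] by blast
  have "n = card (J - {i})" using Suc.hyps(2) i(1) fJ by simp
  moreover have "J - {i} \<subseteq> Iaff" using Suc.prems by blast
  ultimately have "\<exists>\<sigma> :: 'a \<Rightarrow> real. (\<forall>i. \<sigma> i = 1 \<or> \<sigma> i = -1) \<and>
      (\<forall>k\<in>J - {i}. \<forall>j\<in>J - {i}. k \<noteq> j \<longrightarrow> k \<bullet> j \<noteq> 0 \<longrightarrow> \<sigma> k * \<sigma> j = -1)"
    by (rule Suc.hyps(1))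
  then obtain \<sigma> :: "'a \<Rightarrow> real" where s0: "(\<forall>i. \<sigma> i = 1 \<or> \<sigma> i = -1) \<and>
      (\<forall>k\<in>J - {i}. \<forall>j\<in>J - {i}. k \<noteq> j \<longrightarrow> k \<bullet> j \<noteq> 0 \<longrightarrow> \<sigma> k * \<sigma> j = -1)" ..
  note s = conjunct1[OF s0] conjunct2[OF s0]
  let ?T = "{j \<in> J. j \<noteq> i \<and> i \<bullet> j \<noteq> 0}"
  have fin: "finite ?T" using fJ by simp
  have uniq: "\<forall>x\<in>?T. \<forall>y\<in>?T. x = y"
    using i(2) unfolding One_nat_def card_le_Suc0_iff_eq[OF fin] .
  have "\<exists>t. ?T \<subseteq> {t}"
  proof (cases "?T = {}")
    case False
    then obtain t where "t \<in> ?T" by blast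
    then show ?thesis using uniq by blast
  qed auto
  then obtain t where t: "?T \<subseteq> {t}" by blast
  \<comment> \<open>\<open>t\<close> is the only possible neighbour of \<open>i\<close>; if there is
    none, it is arbitrary.\<close>
  let ?s = "\<sigma>(i := - \<sigma> t)"
  have sq: "\<sigma> t * \<sigma> t = 1" using s(1)[rule_format, of t] by auto
  show ?case
  proof (intro exI[of _ ?s] conjI allI ballI impI)
    show "?s k = 1 \<or> ?s k = -1" for k using s(1)[rule_format, of k] s(1)[rule_format, of t] by auto
    fix k j assume kj: "k \<in> J" "j \<in> J" "k \<noteq> j" "k \<bullet> j \<noteq> 0"
    consider "k = i" | "j = i" | "k \<noteq> i" "j \<noteq> i" by blast
    then show "?s k * ?s j = -1"
    proof cases
      case 1
      then have "j = t" using t kj by auto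
      then show ?thesis using 1 kj sq by simp
    next
      case 2
      then have "k = t" using t kj by (auto simp: inner_commute)
      then show ?thesis using 2 kj sq by simp
    next
      case 3
      then show ?thesis using s(2) kj by simp
    qed
  qed
qed

text \<open>With two root lengths the affine diagram is a forest, and the colouring works with all
  \<open>s\<close> equal to 1. A simply laced diagram can be an odd cycle, which has no
  two-colouring; there the cocycle is used, with constant \<open>\<sigma>\<close>.\<close>

lemma signs_exist:
  assumes N: "N \<ge> 2" shows "\<exists>s \<sigma>. sign_system Iaff s \<sigma>"
proof (cases "\<exists>x\<in>R. x \<bullet> x \<noteq> \<theta> \<bullet> \<theta>")
  case True
  obtain \<sigma> :: "'a \<Rightarrow> real" where s0: "(\<forall>i. \<sigma> i = 1 \<or> \<sigma> i = -1) \<and>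
    (\<forall>i\<in>Iaff. \<forall>j\<in>Iaff. i \<noteq> j \<longrightarrow> i \<bullet> j \<noteq> 0 \<longrightarrow> \<sigma> i * \<sigma> j = -1)"
    using two_colouring[OF N True order_refl] ..
  have "\<sigma> i * \<sigma> i = 1" for i using conjunct1[OF s0, rule_format, of i] by auto
  then show ?thesis unfolding sign_system_def
    using conjunct2[OF s0] by (intro exI[of _ "\<lambda>_ _. 1"] exI[of _ \<sigma>]) simp
next
  case False
  then have "\<exists>s. sign_system Iaff s (\<lambda>_. 1)"
    using Iaff_props[OF N] by (intro simply_laced_signs[of "\<theta> \<bullet> \<theta>"]) blast+
  then show ?thesis by blast
qed

end

section \<open>Duality of heights\<close>

text \<open>The premise on scalars also makes \<open>v\<close> injective, so indices are counted and
  not merely their images.\<close>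

lemma card_le_of_linear_injection:
  fixes v :: "'b \<Rightarrow> 'a::euclidean_space"
  assumes C: "finite C" and v: "\<And>k. k \<in> C \<Longrightarrow> v k \<in> span S"
    and inj: "\<And>w k. (\<Sum>k\<in>C. w k *\<^sub>R v k) = 0 \<Longrightarrow> k \<in> C \<Longrightarrow> w k = 0"
    and S: "independent S"
  shows "card C \<le> card S"
proof -
  have iv: "inj_on v C"
  proof (rule inj_onI, rule ccontr)
    fix a b assume ab: "a \<in> C" "b \<in> C" "v a = v b" "a \<noteq> b"
    let ?w = "\<lambda>k. (if k = a then 1 else 0) - (if k = b then 1 else 0) :: real"
    have "(\<Sum>k\<in>C. ?w k *\<^sub>R v k) = (\<Sum>k\<in>C. if k = a then v k else 0) - (\<Sum>k\<in>C. if k = b then v k else 0)"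
      unfolding sum_subtractf[symmetric] by (intro sum.cong refl) auto
    also have "\<dots> = 0" using C ab by simp
    finally have "?w a = 0" using inj[of ?w a] ab(1) by blast
    then show False using ab(4) by simp
  qed
  have "independent (v ` C)"
  proof (rule independent_if_scalars_zero)
    show "finite (v ` C)" using C by simp
    fix f x assume f: "(\<Sum>x\<in>v ` C. f x *\<^sub>R x) = 0" and x: "x \<in> v ` C"
    then have "(\<Sum>k\<in>C. f (v k) *\<^sub>R v k) = 0" by (simp add: sum.reindex[OF iv])
    then show "f x = 0" using inj[of "\<lambda>k. f (v k)"] x by blast
  qed
  moreover have "v ` C \<subseteq> span S" using v by blast
  ultimately have "card (v ` C) \<le> dim (span S)" using independent_card_le_dim by blast
  also have "dim (span S) = card S" using dim_eq_card_independent[OF S] by simp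
  finally show ?thesis using card_image[OF iv] by simp
qed

context irr_roots begin

text \<open>Weights for which the affine simple coroots sum to zero, so that the raising operator commutes
  with its adjoint.\<close>

definition nco :: "'a \<Rightarrow> real" where "nco i = (if i = - \<theta> then 1 else \<theta> \<bullet> dualv i)"

definition caff :: "'a \<Rightarrow> real" where "caff i = nco i * (i \<bullet> i)"

lemma nco_ge1: "i \<in> Iaff \<Longrightarrow> nco i \<ge> 1"
  using theta_coord_pos by (auto simp: nco_def)

lemma caff_pos: "i \<in> Iaff \<Longrightarrow> caff i > 0"
proof -
  assume i: "i \<in> Iaff"
  then have "i \<in> R" using S_root theta_root by auto
  then show ?thesis using nco_ge1[OF i] root_inner_pos[of i] by (simp add: caff_def)
qed

lemma minus_theta_not_simple: "- \<theta> \<notin> S"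
  using pos_not_neg[OF theta_pos] simple_pos by blast

lemma nco_relation: "(\<Sum>i\<in>Iaff. nco i *\<^sub>R i) = 0"
proof -
  have "(\<Sum>i\<in>Iaff. nco i *\<^sub>R i) = - \<theta> + (\<Sum>i\<in>S. nco i *\<^sub>R i)"
    using finite_S minus_theta_not_simple by (simp add: nco_def)
  also have "(\<Sum>i\<in>S. nco i *\<^sub>R i) = (\<Sum>i\<in>S. (\<theta> \<bullet> dualv i) *\<^sub>R i)"
    using minus_theta_not_simple by (intro sum.cong refl) (auto simp: nco_def)
  also have "\<dots> = \<theta>" by (rule root_expand[OF theta_root, symmetric])
  finally show ?thesis by simp
qed

text \<open>\<open>caff i\<close> times the coroot of \<open>i\<close> is \<open>2 * nco i\<close>
  times \<open>i\<close>, so this is \<open>nco_relation\<close> paired with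
  \<open>x\<close>.\<close>

lemma caff_sum: "(\<Sum>i\<in>Iaff. caff i * cint x i) = 0"
proof -
  have "caff i * cint x i = 2 * (x \<bullet> (nco i *\<^sub>R i))" if "i \<in> Iaff" for i
  proof -
    have "i \<in> R" using that S_root theta_root by auto
    then show ?thesis using root_inner_pos[of i] by (simp add: caff_def cint_def)
  qed
  then have "(\<Sum>i\<in>Iaff. caff i * cint x i) = 2 * (x \<bullet> (\<Sum>i\<in>Iaff. nco i *\<^sub>R i))"
    by (simp add: inner_sum_right sum_distrib_left)
  then show ?thesis by (simp add: nco_relation)
qed

lemma rhoc_bounds: assumes "x \<in> R" shows "x \<bullet> rhoc \<le> N" "x \<bullet> rhoc \<ge> - real N"
proof -
  have *: "y \<bullet> rhoc \<le> N" if "y \<in> R" for y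
    using Qplus_rhoc_nonneg[OF theta_above[OF that]] height_Qplus[OF pos_Qplus[OF theta_pos]]
    by (simp add: inner_diff_left)
  show "x \<bullet> rhoc \<le> N" "x \<bullet> rhoc \<ge> - real N" using *[OF assms] *[of "- x"] assms by auto
qed

text \<open>The grading by height modulo h = N + 1, in which the simple roots and
  \<open>- \<theta>\<close> all have degree 1.\<close>

definition Bres :: "int \<Rightarrow> 'a set" where
  "Bres k = {x \<in> R. \<exists>m::int. x \<bullet> rhoc = of_int (k + m * int (N + 1))}"

lemma theta_rhoc: "\<theta> \<bullet> rhoc = real N"
  using height_Qplus[OF pos_Qplus[OF theta_pos]] by simp

lemma Iaff_Bres: "i \<in> Iaff \<Longrightarrow> \<exists>m::int. i \<bullet> rhoc = of_int (1 + m * int (N + 1))"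
proof -
  assume "i \<in> Iaff"
  then consider "i \<in> S" | "i = - \<theta>" by blast
  then show ?thesis
  proof cases
    case 1
    then show ?thesis by (intro exI[of _ 0]) (simp add: inner_rhoc_simple)
  next
    case 2
    then show ?thesis by (intro exI[of _ "-1"]) (simp add: theta_rhoc)
  qed
qed

text \<open>Heights of roots lie between -N and N, which leaves only 1 and -N in this residue
  class.\<close>

lemma Bres_1: assumes "x \<in> Bres 1" shows "x \<in> Iaff"
proof -
  obtain m :: int where x: "x \<in> R" "x \<bullet> rhoc = of_int (1 + m * int (N + 1))" using assms by (auto simp: Bres_def)
  have "real_of_int (1 + m * int (N + 1)) \<le> of_int (int N)" "of_int (- int N) \<le> real_of_int (1 + m * int (N + 1))"
    using rhoc_bounds[OF x(1)] x(2) by simp_all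
  then have b0: "1 + m * int (N + 1) \<le> int N" "- int N \<le> 1 + m * int (N + 1)" by (simp_all only: of_int_le_iff)
  define n where "n = int (N + 1)"
  have n: "int N = n - 1" by (simp add: n_def)
  have b: "1 + m * n \<le> n - 1" "- (n - 1) \<le> 1 + m * n" using b0 unfolding n n_def[symmetric] by simp_all
  have n0: "n \<ge> 0" by (simp add: n_def)
  have "m < 1"
  proof (rule ccontr)
    assume "\<not> m < 1"
    then have "1 * n \<le> m * n" using n0 by (intro mult_right_mono) auto
    then show False using b by linarith
  qed
  moreover have "m > -2"
  proof (rule ccontr)
    assume "\<not> m > -2"
    then have "m * n \<le> (-2) * n" using n0 by (intro mult_right_mono) auto
    then show False using b by linarith
  qed
  ultimately consider "m = 0" | "m = -1" by linarith
  then show ?thesis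
  proof cases
    case 1
    then have h: "x \<bullet> rhoc = 1" using x by simp
    then have "x \<in> P" using pos_iff_rhoc[OF x(1)] by simp
    moreover then have "height S x = 1" using height_Qplus[OF pos_Qplus] h by (metis of_nat_1_eq_iff)
    ultimately show ?thesis using height_one_simple by blast
  next
    case 2
    then have h: "(- x) \<bullet> rhoc = real N" using x by simp
    have "\<theta> - (- x) \<in> Qplus S" using theta_above x(1) by (metis uminus_root)
    moreover have "(\<theta> - (- x)) \<bullet> rhoc \<le> 0" unfolding inner_diff_left h theta_rhoc by simp
    ultimately have "\<theta> - (- x) = 0" by (rule Qplus_rhoc_0)
    then have "x = - \<theta>" by (simp add: eq_neg_iff_add_eq_0 add.commute)
    then show ?thesis by blast
  qed
qed

lemma Bres_shift: assumes "x + i \<in> Bres (k + 1)" "x \<in> R" "i \<in> Iaff" shows "x \<in> Bres k"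
proof -
  obtain m :: int where "(x + i) \<bullet> rhoc = of_int (k + 1 + m * int (N + 1))" using assms(1) by (auto simp: Bres_def)
  moreover obtain m' :: int where "i \<bullet> rhoc = of_int (1 + m' * int (N + 1))" using Iaff_Bres assms(3) by blast
  ultimately have "x \<bullet> rhoc = of_int (k + (m - m') * int (N + 1))"
    by (simp add: inner_add_left algebra_simps)
  then show ?thesis using assms(2) unfolding Bres_def by blast
qed

lemma Bres_not_Iaff:
  assumes x: "x \<in> Bres k" and k: "2 \<le> k" "k \<le> int N - 1" shows "x \<notin> Iaff" "- x \<notin> Iaff"
proof -
  obtain m :: int where m: "x \<bullet> rhoc = of_int (k + m * int (N + 1))" using x by (auto simp: Bres_def)
  have no: "\<not> int (N + 1) dvd l" if "0 < l" "l < int (N + 1)" for l using that zdvd_not_zless by blast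
  show "x \<notin> Iaff"
  proof
    assume "x \<in> Iaff"
    then obtain m' :: int where "x \<bullet> rhoc = of_int (1 + m' * int (N + 1))" using Iaff_Bres by blast
    then have "k + m * int (N + 1) = 1 + m' * int (N + 1)" using m by (metis of_int_eq_iff)
    then have "k - 1 = int (N + 1) * (m' - m)" by (simp add: algebra_simps)
    then have "int (N + 1) dvd k - 1" by (rule dvdI)
    then show False using no[of "k - 1"] k by simp
  qed
  show "- x \<notin> Iaff"
  proof
    assume "- x \<in> Iaff"
    then obtain m' :: int where "(- x) \<bullet> rhoc = of_int (1 + m' * int (N + 1))" using Iaff_Bres by blast
    then have "x \<bullet> rhoc = of_int (- (1 + m' * int (N + 1)))" by simp
    then have "k + m * int (N + 1) = - (1 + m' * int (N + 1))" using m by (metis of_int_eq_iff)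
    then have "k + 1 = int (N + 1) * (- m' - m)" by (simp add: algebra_simps)
    then have "int (N + 1) dvd k + 1" by (rule dvdI)
    then show False using no[of "k + 1"] k by simp
  qed
qed

text \<open>Comparing heights in i + j = k + l matches the occurrences of \<open>- \<theta>\<close>;
  the rest is independence of \<open>S\<close>.\<close>

lemma Iaff_relation:
  assumes N: "N \<ge> 2" and i: "i \<in> Iaff" "j \<in> Iaff" "k \<in> Iaff" "i + j - k \<in> Iaff" "k \<noteq> j" "i \<noteq> j"
  shows "k = i"
proof -
  define l where "l = i + j - k"
  have e: "i + j = k + l" by (simp add: l_def)
  have h: "x \<bullet> rhoc = (if x = - \<theta> then - real N else 1)" if "x \<in> Iaff" for x
    using that inner_rhoc_simple theta_rhoc minus_theta_not_simple by auto
  have hs: "i \<bullet> rhoc + j \<bullet> rhoc = k \<bullet> rhoc + l \<bullet> rhoc" using e by (metis inner_add_left)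
  have N2: "real N \<ge> 2" using N by simp
  have l: "l \<in> Iaff" using i(4) by (simp add: l_def)
  consider "i = - \<theta>" | "j = - \<theta>" "i \<noteq> - \<theta>" | "i \<noteq> - \<theta>" "j \<noteq> - \<theta>" by blast
  then show ?thesis
  proof cases
    case 1
    then have "k = - \<theta> \<or> l = - \<theta>" using hs h[OF i(1)] h[OF i(2)] h[OF i(3)] h[OF l] i(6) N2 by (auto split: if_splits)
    then show ?thesis using 1 e i(5) by auto
  next
    case 2
    then have "k = - \<theta> \<or> l = - \<theta>" using hs h[OF i(1)] h[OF i(2)] h[OF i(3)] h[OF l] N2 by (auto split: if_splits)
    then show ?thesis using 2 e i(5) by auto
  next
    case 3
    then have "k \<noteq> - \<theta>" "l \<noteq> - \<theta>" using hs h[OF i(1)] h[OF i(2)] h[OF i(3)] h[OF l] N2 by (auto split: if_splits)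
    then have S: "i \<in> S" "j \<in> S" "k \<in> S" "l \<in> S" using 3 i l by auto
    have "i \<bullet> dualv k + j \<bullet> dualv k = k \<bullet> dualv k + l \<bullet> dualv k" using e by (metis inner_add_left)
    then show ?thesis using S i(5) by (auto simp: inner_dualv split: if_splits)
  qed
qed

end

section \<open>The cyclic raising operator and its rank\<close>

locale affine_raising = raising R S \<theta> "insert (- \<theta>) S" "irr_roots.caff S \<theta>" s
  for R S :: "'a::euclidean_space set" and \<theta> s +
  fixes \<sigma> :: "'a \<Rightarrow> real"
  assumes N2: "N \<ge> 2" and sigma_sq: "\<And>i. \<sigma> i * \<sigma> i = 1"
    and s_adj: "\<And>i j. i \<in> Iaff \<Longrightarrow> j \<in> Iaff \<Longrightarrow> i \<noteq> j \<Longrightarrow> i \<bullet> j \<noteq> 0 \<Longrightarrow> s j i * s i j = - (\<sigma> i * \<sigma> j)"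
begin

sublocale fin: finite_raising R S \<theta> caff s
proof unfold_locales
  show "S \<subseteq> R" by (rule S_subset)
  show "caff i > 0" if "i \<in> S" for i using caff_pos that by blast
  then show "caff i \<ge> 0" if "i \<in> S" for i using that less_imp_le by blast
qed (use I_diff s_sq s_square in auto)

text \<open>The transpose of the raising operator from the Cartan subalgebra to the affine simple roots.\<close>

definition z0 :: "('a \<Rightarrow> real) \<Rightarrow> 'a" where
  "z0 g = (\<Sum>i\<in>Iaff. (g i * \<sigma> i * sqrt (2 * nco i)) *\<^sub>R i)"

lemma strw_affine: assumes "i \<in> Iaff" "j \<in> Iaff" "i \<noteq> j" shows "strw j i = - cint i j"
proof -
  have "i \<in> R" "j \<in> R" "i - j \<notin> R" "i \<noteq> - j" using assms I_sub I_diff by auto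
  then show ?thesis using strw_diff[of i j] assms(3) strw_0[of "i - j" j] by simp
qed

text \<open>The weights turn both Cartan integers into \<open>2 * (i \<bullet> j)\<close>, so the
  square root is an absolute value. As \<open>i \<bullet> j\<close> is negative here, the sign in
  \<open>s_adj\<close> removes it.\<close>

lemma co_affine:
  assumes i: "i \<in> Iaff" "j \<in> Iaff" "i \<noteq> j"
  shows "co j i * co i j = \<sigma> i * \<sigma> j * (2 * (sqrt (nco i) * sqrt (nco j))) * (i \<bullet> j)"
proof (cases "i \<bullet> j = 0")
  case True
  then show ?thesis using strw_affine[OF i] by (simp add: co_def cint_def)
next
  case False
  have ij: "i \<bullet> j < 0" using False Iaff_obtuse[OF N2 i] by simp
  have p: "i \<bullet> i > 0" "j \<bullet> j > 0" using i I_sub root_inner_pos by auto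
  have e: "(j \<bullet> j) * strw j i = - (2 * (i \<bullet> j))" "(i \<bullet> i) * strw i j = - (2 * (i \<bullet> j))"
    using strw_affine[OF i] strw_affine[OF i(2,1)] i(3) p by (simp_all add: cint_def inner_commute)
  have "caff j * strw j i * (caff i * strw i j) = (nco i * nco j) * (((j \<bullet> j) * strw j i) * ((i \<bullet> i) * strw i j))"
    by (simp only: caff_def mult_ac)
  also have "\<dots> = (nco i * nco j) * ((2 * (i \<bullet> j)) * (2 * (i \<bullet> j)))" unfolding e by simp
  finally have "sqrt (caff j * strw j i) * sqrt (caff i * strw i j) = sqrt (nco i * nco j) * \<bar>2 * (i \<bullet> j)\<bar>"
    unfolding real_sqrt_mult[symmetric] by (simp only: real_sqrt_mult[of "nco i * nco j"] real_sqrt_abs2)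
  then have "co j i * co i j = (s j i * s i j) * (sqrt (nco i * nco j) * \<bar>2 * (i \<bullet> j)\<bar>)"
    by (simp only: co_def mult_ac)
  then show ?thesis using s_adj[OF i False] ij by (simp add: real_sqrt_mult)
qed

text \<open>In the full Lie algebra, commuting the operators here leads through the Cartan
  subalgebra: the right-hand side is \<open>z0\<close> followed by its transpose. The factor
  \<open>sqrt (2 * nco i)\<close> is the square root of \<open>caff i\<close> times 2 / (i .
  i).\<close>

lemma level_one:
  assumes g: "\<And>x. g x \<noteq> 0 \<Longrightarrow> x \<in> Iaff" and i: "i \<in> Iaff"
  shows "Dn (Up g) i = \<sigma> i * sqrt (2 * nco i) * (i \<bullet> z0 g)"
proof -
  have iR: "i \<in> R" using i I_sub by auto
  have two: "i + i \<notin> R" using root_diff_ne[OF iR, of "i + i"] by auto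
  have fI: "finite Iaff" by (rule finite_I)
  have "Dn (Up g) i = (\<Sum>j\<in>Iaff. \<Sum>k\<in>Iaff. co j i * co k (i + j - k) * g (i + j - k))"
    by (simp add: Dn_def Up_def sum_distrib_left mult.assoc)
  \<comment> \<open>By \<open>Iaff_relation\<close> only \<open>k = j\<close>, which returns to
    \<open>i\<close>, and \<open>k = i\<close>, which reads \<open>g\<close> at \<open>j\<close>,
    survive.\<close>
  also have "\<dots> = (\<Sum>j\<in>Iaff. \<Sum>k\<in>Iaff. (if k = j then co j i * co j i * g i else 0)
      + (if k = i then (if j = i then 0 else co j i * co i j * g j) else 0))"
  proof (intro sum.cong refl)
    fix j k assume jk: "j \<in> Iaff" "k \<in> Iaff"
    have z: "co i i = 0" using co_0[of i i] two by blast
    show "co j i * co k (i + j - k) * g (i + j - k) = (if k = j then co j i * co j i * g i else 0)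
      + (if k = i then (if j = i then 0 else co j i * co i j * g j) else 0)"
    proof (cases "j = i")
      case True
      then show ?thesis using z by simp
    next
      case ji: False
      show ?thesis
      proof (cases "k = j")
        case True
        then show ?thesis using ji by simp
      next
        case kj: False
        show ?thesis
        proof (cases "k = i")
          case True
          then show ?thesis using ji kj by simp
        next
          case False
          then have "i + j - k \<notin> Iaff" using Iaff_relation[OF N2 i jk(1,2)] kj ji by blast
          then have "g (i + j - k) = 0" using g by blast
          then show ?thesis using kj False by simp
        qed
      qed
    qed
  qed
  also have "\<dots> = (\<Sum>j\<in>Iaff. co j i * co j i * g i + (if j = i then 0 else co j i * co i j * g j))"
    using fI i by (simp add: sum.distrib)
  also have "\<dots> = (\<Sum>j\<in>Iaff. co j i * co j i) * g i + (\<Sum>j\<in>Iaff. if j = i then 0 else co j i * co i j * g j)"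
    by (simp add: sum.distrib sum_distrib_right)
  also have "(\<Sum>j\<in>Iaff. co j i * co j i) = 2 * caff i"
  proof -
    have "(\<Sum>j\<in>Iaff. co j i * co j i) = (\<Sum>j\<in>Iaff. (if j = i then 2 * caff i else 0) - caff j * cint i j)"
    proof (intro sum.cong refl)
      fix j assume j: "j \<in> Iaff"
      show "co j i * co j i = (if j = i then 2 * caff i else 0) - caff j * cint i j"
        using co_sq[OF j, of i] strw_affine[OF i j] strw_0[of i i] two iR by (cases "j = i") auto
    qed
    also have "\<dots> = 2 * caff i - (\<Sum>j\<in>Iaff. caff j * cint i j)"
      using fI i by (simp add: sum_subtractf)
    finally show ?thesis by (simp add: caff_sum)
  qed
  also have "2 * caff i * g i + (\<Sum>j\<in>Iaff. if j = i then 0 else co j i * co i j * g j)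
     = (\<Sum>j\<in>Iaff. \<sigma> i * \<sigma> j * (2 * (sqrt (nco i) * sqrt (nco j))) * (i \<bullet> j) * g j)"
  proof -
    have n0: "nco i \<ge> 0" using nco_ge1[OF i] by simp
    have "(\<Sum>j\<in>Iaff. \<sigma> i * \<sigma> j * (2 * (sqrt (nco i) * sqrt (nco j))) * (i \<bullet> j) * g j)
      = (\<Sum>j\<in>Iaff. (if j = i then 2 * caff i * g i else 0) + (if j = i then 0 else co j i * co i j * g j))"
    proof (intro sum.cong refl)
      fix j assume j: "j \<in> Iaff"
      show "\<sigma> i * \<sigma> j * (2 * (sqrt (nco i) * sqrt (nco j))) * (i \<bullet> j) * g j
        = (if j = i then 2 * caff i * g i else 0) + (if j = i then 0 else co j i * co i j * g j)"
        using co_affine[OF i j] sigma_sq[of i] n0 by (cases "j = i") (auto simp: caff_def)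
    qed
    then show ?thesis using fI i by (simp add: sum.distrib)
  qed
  also have "\<dots> = \<sigma> i * sqrt (2 * nco i) * (i \<bullet> z0 g)"
  proof -
    have sq: "2 * (sqrt (nco i) * sqrt (nco j)) = sqrt (2 * nco i) * sqrt (2 * nco j)" for j
    proof -
      have "sqrt (2 * nco i) * sqrt (2 * nco j) = (sqrt 2 * sqrt 2) * (sqrt (nco i) * sqrt (nco j))"
        by (simp only: real_sqrt_mult mult_ac)
      then show ?thesis by simp
    qed
    have "\<sigma> i * \<sigma> j * (2 * (sqrt (nco i) * sqrt (nco j))) * (i \<bullet> j) * g j
        = \<sigma> i * sqrt (2 * nco i) * ((g j * \<sigma> j * sqrt (2 * nco j)) * (i \<bullet> j))" for j
      unfolding sq by (simp only: mult_ac)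
    then show ?thesis unfolding z0_def inner_sum_right sum_distrib_left inner_scaleR_right
      by (intro sum.cong refl)
  qed
  finally show ?thesis .
qed

lemma Dn_Bres:
  assumes "\<And>x. f x \<noteq> 0 \<Longrightarrow> x \<in> Bres (k + 1)" and "Dn f x \<noteq> 0" shows "x \<in> Bres k"
  using Dn_supp[OF assms(2)] assms(1) Bres_shift by blast

text \<open>If \<open>Dn (Dn f)\<close> vanishes on \<open>R\<close>, commutation makes
  \<open>Dn (Up (Dn f))\<close> vanish on the support of \<open>Dn f\<close>, and the norm
  identities then kill \<open>Up (Dn f)\<close> and \<open>Dn f\<close> in turn. At the lowest level
  \<open>level_one\<close> replaces commutation.\<close>

lemma kernel:
  assumes "1 \<le> j" "j + 1 \<le> N" and "\<And>x. f x \<noteq> 0 \<Longrightarrow> x \<in> Bres (int j + 1)" and "z0 ((Dn ^^ j) f) = 0" and "x \<in> R"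
  shows "Dn f x = 0"
  using assms
proof (induction j arbitrary: f x rule: nat_induct_at_least[of 1])
  case base
  then have sup: "Dn f y \<noteq> 0 \<Longrightarrow> y \<in> Iaff" for y
    using Dn_Bres[of f 1 y] Bres_1 by simp
  have "Dn (Up (Dn f)) y = 0" if "Dn f y \<noteq> 0" for y
    using level_one[of "Dn f", OF sup sup[OF that]] base(3) by simp
  then have "Up (Dn f) y = 0" if "y \<in> R" for y using Up_zero[of "Dn f"] that by blast
  then show ?case using Dn_zero[of f] base(4) by blast
next
  case (Suc j)
  have sup: "Dn f y \<noteq> 0 \<Longrightarrow> y \<in> Bres (int j + 1)" for y
    using Dn_Bres[of f "int j + 1" y] Suc.prems(2) by (simp add: add.commute)
  have "z0 ((Dn ^^ j) (Dn f)) = 0" using Suc.prems(3) by (simp add: funpow_swap1)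
  then have DD: "Dn (Dn f) y = 0" if "y \<in> R" for y
    using Suc.IH[of "Dn f" y] Suc.prems(1) sup that by simp
  have "Dn (Up (Dn f)) y = 0" if y: "y \<in> R" "Dn f y \<noteq> 0" for y
  proof -
    have "y \<notin> Iaff" "- y \<notin> Iaff"
      using Bres_not_Iaff[OF sup[OF y(2)]] Suc.prems(1) Suc.hyps by auto
    then have "Dn (Up (Dn f)) y = Up (Dn (Dn f)) y" using commutator[OF y(1)] by (simp add: caff_sum)
    also have "\<dots> = 0" using Up_supp[of "Dn (Dn f)" y] DD by blast
    finally show ?thesis .
  qed
  then have "Up (Dn f) y = 0" if "y \<in> R" for y using Up_zero[of "Dn f"] that by blast
  then show ?case using Dn_zero[of f] Suc.prems(4) by blast
qed

text \<open>By \<open>kernel\<close>, the raising operator out of the roots of height \<open>j\<close> modulo \<open>h\<close> has rank at most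
  \<open>card S\<close>. It is block triangular with respect to the two heights \<open>j\<close> and \<open>j - h\<close>: its diagonal blocks,
  built from the simple roots alone, are surjective and injective.\<close>

lemma two_levels_le:
  assumes j: "1 \<le> j" "j + 1 \<le> N"
  shows "card ({x \<in> R. x \<bullet> rhoc = real j + 1} \<union> {x \<in> R. x \<bullet> rhoc = real j - real N - 1}) \<le> card S"
proof -
  let ?A = "{x \<in> R. x \<bullet> rhoc = real j + 1}" and ?B = "{x \<in> R. x \<bullet> rhoc = real j - real N - 1}"
  define C where "C = ?A \<union> ?B"
  have fC: "finite C" using finite_R by (simp add: C_def)
  define ind where "ind k x = (if x = k then 1 else 0::real)" for k x :: 'a
  \<comment> \<open>A root of height j - h enters through its image under the simple raising
    operators, at height j + 1 - h; thus every \<open>F k\<close> lies in the residue class of j +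
    1.\<close>
  define F where "F k = (if k \<in> ?A then ind k else fin.Up (ind k))" for k
  define v where "v k = z0 ((Dn ^^ j) (F k))" for k
  have "card C \<le> card S"
  proof (rule card_le_of_linear_injection[OF fC])
    show "v k \<in> span S" for k
    proof -
      have "i \<in> span S" if "i \<in> Iaff" for i
        using that span_R_S theta_root by (auto intro: span_base span_neg)
      then show ?thesis unfolding v_def z0_def by (intro span_sum span_scale)
    qed
    show "independent S" by (rule S_indep)
    fix w k assume w: "(\<Sum>k\<in>C. w k *\<^sub>R v k) = 0" and k: "k \<in> C"
    define a where "a x = (if x \<in> ?A then w x else 0)" for x
    define b where "b x = (if x \<in> ?B then w x else 0)" for x
    define f where "f x = (\<Sum>k\<in>C. w k * F k x)" for x
    have AB: "?A \<inter> ?B = {}" by auto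
    have bsum: "b = (\<lambda>x. \<Sum>k\<in>?B. w k * ind k x)"
    proof
      fix x
      have "(\<Sum>k\<in>?B. w k * ind k x) = (\<Sum>k\<in>?B. if x = k then w k else 0)"
        by (intro sum.cong refl) (auto simp: ind_def)
      then show "b x = (\<Sum>k\<in>?B. w k * ind k x)" using finite_R by (simp add: b_def)
    qed
    have f: "f x = a x + fin.Up b x" for x
    proof -
      have "f x = (\<Sum>k\<in>?A. w k * F k x) + (\<Sum>k\<in>?B. w k * F k x)"
        unfolding f_def C_def using finite_R AB by (intro sum.union_disjoint) auto
      also have "(\<Sum>k\<in>?A. w k * F k x) = (\<Sum>k\<in>?A. if x = k then w k else 0)"
        by (intro sum.cong refl) (auto simp: F_def ind_def)
      also have "\<dots> = a x" using finite_R by (simp add: a_def)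
      also have "(\<Sum>k\<in>?B. w k * F k x) = (\<Sum>k\<in>?B. w k * fin.Up (ind k) x)"
        using AB by (intro sum.cong refl) (auto simp: F_def)
      also have "\<dots> = fin.Up b x" unfolding bsum using finite_R by (simp add: fin.Up_sum)
      finally show ?thesis .
    qed
    have Ub: "x \<in> R \<and> x \<bullet> rhoc = real j - real N" if "fin.Up b x \<noteq> 0" for x
    proof -
      obtain i where i: "i \<in> S" "x \<in> R" "x - i \<in> R" "b (x - i) \<noteq> 0" using fin.Up_supp \<open>fin.Up b x \<noteq> 0\<close> by blast
      then have "(x - i) \<bullet> rhoc = real j - real N - 1" by (auto simp: b_def split: if_splits)
      then show ?thesis using i inner_rhoc_simple[OF i(1)] by (simp add: inner_diff_left)
    qed
    have fsup: "f x \<noteq> 0 \<Longrightarrow> x \<in> Bres (int j + 1)" for x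
    proof -
      assume "f x \<noteq> 0"
      then consider "a x \<noteq> 0" | "fin.Up b x \<noteq> 0" using f by force
      then show ?thesis
      proof cases
        case 1
        then have "x \<in> R" "x \<bullet> rhoc = real j + 1" by (auto simp: a_def split: if_splits)
        then show ?thesis unfolding Bres_def by (auto intro!: exI[of _ 0])
      next
        case 2
        then show ?thesis using Ub[of x] unfolding Bres_def by (auto intro!: exI[of _ "-1"])
      qed
    qed
    have "z0 ((Dn ^^ j) f) = (\<Sum>k\<in>C. w k *\<^sub>R v k)"
    proof -
      have "(Dn ^^ j) f = (\<lambda>x. \<Sum>k\<in>C. w k * (Dn ^^ j) (F k) x)" unfolding f_def by (rule Dn_pow_sum[OF fC])
      then show ?thesis
        unfolding v_def z0_def
        by (simp add: sum_distrib_right scaleR_sum_left scaleR_sum_right sum.swap[of _ Iaff C] mult.assoc)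
    qed
    then have D0: "Dn f x = 0" if "x \<in> R" for x using kernel[OF j fsup _ that] w by simp
    have split: "Dn f x = (\<Sum>i\<in>S. fin.co i x * f (x + i)) + co (- \<theta>) x * f (x - \<theta>)" for x
      unfolding Dn_def using finite_S minus_theta_not_simple by (simp add: co_def fin.co_def)
    \<comment> \<open>At height j - h, subtracting \<open>\<theta>\<close> leaves \<open>R\<close>,
      and \<open>a\<close> lives at another height than \<open>x + i\<close>; so \<open>Dn f\<close>
      reduces to the simple-root block acting on \<open>fin.Up b\<close>.\<close>
    have "fin.Dn (fin.Up b) x = 0" if x: "x \<in> R" "b x \<noteq> 0" for x
    proof -
      have h: "x \<bullet> rhoc = real j - real N - 1" using x by (auto simp: b_def split: if_splits)
      have "x - \<theta> \<notin> R"
      proof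
        assume "x - \<theta> \<in> R"
        then have "(x - \<theta>) \<bullet> rhoc \<ge> - real N" by (rule rhoc_bounds)
        then show False using h j by (simp add: inner_diff_left theta_rhoc)
      qed
      then have "co (- \<theta>) x = 0" using co_0[of x "- \<theta>"] by simp
      moreover have "a (x + i) = 0" if "i \<in> S" for i
        using h inner_rhoc_simple[OF that] by (auto simp: a_def inner_add_left)
      ultimately have "Dn f x = fin.Dn (fin.Up b) x" unfolding split fin.Dn_def by (simp add: f)
      then show ?thesis using D0[OF x(1)] by simp
    qed
    then have Ub0: "fin.Up b x = 0" for x using fin.Up_zero[of b x] Ub[of x] by blast
    have b0: "b x = 0" for x
    proof (rule fin.Up_inj)
      show "x \<in> R \<and> x \<bullet> rhoc < - 1" if "b x \<noteq> 0" for x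
        using that j by (auto simp: b_def split: if_splits)
    qed (rule Ub0)
    have fa: "f = a" using f Ub0 by auto
    \<comment> \<open>Now \<open>f\<close> is concentrated at height j + 1, so the
      \<open>- \<theta>\<close> term of \<open>Dn f\<close> vanishes at height j.\<close>
    have a0: "a x = 0" for x
    proof (rule fin.Dn_inj)
      show "x \<in> R \<and> x \<bullet> rhoc > 1" if "a x \<noteq> 0" for x
        using that j by (auto simp: a_def split: if_splits)
      show "fin.Dn a x = 0" if x: "x \<in> R" for x
      proof (rule ccontr)
        assume n: "fin.Dn a x \<noteq> 0"
        then obtain i where i: "i \<in> S" "a (x + i) \<noteq> 0" using fin.Dn_supp by blast
        then have "(x + i) \<bullet> rhoc = real j + 1" by (auto simp: a_def split: if_splits)
        then have h: "x \<bullet> rhoc = real j" using inner_rhoc_simple[OF i(1)] by (simp add: inner_add_left)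
        then have "a (x - \<theta>) = 0" by (auto simp: a_def inner_diff_left theta_rhoc)
        then have "Dn f x = fin.Dn a x" unfolding split unfolding fa fin.Dn_def by simp
        then show False using n D0[OF x] by simp
      qed
    qed
    show "w k = 0" using k a0[of k] b0[of k] by (auto simp: C_def a_def b_def)
  qed
  then show ?thesis by (simp add: C_def)
qed

end

section \<open>Counting roots by height, and the resulting identity\<close>

context irr_roots begin

definition cnt :: "nat \<Rightarrow> nat" where "cnt j = card {g \<in> P. height S g = j}"

lemma cnt_1: "cnt 1 = card S"
proof -
  have "{g \<in> P. height S g = 1} = S" using height_one_simple height_simple simple_pos by auto
  then show ?thesis by (simp add: cnt_def)
qed

lemma cnt_gt_N: "j > N \<Longrightarrow> cnt j = 0"
proof -
  assume "j > N"
  then have "{g \<in> P. height S g = j} = {}" using height_le_N by fastforce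
  then show ?thesis by (simp only: cnt_def card.empty)
qed

lemma cnt_le:
  assumes j: "1 \<le> j" "j + 1 \<le> N" shows "cnt (j + 1) + cnt (N + 1 - j) \<le> card S"
proof -
  have N2: "N \<ge> 2" using j by simp
  obtain s \<sigma> where s: "sign_system Iaff s \<sigma>" using signs_exist[OF N2] by blast
  interpret affine_raising R S \<theta> s \<sigma>
  proof
    show "Iaff \<subseteq> R" by (rule Iaff_props(1)[OF N2])
    show "i - j \<notin> R \<and> i \<noteq> - j" if "i \<in> Iaff" "j \<in> Iaff" "i \<noteq> j" for i j by (rule Iaff_props(2)[OF N2 that])
    show "0 \<le> caff i" if "i \<in> Iaff" for i using caff_pos[OF that] by simp
    show "s i x * s i x = 1" "\<sigma> i * \<sigma> i = 1" for i x using s by (simp_all add: sign_system_def)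
    show "s i x * s j x = s i (x + j) * s j (x + i)" if "i \<in> Iaff" "j \<in> Iaff" "i \<noteq> j" "x \<in> R" "x + i \<in> R" "x + j \<in> R" "x + i + j \<in> R" for i j x
      using s that unfolding sign_system_def by blast
    show "s j i * s i j = - (\<sigma> i * \<sigma> j)" if "i \<in> Iaff" "j \<in> Iaff" "i \<noteq> j" "i \<bullet> j \<noteq> 0" for i j
      using s that unfolding sign_system_def by blast
    show "N \<ge> 2" by (rule N2)
  qed
  let ?A = "{x \<in> R. x \<bullet> rhoc = real j + 1}" and ?B = "{x \<in> R. x \<bullet> rhoc = real j - real N - 1}"
  have "{g \<in> P. height S g = j + 1} = ?A"
  proof
    show "{g \<in> P. height S g = j + 1} \<subseteq> ?A"
    proof
      fix x assume x: "x \<in> {g \<in> P. height S g = j + 1}"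
      then have "x \<bullet> rhoc = real (j + 1)" using height_Qplus[OF pos_Qplus, of x] by simp
      then show "x \<in> ?A" using x pos_root by simp
    qed
    show "?A \<subseteq> {g \<in> P. height S g = j + 1}"
    proof
      fix x assume x: "x \<in> ?A"
      then have "x \<in> P" using pos_iff_rhoc by auto
      moreover then have "real (height S x) = real (j + 1)" using height_Qplus[OF pos_Qplus] x by simp
      ultimately show "x \<in> {g \<in> P. height S g = j + 1}" by (simp only: of_nat_eq_iff mem_Collect_eq)
    qed
  qed
  then have cA: "cnt (j + 1) = card ?A" by (simp add: cnt_def)
  have "?B = uminus ` {g \<in> P. height S g = N + 1 - j}"
  proof
    show "uminus ` {g \<in> P. height S g = N + 1 - j} \<subseteq> ?B"
    proof (rule image_subsetI)
      fix g assume g: "g \<in> {g \<in> P. height S g = N + 1 - j}"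
      then have "g \<bullet> rhoc = real (N + 1 - j)" using height_Qplus[OF pos_Qplus, of g] by simp
      then show "- g \<in> ?B" using g pos_root j by (simp add: of_nat_diff)
    qed
    show "?B \<subseteq> uminus ` {g \<in> P. height S g = N + 1 - j}"
    proof
      fix x assume x: "x \<in> ?B"
      then have xP: "- x \<in> P" using pos_iff_rhoc[of "- x"] j by auto
      then have "real (height S (- x)) = real (N + 1 - j)" using height_Qplus[OF pos_Qplus[OF xP]] x j by (simp add: of_nat_diff)
      then have "- x \<in> {g \<in> P. height S g = N + 1 - j}" using xP by (simp only: of_nat_eq_iff mem_Collect_eq)
      then show "x \<in> uminus ` {g \<in> P. height S g = N + 1 - j}" using imageI[of "- x" _ uminus] by simp
    qed
  qed
  then have cB: "cnt (N + 1 - j) = card ?B" by (simp add: cnt_def card_image inj_on_def)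
  have "cnt (j + 1) + cnt (N + 1 - j) = card (?A \<union> ?B)"
    unfolding cA cB using finite_R by (intro card_Un_disjoint[symmetric]) auto
  also have "\<dots> \<le> card S" by (rule two_levels_le[OF j])
  finally show ?thesis .
qed

lemma sum_cnt: "(\<Sum>g\<in>P. f (height S g)) = (\<Sum>j=1..N. of_nat (cnt j) * f j)" for f :: "nat \<Rightarrow> 'b::comm_semiring_1"
proof -
  have "(\<Sum>g\<in>P. f (height S g)) = (\<Sum>j\<in>{1..N}. \<Sum>g\<in>{g \<in> P. height S g = j}. f (height S g))"
    using finite_P height_le_N pos_height_ge1 by (intro sum.group[symmetric]) auto
  also have "\<dots> = (\<Sum>j\<in>{1..N}. of_nat (cnt j) * f j)"
    by (intro sum.cong refl) (simp add: cnt_def)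
  finally show ?thesis .
qed

lemma cnt_duality: assumes "j \<le> N" shows "cnt (j + 1) + cnt (N + 1 - j) = card S"
proof -
  have le: "cnt (j + 1) + cnt (N + 1 - j) \<le> card S" if "j \<le> N" for j
  proof -
    \<comment> \<open>For \<open>j = 0\<close> and \<open>j = N\<close> one count is
      \<open>cnt 1\<close> and the other is \<open>cnt (N + 1)\<close>, which is 0.\<close>
    consider "j = 0" | "j = N" | "1 \<le> j" "j + 1 \<le> N" using \<open>j \<le> N\<close> by linarith
    then show ?thesis by cases (use cnt_le cnt_1 cnt_gt_N N_ge1 in auto)
  qed
  have "card R = 2 * card P"
  proof -
    have "int (card R) = (\<Sum>g\<in>R. 1)" by simp
    also have "\<dots> = 2 * int (card P)" by (subst sum_R_split) simp
    finally show ?thesis by simp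
  qed
  have cP: "card P = (\<Sum>j=1..N. cnt j)" using sum_cnt[of "\<lambda>_. 1::nat"] by simp
  have s1: "(\<Sum>j\<le>N. cnt (j + 1)) = (\<Sum>j=1..N. cnt j)"
  proof -
    have "(\<Sum>j\<le>N. cnt (j + 1)) = (\<Sum>j\<in>{1..N+1}. cnt j)"
      by (rule sum.reindex_bij_witness[of _ "\<lambda>j. j - 1" "\<lambda>j. j + 1"]) auto
    also have "\<dots> = (\<Sum>j=1..N. cnt j)" using cnt_gt_N[of "N + 1"] by simp
    finally show ?thesis .
  qed
  have s2: "(\<Sum>j\<le>N. cnt (N + 1 - j)) = (\<Sum>j\<le>N. cnt (j + 1))"
    by (rule sum.reindex_bij_witness[of _ "\<lambda>j. N - j" "\<lambda>j. N - j"]) (auto intro!: arg_cong[of _ _ cnt])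
  have "(\<Sum>j\<le>N. cnt (j + 1) + cnt (N + 1 - j)) = card R"
    unfolding sum.distrib s2 s1 using \<open>card R = 2 * card P\<close> cP by simp
  also have "\<dots> = (\<Sum>j\<le>N. card S)" using card_roots by simp
  finally have eq: "(\<Sum>j\<le>N. cnt (j + 1) + cnt (N + 1 - j)) = (\<Sum>j\<le>N. card S)" .
  show ?thesis
  proof (rule ccontr)
    assume "cnt (j + 1) + cnt (N + 1 - j) \<noteq> card S"
    then have "cnt (j + 1) + cnt (N + 1 - j) < card S" using le[OF assms] by simp
    then have "(\<Sum>j\<le>N. cnt (j + 1) + cnt (N + 1 - j)) < (\<Sum>j\<le>N. card S)"
      using le assms by (intro sum_strict_mono_ex1) auto
    then show False using eq by simp
  qed
qed

lemma height_polynomial_duality: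
  "(\<Sum>g\<in>P. qq ^ (height S g - 1)) + qq * (\<Sum>g\<in>P. qq ^ (N - height S g))
     = of_nat (card S) * (\<Sum>j\<le>N. qq ^ j)"
proof -
  have "(\<Sum>g\<in>P. qq ^ (height S g - 1)) = (\<Sum>j=1..N. of_nat (cnt j) * qq ^ (j - 1))" by (rule sum_cnt)
  \<comment> \<open>The added index carries no roots; it gives both sums the common range from 0 to
    N.\<close>
  also have "\<dots> = (\<Sum>j=1..N+1. of_nat (cnt j) * qq ^ (j - 1))" using cnt_gt_N[of "N + 1"] by simp
  also have "\<dots> = (\<Sum>j\<le>N. of_nat (cnt (j + 1)) * qq ^ j)"
    by (rule sum.reindex_bij_witness[of _ "\<lambda>j. j + 1" "\<lambda>j. j - 1"]) auto
  finally have 1: "(\<Sum>g\<in>P. qq ^ (height S g - 1)) = (\<Sum>j\<le>N. of_nat (cnt (j + 1)) * qq ^ j)" .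
  have "qq * (\<Sum>g\<in>P. qq ^ (N - height S g)) = (\<Sum>g\<in>P. qq ^ (N + 1 - height S g))"
    unfolding sum_distrib_left using height_le_N
    by (intro sum.cong refl) (simp add: Suc_diff_le)
  also have "\<dots> = (\<Sum>j=1..N. of_nat (cnt j) * qq ^ (N + 1 - j))" by (rule sum_cnt)
  also have "\<dots> = (\<Sum>j=1..N+1. of_nat (cnt j) * qq ^ (N + 1 - j))" using cnt_gt_N[of "N + 1"] by simp
  also have "\<dots> = (\<Sum>j\<le>N. of_nat (cnt (N + 1 - j)) * qq ^ j)"
    by (rule sum.reindex_bij_witness[of _ "\<lambda>j. N + 1 - j" "\<lambda>j. N + 1 - j"]) auto
  finally have 2: "qq * (\<Sum>g\<in>P. qq ^ (N - height S g)) = (\<Sum>j\<le>N. of_nat (cnt (N + 1 - j)) * qq ^ j)" .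
  have "of_nat (cnt (j + 1)) * qq ^ j + of_nat (cnt (N + 1 - j)) * qq ^ j = of_nat (card S) * qq ^ j" if "j \<le> N" for j
    unfolding cnt_duality[OF that, symmetric] by (simp add: distrib_right)
  then have "(\<Sum>j\<le>N. of_nat (cnt (j + 1)) * qq ^ j + of_nat (cnt (N + 1 - j)) * qq ^ j) = (\<Sum>j\<le>N. of_nat (card S) * qq ^ j)"
    by (intro sum.cong refl) simp
  then show ?thesis unfolding 1 2 sum.distrib sum_distrib_left[symmetric] .
qed

lemma sum_L_theta:
  shows "(\<Sum>\<mu>\<in>R. L \<theta> \<mu>) = L \<theta> 0 * (L \<theta> 0 - of_nat (card S)) + (L \<theta> 0 div qq) * ((1 - qq ^ (N + 1)) div (1 - qq))"
proof -
  define H where "H = (\<Sum>g\<in>P. qq ^ (height S g - 1))"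
  define K where "K = (\<Sum>g\<in>P. qq ^ (N - height S g))"
  define G where "G = (\<Sum>j\<le>N. qq ^ j)"
  define r :: "int poly" where "r = of_nat (card S)"
  define A where "A = L \<theta> 0"
  have geo: "1 - qq ^ (N + 1) = (1 - qq) * G"
    unfolding G_def using one_diff_power_eq[of qq "N + 1"] by (simp add: lessThan_Suc_atMost)
  have "1 - qq \<noteq> 0" "qq \<noteq> 0" by (simp_all add: qq_def one_pCons)
  then have G: "(1 - qq ^ (N + 1)) div (1 - qq) = G" unfolding geo by simp
  have A: "A = r + (qq - 1) * H" unfolding A_def H_def r_def by (rule L_theta_0)
  have dual: "H + qq * K = r * G" unfolding H_def K_def r_def G_def by (rule height_polynomial_duality)
  have H: "H = r * G - qq * K" using dual by (metis add_diff_cancel_right')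
  \<comment> \<open>Eliminating \<open>H\<close> by duality exhibits \<open>A\<close> as a multiple
    of q, so division by \<open>qq\<close> is exact.\<close>
  have "A = r - r * ((1 - qq) * G) + qq * (1 - qq) * K" unfolding A H by (simp add: algebra_simps)
  also have "\<dots> = qq * (r * qq ^ N + (1 - qq) * K)" unfolding geo[symmetric] by (simp add: algebra_simps)
  finally have A1: "A = qq * (r * qq ^ N + (1 - qq) * K)" .
  have dq: "A div qq = r * qq ^ N + (1 - qq) * K" unfolding A1 using \<open>qq \<noteq> 0\<close> by simp
  have e1: "K + qq ^ N * H = (r * qq ^ N + (1 - qq) * K) * G"
  proof -
    have "(r * qq ^ N + (1 - qq) * K) * G = qq ^ N * (r * G) + ((1 - qq) * G) * K" by (simp add: algebra_simps)
    also have "\<dots> = qq ^ N * (H + qq * K) + (1 - qq ^ (N + 1)) * K" unfolding dual geo ..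
    also have "\<dots> = K + qq ^ N * H" by (simp add: algebra_simps)
    finally show ?thesis by simp
  qed
  have "(qq - 1) * H = A - r" using A by simp
  then have e3: "H * ((qq - 1) * A) = A * (A - r)" by (metis mult.assoc mult.commute)
  have "(\<Sum>\<mu>\<in>R. L \<theta> \<mu>) = K + H * (qq ^ N + (qq - 1) * A)"
    unfolding A_def K_def H_def by (rule sum_L_theta_roots)
  also have "\<dots> = (K + qq ^ N * H) + H * ((qq - 1) * A)"
    by (simp only: distrib_left mult.commute[of H "qq ^ N"] add.assoc)
  finally have "(\<Sum>\<mu>\<in>R. L \<theta> \<mu>) = A * (A - r) + (A div qq) * ((1 - qq ^ (N + 1)) div (1 - qq))"
    unfolding e1 e3 G dq by (simp only: add.commute)
  then show ?thesis unfolding A_def r_def .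
qed

end

theorem theorem2p2:
  fixes R :: "'a::euclidean_space set" and S :: "'a set" and \<theta> :: 'a
  assumes "root_system R" and "irreducible_rs R" and "is_base R S"
    and "highest_root R S \<theta>"
  defines "r \<equiv> card S" and "h \<equiv> coxeter_number S \<theta>"
    and "m0 \<equiv> lusztig_q R S \<theta> 0"
  shows "(\<Sum>\<mu>\<in>insert 0 R. lusztig_q R S \<theta> \<mu>)
           = m0 * (m0 - of_nat r + 1)
             + (m0 div [:0, 1:]) * ((1 - [:0, 1:] ^ h) div (1 - [:0, 1:]))
       \<and> (\<Sum>\<mu>\<in>insert 0 R. of_nat (if \<mu> = 0 then r else 1) * lusztig_q R S \<theta> \<mu>)
           = m0 ^ 2
             + (m0 div [:0, 1:]) * ((1 - [:0, 1:] ^ h) div (1 - [:0, 1:]))"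
proof -
  interpret irr_roots R S \<theta>
    using assms(1-4) by unfold_locales
  define E where "E = (m0 div [:0, 1:]) * ((1 - [:0, 1:] ^ h) div (1 - [:0, 1:]))"
  have roots: "(\<Sum>\<mu>\<in>R. L \<theta> \<mu>) = m0 * (m0 - of_nat r) + E"
    using sum_L_theta unfolding E_def m0_def r_def h_def coxeter_number_def qq_def .
  have R0: "0 \<notin> R" using root_nonzero[of 0] by auto
  have "(\<Sum>\<mu>\<in>insert 0 R. L \<theta> \<mu>) = m0 + (\<Sum>\<mu>\<in>R. L \<theta> \<mu>)"
    using finite_R R0 by (simp add: m0_def)
  also have "\<dots> = m0 * (m0 - of_nat r + 1) + E" unfolding roots by (simp add: algebra_simps)
  finally have 1: "(\<Sum>\<mu>\<in>insert 0 R. L \<theta> \<mu>) = m0 * (m0 - of_nat r + 1) + E" .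
  \<comment> \<open>The two identities differ only in the weight given to
    \<open>\<mu> = 0\<close>.\<close>
  have "(\<Sum>\<mu>\<in>R. of_nat (if \<mu> = 0 then r else 1) * L \<theta> \<mu>) = (\<Sum>\<mu>\<in>R. L \<theta> \<mu>)"
    using R0 by (intro sum.cong refl) auto
  then have "(\<Sum>\<mu>\<in>insert 0 R. of_nat (if \<mu> = 0 then r else 1) * L \<theta> \<mu>) = of_nat r * m0 + (\<Sum>\<mu>\<in>R. L \<theta> \<mu>)"
    using finite_R R0 by (simp add: m0_def)
  also have "\<dots> = m0 ^ 2 + E" unfolding roots by (simp add: algebra_simps power2_eq_square)
  finally show ?thesis using 1 unfolding E_def by blast
qed

end
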